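(* Let $G$ be a countable connected graph and let $\ell:E(G)\to\mathbb{R}_{>0}$ be such that $\sum_{e\in E(G)}\ell(e)<\infty$. Then $|G|_\ell\approx ETOP(G)$; that is, the identity on $G$ extends to a homeomorphism between $|G|_\ell$ and $ETOP(G)$ (there is a homeomorphism $h:|G|_\ell\to ETOP(G)$ that commutes with the canonical maps of $G$ into the two spaces).
   Context: A graph $G$ is viewed as a 1-complex: each edge is a homeomorphic copy of the real unit interval. Given $\ell:E(G)\to\mathbb{R}_{>0}$, fix for each edge $e$ a homeomorphism $\sigma_e:e\to[0,\ell(e)]$. A half-edge is a connected subset $f$ of an edge $e$; if its endpoints are $a,b$, its length is $|\sigma_e(a)-\sigma_e(b)|$. For points $x,y$ of $G$ let $d_\ell(x,y)=\inf\{\ell(P): P \text{ is an } x\text{--}y \text{ arc in the 1-complex } G\}$, where $\ell(P)$ is the sum of the lengths of the edges and maximal half-edges in $P$. Identifying any two vertices $x,x'$ with $d_\ell(x,x')=0$ yields a metric space $(\overline{G},d_\ell)$, and $|G|_\ell$ denotes its completion. A ray is a 1-way infinite path. Two rays of $G$ are edge-equivalent if no finite set of edges separates them; the equivalence classes are the edge-ends, and $\Omega'(G)$ denotes the set of edge-ends. $ETOP'(G)$ is the space $G\cup\Omega'(G)$ with the topology generated by the open subsets of the interiors of edges together with all sets $C\cup\Omega'(C)\cup E'(C)$, where $S\subset E(G)$ is finite, $C$ is a component of $G-S$, $\Omega'(C)$ is the set of edge-ends having a ray in $C$, and $E'(C)$ is any union of half-edges $(z,y]$, one for every edge $e=xy\in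 S$ with $y$ lying in $C$ ($z$ an inner point of $e$). $ETOP(G)$ is the quotient of $ETOP'(G)$ obtained by identifying any two points having the same open neighbourhoods. *)

theory Defs
  imports "HOL-Analysis.Analysis"
begin

section \<open>Graphs, components, rays\<close>

type_synonym 'v graph = "'v set \<times> 'v set set"

abbreviation verts :: "'v graph \<Rightarrow> 'v set" where "verts \<equiv> fst"
abbreviation edges :: "'v graph \<Rightarrow> 'v set set" where "edges \<equiv> snd"

definition simple_graph :: "'v graph \<Rightarrow> bool" where
  "simple_graph G \<longleftrightarrow> (\<forall>e\<in>edges G. \<exists>x\<in>verts G. \<exists>y\<in>verts G. x \<noteq> y \<and> e = {x, y})"

definition linked :: "'v graph \<Rightarrow> 'v \<Rightarrow> 'v \<Rightarrow> bool" where
  "linked G x y \<longleftrightarrow> (x, y) \<in> {(u, v). {u, v} \<in> edges G}\<^sup>*"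

definition connected_graph :: "'v graph \<Rightarrow> bool" where
  "connected_graph G \<longleftrightarrow> verts G \<noteq> {} \<and> (\<forall>x\<in>verts G. \<forall>y\<in>verts G. linked G x y)"

definition del_edges :: "'v graph \<Rightarrow> 'v set set \<Rightarrow> 'v graph" where
  "del_edges G S = (verts G, edges G - S)"

definition graph_components :: "'v graph \<Rightarrow> 'v graph set" where
  "graph_components G =
     {(U, {e \<in> edges G. e \<subseteq> U}) | U. \<exists>x\<in>verts G. U = {y. linked G x y}}"

text \<open>A ray is given by its sequence of vertices, beginning with its vertex of degree one.\<close>

definition rays :: "'v graph \<Rightarrow> (nat \<Rightarrow> 'v) set" where
  "rays G = {r. inj r \<and> range r \<subseteq> verts G \<and> (\<forall>n. {r n, r (Suc n)} \<in> edges G)}"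

definition tail_in :: "'v graph \<Rightarrow> (nat \<Rightarrow> 'v) \<Rightarrow> bool" where
  "tail_in C r \<longleftrightarrow> (\<exists>N. (\<lambda>n. r (N + n)) \<in> rays C)"

text \<open>Separation concerns tails: two rays that share a vertex may well be separated by finitely
  many edges (for instance the two halves of a double ray).\<close>

definition separates_rays ::
    "'v graph \<Rightarrow> 'v set set \<Rightarrow> (nat \<Rightarrow> 'v) \<Rightarrow> (nat \<Rightarrow> 'v) \<Rightarrow> bool" where
  "separates_rays G S r r' \<longleftrightarrow>
     (\<exists>C\<in>graph_components (del_edges G S). \<exists>C'\<in>graph_components (del_edges G S).
        C \<noteq> C' \<and> tail_in C r \<and> tail_in C' r')"

definition edge_equiv :: "'v graph \<Rightarrow> ((nat \<Rightarrow> 'v) \<times> (nat \<Rightarrow> 'v)) set" where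
  "edge_equiv G = {(r, r'). r \<in> rays G \<and> r' \<in> rays G \<and>
     \<not> (\<exists>S. finite S \<and> S \<subseteq> edges G \<and> separates_rays G S r r')}"

definition edge_ends :: "'v graph \<Rightarrow> (nat \<Rightarrow> 'v) set set" where
  "edge_ends G = rays G // edge_equiv G"


section \<open>The 1-complex of a graph\<close>

text \<open>Points are given by barycentric coordinates: the point of an edge \<open>e = {x, y}\<close> at fraction
  \<open>t\<close> of the way from \<open>x\<close> to \<open>y\<close> is the function with value \<open>1 - t\<close> at \<open>x\<close>, value \<open>t\<close> at \<open>y\<close>, and
  \<open>0\<close> elsewhere. With the product topology on functions, \<open>edge_pts e\<close> is a copy of the unit
  interval for every two-element set \<open>e\<close>, and distinct edges meet only in common endvertices.\<close>

definition vertex_pt :: "'v \<Rightarrow> 'v \<Rightarrow> real" where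
  "vertex_pt v = indicator {v}"

definition edge_pts :: "'v set \<Rightarrow> ('v \<Rightarrow> real) set" where
  "edge_pts e = {p. (\<forall>v. 0 \<le> p v) \<and> (\<forall>v. v \<notin> e \<longrightarrow> p v = 0) \<and> (\<Sum>v\<in>e. p v) = 1}"

definition edge_interior :: "'v set \<Rightarrow> ('v \<Rightarrow> real) set" where
  "edge_interior e = edge_pts e - vertex_pt ` e"

definition points :: "'v graph \<Rightarrow> ('v \<Rightarrow> real) set" where
  "points G = vertex_pt ` verts G \<union> (\<Union>e\<in>edges G. edge_pts e)"

text \<open>The topology of the 1-complex is the weak one, not that of the ambient function space.\<close>

definition complex_topology :: "'v graph \<Rightarrow> ('v \<Rightarrow> real) topology" where
  "complex_topology G = topology (\<lambda>U. U \<subseteq> points G \<and>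
     (\<forall>e\<in>edges G. openin (top_of_set (edge_pts e)) (U \<inter> edge_pts e)))"

lemma openin_complex_topology:
  "openin (complex_topology G) U \<longleftrightarrow> U \<subseteq> points G \<and>
     (\<forall>e\<in>edges G. openin (top_of_set (edge_pts e)) (U \<inter> edge_pts e))"
proof -
  have "istopology (\<lambda>U. U \<subseteq> points G \<and>
     (\<forall>e\<in>edges G. openin (top_of_set (edge_pts e)) (U \<inter> edge_pts e)))"
    unfolding istopology_def
  proof (intro conjI allI impI ballI)
    fix S T e
    assume S: "S \<subseteq> points G \<and> (\<forall>e\<in>edges G. openin (top_of_set (edge_pts e)) (S \<inter> edge_pts e))"
      and T: "T \<subseteq> points G \<and> (\<forall>e\<in>edges G. openin (top_of_set (edge_pts e)) (T \<inter> edge_pts e))"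
      and e: "e \<in> edges G"
    have "openin (top_of_set (edge_pts e)) (S \<inter> edge_pts e)"
      using S e by (elim conjE) (erule bspec)
    moreover have "openin (top_of_set (edge_pts e)) (T \<inter> edge_pts e)"
      using T e by (elim conjE) (erule bspec)
    ultimately have "openin (top_of_set (edge_pts e)) ((S \<inter> edge_pts e) \<inter> (T \<inter> edge_pts e))"
      by (rule openin_Int)
    moreover have "(S \<inter> edge_pts e) \<inter> (T \<inter> edge_pts e) = S \<inter> T \<inter> edge_pts e"
      by (rule set_eqI) (simp only: Int_iff, argo)
    ultimately show "openin (top_of_set (edge_pts e)) (S \<inter> T \<inter> edge_pts e)"
      by (simp only:)
  next
    fix K e
    assume K: "\<forall>S\<in>K. S \<subseteq> points G \<and>
        (\<forall>e\<in>edges G. openin (top_of_set (edge_pts e)) (S \<inter> edge_pts e))"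
      and e: "e \<in> edges G"
    have "openin (top_of_set (edge_pts e)) (\<Union>S\<in>K. S \<inter> edge_pts e)"
    proof (rule openin_Union)
      fix U assume "U \<in> (\<lambda>S. S \<inter> edge_pts e) ` K"
      then obtain S where "S \<in> K" and U: "U = S \<inter> edge_pts e"
        by (rule imageE)
      then show "openin (top_of_set (edge_pts e)) U"
        using K e unfolding U by (meson bspec)
    qed
    then show "openin (top_of_set (edge_pts e)) (\<Union>K \<inter> edge_pts e)"
      by (simp only: Int_Union2)
  next
    fix S T
    assume "S \<subseteq> points G \<and> (\<forall>e\<in>edges G. openin (top_of_set (edge_pts e)) (S \<inter> edge_pts e))"
    then show "S \<inter> T \<subseteq> points G"
      by (meson inf.coboundedI1)
  next
    fix K
    assume "\<forall>S\<in>K. S \<subseteq> points G \<and>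
        (\<forall>e\<in>edges G. openin (top_of_set (edge_pts e)) (S \<inter> edge_pts e))"
    then show "\<Union>K \<subseteq> points G"
      by (meson Union_least)
  qed
  then show ?thesis
    by (simp add: complex_topology_def)
qed

text \<open>\<open>P\<close> is (the point set of) an \<open>x\<close>--\<open>y\<close> arc; the trivial arc is admitted when \<open>x = y\<close>.\<close>

definition is_arc ::
    "'v graph \<Rightarrow> ('v \<Rightarrow> real) \<Rightarrow> ('v \<Rightarrow> real) \<Rightarrow> ('v \<Rightarrow> real) set \<Rightarrow> bool" where
  "is_arc G x y P \<longleftrightarrow>
     (x = y \<and> x \<in> points G \<and> P = {x}) \<or>
     (\<exists>g. embedding_map (top_of_set {0..1::real}) (complex_topology G) g \<and>
          g 0 = x \<and> g 1 = y \<and> P = g ` {0..1})"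


section \<open>The metric completion given by edge lengths\<close>

text \<open>The parameter \<open>\<sigma>\<close> assigns to each edge \<open>e\<close> a homeomorphism from \<open>edge_pts e\<close> onto
  \<open>{0..l e}\<close>; all lengths are measured through it. A half-edge of \<open>e\<close> with endpoints \<open>a\<close> and \<open>b\<close>
  is a connected set whose closure is the segment of \<open>e\<close> between \<open>a\<close> and \<open>b\<close>.\<close>

definition half_edge_length ::
    "('v set \<Rightarrow> ('v \<Rightarrow> real) \<Rightarrow> real) \<Rightarrow> 'v set \<Rightarrow> ('v \<Rightarrow> real) set \<Rightarrow> real" where
  "half_edge_length \<sigma> e f = (THE r. \<exists>a\<in>edge_pts e. \<exists>b\<in>edge_pts e.
     closure f = {p \<in> edge_pts e. \<sigma> e p \<in> closed_segment (\<sigma> e a) (\<sigma> e b)} \<and>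
     r = \<bar>\<sigma> e a - \<sigma> e b\<bar>)"

text \<open>The edges contained in \<open>P\<close> and the maximal half-edges in \<open>P\<close> are the connected components of
  the sets \<open>P \<inter> edge_pts e\<close>. An arc, being compact, meets the interiors of only finitely many
  edges, so that only finitely many summands are nonzero (an edge that \<open>P\<close> meets in an endvertex
  only contributes a trivial component of length zero).\<close>

definition arc_length ::
    "'v graph \<Rightarrow> ('v set \<Rightarrow> ('v \<Rightarrow> real) \<Rightarrow> real) \<Rightarrow> ('v \<Rightarrow> real) set \<Rightarrow> real" where
  "arc_length G \<sigma> P =
     (\<Sum>\<^sub>\<infinity>(e, f)\<in>(SIGMA e:edges G. components (P \<inter> edge_pts e)). half_edge_length \<sigma> e f)"

definition len_dist ::
    "'v graph \<Rightarrow> ('v set \<Rightarrow> ('v \<Rightarrow> real) \<Rightarrow> real) \<Rightarrow> ('v \<Rightarrow> real) \<Rightarrow> ('v \<Rightarrow> real) \<Rightarrow> real" where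
  "len_dist G \<sigma> x y = Inf {arc_length G \<sigma> P | P. is_arc G x y P}"

definition vertex_ident ::
    "'v graph \<Rightarrow> ('v set \<Rightarrow> ('v \<Rightarrow> real) \<Rightarrow> real) \<Rightarrow> (('v \<Rightarrow> real) \<times> ('v \<Rightarrow> real)) set" where
  "vertex_ident G \<sigma> = {(p, q). p \<in> points G \<and> q \<in> points G \<and>
     (p = q \<or> p \<in> vertex_pt ` verts G \<and> q \<in> vertex_pt ` verts G \<and> len_dist G \<sigma> p q = 0)}"

definition ident_points ::
    "'v graph \<Rightarrow> ('v set \<Rightarrow> ('v \<Rightarrow> real) \<Rightarrow> real) \<Rightarrow> ('v \<Rightarrow> real) set set" where
  "ident_points G \<sigma> = points G // vertex_ident G \<sigma>"

definition ident_class ::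
    "'v graph \<Rightarrow> ('v set \<Rightarrow> ('v \<Rightarrow> real) \<Rightarrow> real) \<Rightarrow> ('v \<Rightarrow> real) \<Rightarrow> ('v \<Rightarrow> real) set" where
  "ident_class G \<sigma> p = vertex_ident G \<sigma> `` {p}"

text \<open>Distances do not depend on the representatives.\<close>

definition ident_dist ::
    "'v graph \<Rightarrow> ('v set \<Rightarrow> ('v \<Rightarrow> real) \<Rightarrow> real) \<Rightarrow>
     ('v \<Rightarrow> real) set \<Rightarrow> ('v \<Rightarrow> real) set \<Rightarrow> real" where
  "ident_dist G \<sigma> A B = len_dist G \<sigma> (SOME a. a \<in> A) (SOME b. b \<in> B)"

text \<open>\<open>m\<close> together with the isometric embedding \<open>i\<close> is a completion of the metric space
  \<open>(M, d)\<close>. Completions are unique up to a unique isometry compatible with the embeddings, and one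
  exists by \<open>metric_completion\<close> in theory Urysohn.\<close>

definition is_completion ::
    "'a set \<Rightarrow> ('a \<Rightarrow> 'a \<Rightarrow> real) \<Rightarrow> 'c metric \<Rightarrow> ('a \<Rightarrow> 'c) \<Rightarrow> bool" where
  "is_completion M d m i \<longleftrightarrow>
     mcomplete_of m \<and> i \<in> M \<rightarrow> mspace m \<and>
     mtopology_of m closure_of (i ` M) = mspace m \<and>
     (\<forall>x\<in>M. \<forall>y\<in>M. mdist m (i x) (i y) = d x y)"


section \<open>The edge-end topology\<close>

text \<open>The half-edge \<open>(z, y]\<close> of \<open>e\<close>, for an inner point \<open>z\<close> and an endvertex \<open>y\<close> of \<open>e\<close>: the
  coordinate at \<open>y\<close> increases along \<open>e\<close> towards \<open>y\<close>.\<close>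

definition half_open_edge :: "'v set \<Rightarrow> ('v \<Rightarrow> real) \<Rightarrow> 'v \<Rightarrow> ('v \<Rightarrow> real) set" where
  "half_open_edge e z y = {p \<in> edge_pts e. z y < p y}"

definition ends_in :: "'v graph \<Rightarrow> 'v graph \<Rightarrow> (nat \<Rightarrow> 'v) set set" where
  "ends_in G C = {\<omega> \<in> edge_ends G. \<exists>r\<in>\<omega>. r \<in> rays C}"

text \<open>The family \<open>z\<close> picks the inner points of the half-edges. If both endvertices of an edge of
  \<open>S\<close> lie in \<open>C\<close>, there is one half-edge at each of them.\<close>

definition basic_nbhd ::
    "'v graph \<Rightarrow> 'v set set \<Rightarrow> 'v graph \<Rightarrow> ('v set \<Rightarrow> 'v \<Rightarrow> 'v \<Rightarrow> real) \<Rightarrow>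
     (('v \<Rightarrow> real) + (nat \<Rightarrow> 'v) set) set" where
  "basic_nbhd G S C z =
     Inl ` points C \<union> Inr ` ends_in G C \<union>
     Inl ` (\<Union>e\<in>S. \<Union>y\<in>e \<inter> verts C. half_open_edge e (z e y) y)"

definition ETOP_pre :: "'v graph \<Rightarrow> (('v \<Rightarrow> real) + (nat \<Rightarrow> 'v) set) topology" where
  "ETOP_pre G = topology_generated_by
     ({Inl ` U | U e. e \<in> edges G \<and> openin (top_of_set (edge_interior e)) U} \<union>
      {basic_nbhd G S C z | S C z. finite S \<and> S \<subseteq> edges G \<and>
         C \<in> graph_components (del_edges G S) \<and>
         (\<forall>e\<in>S. \<forall>y\<in>e \<inter> verts C. z e y \<in> edge_interior e)})"

text \<open>The quotient that identifies points with the same open neighbourhoods; by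
  \<open>quotient_map_Kolmogorov_quotient\<close> the library's choice of representatives
  realises it.\<close>

definition ETOP :: "'v graph \<Rightarrow> (('v \<Rightarrow> real) + (nat \<Rightarrow> 'v) set) topology" where
  "ETOP G = subtopology (ETOP_pre G) (Kolmogorov_quotient (ETOP_pre G) ` topspace (ETOP_pre G))"

definition ETOP_map :: "'v graph \<Rightarrow> ('v \<Rightarrow> real) \<Rightarrow> ('v \<Rightarrow> real) + (nat \<Rightarrow> 'v) set" where
  "ETOP_map G p = Kolmogorov_quotient (ETOP_pre G) (Inl p)"

end

theory Submission
  imports Defs
begin

text \<open>Why the theorem holds. For a finite edge set \<open>S\<close> let \<open>tail S\<close> be the total length of the edges
  outside \<open>S\<close>. Summability makes \<open>tail S\<close> as small as desired. Two facts link this to the metric.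

  Vertices in one component of \<open>G - S\<close> are at distance at most \<open>tail S\<close>, because some arc between
  them uses only edges outside \<open>S\<close>, each at most once (\<open>mdist_linked_le\<close>).

  Conversely, an arc that leaves a basic neighbourhood of a component of \<open>G - S\<close> contains a fixed
  segment of one of the finitely many edges in \<open>S\<close>: if it missed an inner point of each such
  segment, cutting the neighbourhood off at these points would disconnect it
  (\<open>connected_crosses_cut\<close>). So its length is bounded below (\<open>mdist_nbhd_ge\<close>). The same argument
  with a single edge treats inner points of edges (\<open>mdist_edge_interior_ge\<close>).

  The vertices of a ray eventually stay in one component of \<open>G - S\<close> for every \<open>S\<close>. Hence they form
  a Cauchy sequence, and mapping the end of the ray to its limit extends the inclusion of \<open>G\<close> to a
  map \<open>to_compl\<close> from the points of \<open>ETOP'\<close> to the completion. By the two facts, the open sets of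
  \<open>ETOP'\<close> are exactly those that are open for the distance pulled back along this map
  (\<open>openin_ETOP_pre_iff\<close>). The pulled back distance cannot distinguish two points precisely if they
  have the same open neighbourhoods, so the quotient \<open>ETOP\<close> is embedded in the completion.

  It remains to see that \<open>to_compl\<close> is surjective (\<open>to_compl_surj\<close>). A point of the completion away
  from all vertices is a limit of points of finitely many edges, and these are compact. If a point
  is a limit of vertices, the vertices close to it lie in one component of \<open>G - S\<close>, for each \<open>S\<close>.
  These components decrease as \<open>S\<close> grows. Either they have a common vertex, which is then the limit,
  or a walk through all of them visits every vertex only finitely often and so contains a ray, whose
  end is mapped to the limit.\<close>

lemma finite_uniform_bound:
  assumes "finite A" "\<And>a. a \<in> A \<Longrightarrow> \<exists>\<delta>>0. \<forall>b. R a b \<longrightarrow> \<delta> \<le> (f b :: real)"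
  shows "\<exists>\<delta>>0. \<forall>a\<in>A. \<forall>b. R a b \<longrightarrow> \<delta> \<le> f b"
  using assms
proof (induction A)
  case empty
  then show ?case by (auto intro: exI[of _ 1])
next
  case (insert a A)
  then obtain \<delta> \<delta>' where "0 < \<delta>" "\<forall>b. R a b \<longrightarrow> \<delta> \<le> f b" "0 < \<delta>'" "\<forall>c\<in>A. \<forall>b. R c b \<longrightarrow> \<delta>' \<le> f b"
    by (metis insert_iff)
  then show ?case by (intro exI[of _ "min \<delta> \<delta>'"]) (auto simp: min_le_iff_disj)
qed

section \<open>Joining arcs\<close>

text \<open>The set \<open>K\<close> records where an arc runs. This is all that a bound on its length needs, and it
  makes existence of arcs a transitive relation.\<close>

definition arc_within :: "'a topology \<Rightarrow> 'a set \<Rightarrow> 'a \<Rightarrow> 'a \<Rightarrow> bool" where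
  "arc_within X K x y \<longleftrightarrow> (x = y \<and> x \<in> topspace X \<inter> K) \<or>
     (\<exists>h. continuous_map (top_of_set {0..1::real}) X h \<and> inj_on h {0..1} \<and>
          h 0 = x \<and> h 1 = y \<and> h ` {0..1} \<subseteq> K)"

lemma arc_within_subset: "arc_within X K x y \<Longrightarrow> K \<subseteq> L \<Longrightarrow> arc_within X L x y"
  unfolding arc_within_def by blast

lemma continuous_map_affine_reparametrization:
  fixes f :: "real \<Rightarrow> 'a"
  assumes "continuous_map (top_of_set {0..1}) X f"
    and "\<And>t. t \<in> S \<Longrightarrow> a + b * t \<in> {0..1}"
  shows "continuous_map (top_of_set S) X (\<lambda>t. f (a + b * t))"
proof -
  have "continuous_map (top_of_set S) (top_of_set {0..1}) (\<lambda>t. a + b * t)"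
    using assms(2) by (auto intro!: continuous_intros)
  from continuous_map_compose[OF this assms(1)] show ?thesis by (simp add: o_def)
qed

lemma arc_within_subarc:
  assumes f: "continuous_map (top_of_set {0..1::real}) X f" "inj_on f {0..1}"
    and "f ` {0..1} \<subseteq> K" and "a \<in> {0..1}" "b \<in> {0..1}"
  shows "arc_within X K (f a) (f b)"
proof (cases "a = b")
  case True
  have "f a \<in> topspace X"
    using continuous_map_image_subset_topspace[OF f(1)] assms(4) by auto
  then show ?thesis using True assms by (auto simp: arc_within_def)
next
  case False
  have in01: "a + (b - a) * t \<in> {0..1}" if "t \<in> {0..1}" for t
  proof -
    have "a + (b - a) * t = (1 - t) * a + t * b" by (simp add: algebra_simps)
    moreover have "(1 - t) * a + t * b \<le> (1 - t) * 1 + t * 1"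
      using that assms(4,5) by (intro add_mono mult_left_mono) auto
    ultimately show ?thesis using that assms(4,5) by simp
  qed
  let ?h = "\<lambda>t. f (a + (b - a) * t)"
  have "continuous_map (top_of_set {0..1}) X ?h"
    by (rule continuous_map_affine_reparametrization[OF f(1) in01])
  moreover have "inj_on ?h {0..1}"
  proof (rule inj_onI)
    fix s t assume st: "s \<in> {0..1::real}" "t \<in> {0..1}" and "?h s = ?h t"
    then have "a + (b - a) * s = a + (b - a) * t"
      using inj_onD[OF f(2)] in01 by blast
    then show "s = t" using False by simp
  qed
  moreover have "?h ` {0..1} \<subseteq> K" using in01 assms(3) by blast
  ultimately show ?thesis unfolding arc_within_def by (intro disjI2 exI[of _ ?h]) simp
qed

text \<open>Two arcs with a common endpoint may intersect elsewhere. One follows the first arc only up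
  to the first point of the second arc, and then continues along the second arc.\<close>

lemma arc_within_trans:
  assumes X: "Hausdorff_space X" and "arc_within X K x y" "arc_within X L y z"
  shows "arc_within X (K \<union> L) x z"
proof (cases "x = y \<or> y = z")
  case True
  then show ?thesis using assms(2,3) arc_within_subset by (metis Un_upper1 Un_upper2)
next
  case False
  let ?I = "{0..1::real}"
  obtain f where f: "continuous_map (top_of_set ?I) X f" "inj_on f ?I" "f 0 = x" "f 1 = y"
      "f ` ?I \<subseteq> K"
    using assms(2) False unfolding arc_within_def by blast
  obtain g where g: "continuous_map (top_of_set ?I) X g" "inj_on g ?I" "g 0 = y" "g 1 = z"
      "g ` ?I \<subseteq> L"
    using assms(3) False unfolding arc_within_def by blast
  \<comment> \<open>The two arcs meet in \<open>f t0 = g s0\<close>, where \<open>t0\<close> is the first time at which \<open>f\<close> hits \<open>g\<close>.\<close>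
  define A where "A = {t \<in> ?I. f t \<in> g ` ?I}"
  have "compactin X (g ` ?I)"
    by (rule image_compactin[OF _ g(1)]) (simp add: compactin_subtopology)
  then have "closedin X (g ` ?I)" by (rule compactin_imp_closedin[OF X])
  from closedin_continuous_map_preimage[OF f(1) this]
  have "closed A"
    unfolding A_def using closedin_closed_trans[of ?I "{t \<in> ?I. f t \<in> g ` ?I}"] by simp
  have "1 \<in> A" unfolding A_def using f(4) g(3) by force
  define t0 where "t0 = Inf A"
  have bdd: "bdd_below A" unfolding A_def by (rule bdd_belowI[of _ 0]) auto
  have t0: "t0 \<in> A"
    unfolding t0_def using closed_contains_Inf[OF _ bdd \<open>closed A\<close>] \<open>1 \<in> A\<close> by blast
  have first: "f t \<notin> g ` ?I" if "0 \<le> t" "t < t0" for t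
  proof
    assume "f t \<in> g ` ?I"
    with that t0 have "t \<in> A" unfolding A_def by auto
    then show False using cInf_lower[OF _ bdd] that(2) t0_def by fastforce
  qed
  obtain s0 where s0: "s0 \<in> ?I" "g s0 = f t0" and t01: "t0 \<in> ?I"
    using t0 unfolding A_def by auto
  show ?thesis
  proof (cases "t0 = 0 \<or> s0 = 1")
    case True
    then show ?thesis
    proof
      assume "t0 = 0"
      then have "arc_within X L x z"
        using arc_within_subarc[OF g(1,2,5) s0(1), of 1] s0 f g by simp
      then show ?thesis by (rule arc_within_subset) simp
    next
      assume "s0 = 1"
      then have "arc_within X K x z"
        using arc_within_subarc[OF f(1,2,5) _ t01, of 0] s0 f g by simp
      then show ?thesis by (rule arc_within_subset) simp
    qed
  next
    case False
    then have pos: "0 < t0" "s0 < 1" using t01 s0 by auto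
    define h where "h t = (if t \<le> 1/2 then f (0 + (2 * t0) * t)
        else g ((2 * s0 - 1) + (2 - 2 * s0) * t))" for t :: real
    have F: "0 + (2 * t0) * t \<in> ?I" if "t \<in> {0..1/2}" for t
    proof -
      have "(2 * t0) * t \<le> (2 * t0) * (1/2)" using that pos by (intro mult_left_mono) auto
      then have "(2 * t0) * t \<le> 1" using t01 by simp
      then show ?thesis using that pos by simp
    qed
    have G: "(2 * s0 - 1) + (2 - 2 * s0) * t \<in> {s0..1}" if "t \<in> {1/2..1}" for t
    proof -
      have "(2 - 2 * s0) * (1/2) \<le> (2 - 2 * s0) * t" "(2 - 2 * s0) * t \<le> (2 - 2 * s0) * 1"
        using that pos by (intro mult_left_mono; simp)+
      then show ?thesis by (auto simp: algebra_simps)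
    qed
    have G': "(2 * s0 - 1) + (2 - 2 * s0) * t \<in> ?I" if "t \<in> {1/2..1}" for t
      using G[OF that] s0 by auto
    have "continuous_map (top_of_set ?I) X h"
      unfolding h_def
    proof (rule continuous_map_cases_le)
      have *: "subtopology (top_of_set ?I) {t. t \<in> topspace (top_of_set ?I) \<and> t \<le> 1/2}
          = top_of_set {0..1/2}"
        "subtopology (top_of_set ?I) {t. t \<in> topspace (top_of_set ?I) \<and> 1/2 \<le> t}
          = top_of_set {1/2..1}"
        by (auto simp: subtopology_subtopology intro!: arg_cong[of _ _ top_of_set])
      show "continuous_map (subtopology (top_of_set ?I) {t. t \<in> topspace (top_of_set ?I) \<and> t \<le> 1/2})
          X (\<lambda>t. f (0 + 2 * t0 * t))"
        unfolding * by (rule continuous_map_affine_reparametrization[OF f(1) F])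
      show "continuous_map (subtopology (top_of_set ?I) {t. t \<in> topspace (top_of_set ?I) \<and> 1/2 \<le> t})
          X (\<lambda>t. g ((2 * s0 - 1) + (2 - 2 * s0) * t))"
        unfolding * by (rule continuous_map_affine_reparametrization[OF g(1) G'])
    next
      fix t assume t: "t = (1/2 :: real)"
      have "(2 * s0 - 1) + (2 - 2 * s0) * (1/2) = s0" "0 + 2 * t0 * (1/2) = t0"
        by (simp_all add: field_simps)
      then show "f (0 + 2 * t0 * t) = g ((2 * s0 - 1) + (2 - 2 * s0) * t)"
        using s0(2) by (simp only: t)
    qed auto
    moreover have "inj_on h ?I"
    proof (rule linorder_inj_onI)
      fix s t assume st: "s < t" "s \<in> ?I" "t \<in> ?I"
      consider "t \<le> 1/2" | "1/2 < s" | "s \<le> 1/2" "1/2 < t" by linarith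
      then show "h s \<noteq> h t"
      proof cases
        case 1
        then have "0 + (2 * t0) * s \<noteq> 0 + (2 * t0) * t" using st pos by simp
        then have "f (0 + (2 * t0) * s) \<noteq> f (0 + (2 * t0) * t)"
          using inj_onD[OF f(2)] F[of s] F[of t] 1 st by fastforce
        then show ?thesis using 1 st by (simp add: h_def)
      next
        case 2
        then have "(2 * s0 - 1) + (2 - 2 * s0) * s \<noteq> (2 * s0 - 1) + (2 - 2 * s0) * t"
          using st pos by simp
        then have "g ((2 * s0 - 1) + (2 - 2 * s0) * s) \<noteq> g ((2 * s0 - 1) + (2 - 2 * s0) * t)"
          using inj_onD[OF g(2)] G'[of s] G'[of t] 2 st by fastforce
        then show ?thesis using 2 st by (simp add: h_def)
      next
        case 3
        let ?u = "(2 * s0 - 1) + (2 - 2 * s0) * t"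
        have ht: "h t = g ?u" "?u \<in> ?I" using 3 st G'[of t] by (simp_all add: h_def)
        show ?thesis
        proof (cases "s = 1/2")
          case True
          have "h (1/2) = f t0" by (simp add: h_def)
          with True have "h s = g s0" using s0(2) by (simp only:)
          moreover have "?u > s0"
          proof -
            have "(2 - 2 * s0) * (1/2) < (2 - 2 * s0) * t"
              using 3 pos by (intro mult_strict_left_mono) auto
            then show ?thesis by (simp add: algebra_simps)
          qed
          ultimately show ?thesis using ht(1) inj_on_eq_iff[OF g(2) s0(1) ht(2)] by simp
        next
          case False
          then have "(2 * t0) * s < (2 * t0) * (1/2)" using 3 pos by (intro mult_strict_left_mono) auto
          then have "h s \<notin> g ` ?I" using first[of "2 * t0 * s"] 3 st pos by (simp add: h_def)
          then show ?thesis using ht imageI[of ?u ?I g] by metis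
        qed
      qed
    qed auto
    moreover have "h ` ?I \<subseteq> K \<union> L"
    proof
      fix q assume "q \<in> h ` ?I"
      then obtain t where t: "t \<in> ?I" "q = h t" by blast
      show "q \<in> K \<union> L"
      proof (cases "t \<le> 1/2")
        case True
        then have "q \<in> f ` ?I" using t F[of t] by (simp add: h_def)
        then show ?thesis using f(5) by blast
      next
        case False
        then have "q \<in> g ` ?I" using t G'[of t] unfolding h_def by simp
        then show ?thesis using g(5) by blast
      qed
    qed
    moreover have "h 0 = x" "h 1 = z" using f g by (simp_all add: h_def)
    ultimately show ?thesis unfolding arc_within_def by blast
  qed
qed

section \<open>The topology of the 1-complex\<close>

lemma vertex_pt_apply: "vertex_pt v u = (if u = v then 1 else 0)"
  by (simp add: vertex_pt_def indicator_def)

lemma vertex_pt_eq_iff [simp]: "vertex_pt u = vertex_pt v \<longleftrightarrow> u = v"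
  by (metis vertex_pt_apply zero_neq_one)

lemma topspace_complex_topology:
  assumes "simple_graph G"
  shows "topspace (complex_topology G) = points G"
proof -
  have "openin (complex_topology G) (points G)"
    unfolding openin_complex_topology
  proof (intro conjI ballI)
    fix e assume "e \<in> edges G"
    then have "points G \<inter> edge_pts e = edge_pts e" by (auto simp: points_def)
    then show "openin (top_of_set (edge_pts e)) (points G \<inter> edge_pts e)" by simp
  qed simp
  then show ?thesis
    by (metis openin_complex_topology openin_subset openin_topspace subset_antisym)
qed

text \<open>The inverse of the coordinate at \<open>y\<close> on the edge \<open>{x, y}\<close>.\<close>

definition edge_pt :: "'v \<Rightarrow> 'v \<Rightarrow> real \<Rightarrow> 'v \<Rightarrow> real" where
  "edge_pt x y s = (\<lambda>v. if v = y then s else if v = x then 1 - s else 0)"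

lemma edge_pt_in_edge_pts:
  assumes "x \<noteq> y" "s \<in> {0..1}"
  shows "edge_pt x y s \<in> edge_pts {x, y}"
  using assms by (auto simp: edge_pt_def edge_pts_def)

lemma edge_pts_coordinates:
  assumes "x \<noteq> y" "p \<in> edge_pts {x, y}"
  shows "p y \<in> {0..1}" "edge_pt x y (p y) = p"
proof -
  have *: "p x + p y = 1" "0 \<le> p x" "0 \<le> p y" "\<And>v. v \<noteq> x \<Longrightarrow> v \<noteq> y \<Longrightarrow> p v = 0"
    using assms by (auto simp: edge_pts_def)
  then have "p x = 1 - p y" by simp
  then show "edge_pt x y (p y) = p" using * by (auto simp: edge_pt_def fun_eq_iff)
  show "p y \<in> {0..1}" using * by auto
qed

lemma edge_pts_eq_image: "x \<noteq> y \<Longrightarrow> edge_pts {x, y} = edge_pt x y ` {0..1}"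
proof (intro subset_antisym subsetI)
  fix p assume "x \<noteq> y" "p \<in> edge_pts {x, y}"
  then show "p \<in> edge_pt x y ` {0..1}"
    using edge_pts_coordinates[of x y p] by (metis image_eqI)
qed (auto intro: edge_pt_in_edge_pts)

lemma continuous_on_edge_pt: "continuous_on S (edge_pt x y)"
  unfolding edge_pt_def
proof (rule continuous_on_coordinatewise_then_product)
  fix v
  show "continuous_on S (\<lambda>s. if v = y then s else if v = x then 1 - s else 0)"
    by (cases "v = y"; cases "v = x") (auto intro!: continuous_intros)
qed

lemma continuous_on_coordinate: "continuous_on S (\<lambda>p. p (v::'v) :: real)"
  by (rule continuous_on_subset[OF continuous_on_product_coordinates]) simp

lemma Hausdorff_space_functions: "Hausdorff_space (euclidean :: ('v \<Rightarrow> real) topology)"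
  unfolding euclidean_product_topology[symmetric] by (simp add: Hausdorff_space_product_topology)

lemma compact_imp_closed_functions: "compact S \<Longrightarrow> closed (S :: ('v \<Rightarrow> real) set)"
  using compactin_imp_closedin[OF Hausdorff_space_functions] by simp

lemma vertex_pt_in_edge_pts:
  assumes "x \<noteq> y" 
  shows "vertex_pt x \<in> edge_pts {x, y}" "vertex_pt y \<in> edge_pts {x, y}"
  using assms by (auto simp: edge_pts_def vertex_pt_apply)

lemma edge_interior_doubleton:
  assumes "x \<noteq> y"
  shows "p \<in> edge_interior {x, y} \<longleftrightarrow> p \<in> edge_pts {x, y} \<and> 0 < p y \<and> p y < 1"
proof (cases "p \<in> edge_pts {x, y}")
  case True
  note p = edge_pts_coordinates[OF assms True]
  have "edge_pt x y 0 = vertex_pt x" "edge_pt x y 1 = vertex_pt y"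
    using assms by (auto simp: edge_pt_def vertex_pt_apply fun_eq_iff)
  then have "p = vertex_pt x \<longleftrightarrow> p y = 0" "p = vertex_pt y \<longleftrightarrow> p y = 1"
    using p(2) assms by (metis vertex_pt_apply)+
  then show ?thesis using True p(1) by (auto simp: edge_interior_def)
next
  case False
  then show ?thesis by (simp add: edge_interior_def)
qed

lemma edge_pts_positive_coordinate:
  assumes "p \<in> edge_pts e" "p v \<noteq> 0" shows "v \<in> e"
  using assms by (auto simp: edge_pts_def)

lemma vertex_pt_mem_edge_pts_iff:
  assumes "x \<noteq> y"
  shows "vertex_pt v \<in> edge_pts {x, y} \<longleftrightarrow> v \<in> {x, y}"
  using assms vertex_pt_in_edge_pts[OF assms] edge_pts_positive_coordinate[of "vertex_pt v" "{x,y}" v]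
  by (auto simp: vertex_pt_apply)

lemma openin_edge_coordinate:
  fixes y :: 'v
  shows "openin (top_of_set (edge_pts e)) {p \<in> edge_pts e. c < p y}"
  "openin (top_of_set (edge_pts e)) {p \<in> edge_pts e. p y < c}"
proof -
  have "open {p :: 'v \<Rightarrow> real. c < p y}" "open {p :: 'v \<Rightarrow> real. p y < c}"
    by (rule open_Collect_less; simp add: continuous_on_coordinate)+
  from this[THEN openin_open_Int, of "edge_pts e"] 
  show "openin (top_of_set (edge_pts e)) {p \<in> edge_pts e. c < p y}"
    "openin (top_of_set (edge_pts e)) {p \<in> edge_pts e. p y < c}"
    by (simp_all add: Collect_conj_eq)
qed

section \<open>Walks and rays\<close>

lemma linked_refl [simp]: "linked H x x"
  unfolding linked_def by simp

lemma linked_edge: "{x, y} \<in> edges H \<Longrightarrow> linked H x y"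
  unfolding linked_def by auto

lemma linked_sym: "linked H x y \<Longrightarrow> linked H y x"
proof -
  have "sym {(u, v). {u, v} \<in> edges H}" by (auto simp: sym_def insert_commute)
  then show "linked H x y \<Longrightarrow> linked H y x"
    unfolding linked_def by (meson symD sym_rtrancl)
qed

lemma linked_trans: "linked H x y \<Longrightarrow> linked H y z \<Longrightarrow> linked H x z"
  unfolding linked_def by (rule rtrancl_trans)

lemma linked_del_edges_mono:
  assumes "S \<subseteq> T" "linked (del_edges G T) x y" shows "linked (del_edges G S) x y"
proof -
  have "{(u, v). {u, v} \<in> edges (del_edges G T)} \<subseteq> {(u, v). {u, v} \<in> edges (del_edges G S)}"
    using assms(1) by (auto simp: del_edges_def)
  from rtrancl_mono[OF this] assms(2) show ?thesis unfolding linked_def by blast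
qed

lemma rays_iff: "r \<in> rays H \<longleftrightarrow> inj r \<and> range r \<subseteq> verts H \<and> (\<forall>n. {r n, r (Suc n)} \<in> edges H)"
  by (simp add: rays_def)

lemma ray_shift_inj:
  assumes "r \<in> rays H" shows "inj (\<lambda>n. r (N + n :: nat))"
proof (rule injI)
  have "inj r" using assms by (simp add: rays_iff)
  fix a b assume "r (N + a) = r (N + b)"
  then show "a = b" using inj_eq[OF \<open>inj r\<close>] by simp
qed

lemma ray_edge_inj:
  assumes "inj r" shows "inj (\<lambda>n. {r n, r (Suc n)} :: 'v set)"
proof (rule injI)
  fix a b assume "{r a, r (Suc a)} = {r b, r (Suc b)}"
  then have "r a = r b \<or> r a = r (Suc b) \<and> r (Suc a) = r b" by (auto simp: doubleton_eq_iff)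
  then have "a = b \<or> a = Suc b \<and> Suc a = b" by (simp add: inj_eq[OF assms])
  then show "a = b" by auto
qed

text \<open>The walk runs through the paths \<open>p n 0, ..., p n (L n)\<close> one after the other. It pauses for one
  step between two paths, where the end of one is the beginning of the next.\<close>

lemma concatenate_walks:
  fixes p :: "nat \<Rightarrow> nat \<Rightarrow> 'a" and L :: "nat \<Rightarrow> nat"
  assumes "\<And>n. p n (L n) = p (Suc n) 0"
  obtains W where
    "\<And>t. W (Suc t) = W t \<or> (\<exists>n i. i < L n \<and> W t = p n i \<and> W (Suc t) = p n (Suc i))"
    "\<And>N. \<exists>t0. \<forall>t\<ge>t0. \<exists>n\<ge>N. \<exists>i\<le>L n. W t = p n i"
    "\<And>t. \<exists>n. \<exists>i\<le>L n. W t = p n i"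
proof -
  define st :: "nat \<Rightarrow> nat \<times> nat" where
    "st = rec_nat (0, 0) (\<lambda>_ (n, i). if i < L n then (n, Suc i) else (Suc n, 0))"
  have st: "st 0 = (0, 0)"
    "\<And>t. st (Suc t) = (if snd (st t) < L (fst (st t)) then (fst (st t), Suc (snd (st t))) else (Suc (fst (st t)), 0))"
    by (simp_all add: st_def case_prod_beta)
  define W where "W t = p (fst (st t)) (snd (st t))" for t
  have le: "snd (st t) \<le> L (fst (st t))" for t
    by (induction t) (auto simp: st)
  have mono: "fst (st s) \<le> fst (st t)" if "s \<le> t" for s t
    using that by (induction t rule: dec_induct) (auto simp: st)
  have reach_i: "\<exists>t. st t = (n, i)" if "i \<le> L n" "\<exists>t. st t = (n, 0)" for n i
    using that
  proof (induction i)
    case (Suc i)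
    then obtain t where "st t = (n, i)" by auto
    then have "st (Suc t) = (n, Suc i)" using Suc.prems by (simp add: st)
    then show ?case by blast
  qed simp
  have reach: "\<exists>t. st t = (n, 0)" for n
  proof (induction n)
    case (Suc n)
    then obtain t where "st t = (n, L n)" using reach_i[of "L n" n] by blast
    then have "st (Suc t) = (Suc n, 0)" by (simp add: st)
    then show ?case by blast
  qed (use st in blast)
  show thesis
  proof (rule that)
    fix t
    show "W (Suc t) = W t \<or> (\<exists>n i. i < L n \<and> W t = p n i \<and> W (Suc t) = p n (Suc i))"
    proof (cases "snd (st t) < L (fst (st t))")
      case True
      then show ?thesis unfolding W_def
        by (intro disjI2 exI[of _ "fst (st t)"] exI[of _ "snd (st t)"]) (simp add: st)
    next
      case False
      then have "snd (st t) = L (fst (st t))" using le[of t] by simp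
      then show ?thesis using assms[of "fst (st t)"] False by (simp add: W_def st)
    qed
  next
    fix N
    obtain t0 where "st t0 = (N, 0)" using reach by blast
    then have "N \<le> fst (st t)" if "t \<ge> t0" for t using mono[OF that] by simp
    then show "\<exists>t0. \<forall>t\<ge>t0. \<exists>n\<ge>N. \<exists>i\<le>L n. W t = p n i" using le W_def by blast
  next
    show "\<exists>n. \<exists>i\<le>L n. W t = p n i" for t using le W_def by blast
  qed
qed

locale summable_graph =
  fixes G :: "'v graph" and l :: "'v set \<Rightarrow> real"
    and \<sigma> :: "'v set \<Rightarrow> ('v \<Rightarrow> real) \<Rightarrow> real"
  assumes simple: "simple_graph G"
    and connected: "connected_graph G"
    and l_pos: "\<And>e. e \<in> edges G \<Longrightarrow> 0 < l e"
    and sigma: "\<And>e. e \<in> edges G \<Longrightarrow> \<exists>\<tau>. homeomorphism (edge_pts e) {0..l e} (\<sigma> e) \<tau>"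
    and l_summable: "l summable_on edges G"
begin

abbreviation "X \<equiv> complex_topology G"

lemma edgeE:
  assumes "e \<in> edges G"
  obtains x y where "x \<in> verts G" "y \<in> verts G" "x \<noteq> y" "e = {x, y}"
  using simple assms unfolding simple_graph_def by blast

lemma edgeE':
  assumes "e \<in> edges G" "y \<in> e"
  obtains x where "x \<in> verts G" "y \<in> verts G" "x \<noteq> y" "e = {x, y}"
proof -
  obtain a b where "a \<in> verts G" "b \<in> verts G" "a \<noteq> b" "e = {a, b}" by (rule edgeE[OF assms(1)])
  then show thesis using that[of a] that[of b] assms(2) by auto
qed

lemma edge_subset_verts: "e \<in> edges G \<Longrightarrow> e \<subseteq> verts G"
  by (erule edgeE) auto

lemma edge_finite: "e \<in> edges G \<Longrightarrow> finite e"
  by (erule edgeE) auto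

lemma edge_pts_subset_points: "e \<in> edges G \<Longrightarrow> edge_pts e \<subseteq> points G"
  by (auto simp: points_def)

lemma vertex_pt_in_points: "v \<in> verts G \<Longrightarrow> vertex_pt v \<in> points G"
  by (auto simp: points_def)

lemma vertex_pt_mem_edge_pts: "e \<in> edges G \<Longrightarrow> vertex_pt v \<in> edge_pts e \<longleftrightarrow> v \<in> e"
  by (erule edgeE) (simp add: vertex_pt_mem_edge_pts_iff)

lemma compact_edge_pts: "e \<in> edges G \<Longrightarrow> compact (edge_pts e)"
  by (erule edgeE) (auto simp: edge_pts_eq_image intro!: compact_continuous_image continuous_on_edge_pt)

lemma closed_edge_pts: "e \<in> edges G \<Longrightarrow> closed (edge_pts e)"
  by (rule compact_imp_closed_functions) (rule compact_edge_pts)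

text \<open>A common point has nonzero coordinates only in the intersection of the two edges, which has at
  most one element.\<close>

lemma edge_pts_Int:
  assumes "e \<in> edges G" "f \<in> edges G" "e \<noteq> f" "p \<in> edge_pts e" "p \<in> edge_pts f"
  shows "\<exists>v\<in>e \<inter> f. p = vertex_pt v"
proof -
  obtain x y where e: "x \<noteq> y" "e = {x, y}" by (rule edgeE[OF assms(1)])
  obtain a b where f: "a \<noteq> b" "f = {a, b}" by (rule edgeE[OF assms(2)])
  have pos: "p v \<noteq> 0 \<Longrightarrow> v \<in> e \<inter> f" for v
    using edge_pts_positive_coordinate assms by fast
  have one: "p x + p y = 1" using assms(4) e by (simp add: edge_pts_def)
  then have "p x \<noteq> 0 \<or> p y \<noteq> 0" by auto
  then obtain v where v: "p v \<noteq> 0" "v \<in> e" using e by blast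
  have vf: "v \<in> e \<inter> f" by (rule pos[OF v(1)])
  have "p u = 0" if "u \<noteq> v" for u
  proof (rule ccontr)
    assume "p u \<noteq> 0"
    from pos[OF this] vf that e f assms(3) show False by auto
  qed
  moreover from this one e v have "p v = 1" by auto
  ultimately have "p = vertex_pt v" by (auto simp: vertex_pt_apply fun_eq_iff)
  with vf show ?thesis by blast
qed

lemma edge_interior_disjoint:
  assumes "e \<in> edges G" "f \<in> edges G" "e \<noteq> f" "p \<in> edge_interior e"
  shows "p \<notin> edge_pts f"
  using edge_pts_Int[OF assms(1-3), of p] assms(4) by (auto simp: edge_interior_def)

lemma edge_interior_not_vertex:
  assumes "e \<in> edges G" "p \<in> edge_interior e"
  shows "p \<noteq> vertex_pt v"
  using vertex_pt_mem_edge_pts[OF assms(1), of v] assms(2) by (auto simp: edge_interior_def)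

lemma points_cases:
  assumes "p \<in> points G"
  obtains v where "v \<in> verts G" "p = vertex_pt v" | e where "e \<in> edges G" "p \<in> edge_interior e"
proof -
  consider "p \<in> vertex_pt ` verts G" | e where "e \<in> edges G" "p \<in> edge_pts e"
    using assms by (auto simp: points_def)
  then show thesis
  proof cases
    case 2
    then show thesis using that edge_subset_verts unfolding edge_interior_def by blast
  qed (use that in blast)
qed

lemma topspace_X: "topspace X = points G"
  by (rule topspace_complex_topology[OF simple])

lemma continuous_map_edge_inclusion:
  assumes "e \<in> edges G"
  shows "continuous_map (top_of_set (edge_pts e)) X (\<lambda>p. p)"
  unfolding continuous_map_def
proof (intro conjI allI impI)
  show "(\<lambda>p. p) \<in> topspace (top_of_set (edge_pts e)) \<rightarrow> topspace X"
    using edge_pts_subset_points[OF assms] by (auto simp: topspace_X)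
next
  fix U assume "openin X U"
  then have "openin (top_of_set (edge_pts e)) (U \<inter> edge_pts e)"
    using assms by (auto simp: openin_complex_topology)
  moreover have "{p \<in> topspace (top_of_set (edge_pts e)). p \<in> U} = U \<inter> edge_pts e" by auto
  ultimately show "openin (top_of_set (edge_pts e)) {p \<in> topspace (top_of_set (edge_pts e)). p \<in> U}"
    by simp
qed

text \<open>The weak topology refines that of the ambient function space. It is therefore Hausdorff, and
  sets that are compact in it are compact in the ambient space.\<close>

lemma continuous_map_ambient: "continuous_map X euclidean (\<lambda>p. p)"
  unfolding continuous_map_def
proof (intro conjI allI impI)
  fix U :: "('v \<Rightarrow> real) set" assume U: "openin euclidean U"
  show "openin X {p \<in> topspace X. p \<in> U}"
    unfolding openin_complex_topology
  proof (intro conjI ballI)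
    fix e assume "e \<in> edges G"
    then have "{p \<in> topspace X. p \<in> U} \<inter> edge_pts e = edge_pts e \<inter> U"
      using edge_pts_subset_points by (auto simp: topspace_X)
    then show "openin (top_of_set (edge_pts e)) ({p \<in> topspace X. p \<in> U} \<inter> edge_pts e)"
      using U by auto
  qed (auto simp: topspace_X)
qed simp

lemma Hausdorff_X: "Hausdorff_space X"
  unfolding Hausdorff_space_def
proof (intro allI impI)
  fix p q assume pq: "p \<in> topspace X \<and> q \<in> topspace X \<and> p \<noteq> q"
  then obtain U V where UV: "open U" "open V" "p \<in> U" "q \<in> V" "U \<inter> V = {}"
    using Hausdorff_space_functions[where 'v='v] unfolding Hausdorff_space_def disjnt_def
    by (metis UNIV_I open_openin topspace_euclidean)
  show "\<exists>U V. openin X U \<and> openin X V \<and> p \<in> U \<and> q \<in> V \<and> disjnt U V"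
  proof (intro exI conjI)
    show "openin X {p \<in> topspace X. p \<in> U}" "openin X {p \<in> topspace X. p \<in> V}"
      by (rule openin_continuous_map_preimage[OF continuous_map_ambient]; use UV in simp)+
    show "p \<in> {p \<in> topspace X. p \<in> U}" "q \<in> {p \<in> topspace X. p \<in> V}"
      using UV pq by simp_all
    show "disjnt {p \<in> topspace X. p \<in> U} {p \<in> topspace X. p \<in> V}"
      using UV(5) unfolding disjnt_def by blast
  qed
qed

text \<open>A continuous injection of a compact space into a Hausdorff space is an embedding.\<close>

lemma arc_within_imp_is_arc:
  assumes "arc_within X K p q"
  shows "\<exists>P\<subseteq>K. is_arc G p q P"
  using assms unfolding arc_within_def
proof
  assume "p = q \<and> p \<in> topspace X \<inter> K"
  then show ?thesis by (intro exI[of _ "{p}"]) (auto simp: is_arc_def topspace_X)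
next
  assume "\<exists>h. continuous_map (top_of_set {0..1::real}) X h \<and> inj_on h {0..1} \<and> h 0 = p \<and> h 1 = q \<and>
    h ` {0..1} \<subseteq> K"
  then show ?thesis
  proof (elim exE conjE)
    fix h assume h: "continuous_map (top_of_set {0..1::real}) X h" "inj_on h {0..1}"
      "h 0 = p" "h 1 = q" "h ` {0..1} \<subseteq> K"
    have "compact_space (top_of_set {0..1::real})"
      by (simp add: compact_space_subtopology)
    then have "embedding_map (top_of_set {0..1}) X h"
      using continuous_imp_embedding_map[OF h(1) _ Hausdorff_X] h(2) by simp
    then have "is_arc G p q (h ` {0..1})" using h(3,4) unfolding is_arc_def by (intro disjI2 exI[of _ h]) simp
    then show ?thesis using h(5) by blast
  qed
qed

lemma is_arcD:
  assumes "is_arc G p q P"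
  shows "connectedin X P" "compact P" "p \<in> P" "q \<in> P" "P \<subseteq> points G"
proof -
  have *: "connectedin X P \<and> compactin X P \<and> p \<in> P \<and> q \<in> P"
    using assms unfolding is_arc_def
  proof
    assume "p = q \<and> p \<in> points G \<and> P = {p}"
    then show ?thesis by (auto simp: topspace_X)
  next
    assume "\<exists>g. embedding_map (top_of_set {0..1::real}) X g \<and> g 0 = p \<and> g 1 = q \<and> P = g ` {0..1}"
    then obtain g where g: "embedding_map (top_of_set {0..1::real}) X g" "g 0 = p" "g 1 = q"
        "P = g ` {0..1}" by fast
    have c: "continuous_map (top_of_set {0..1::real}) X g"
      using homeomorphic_imp_continuous_map g(1) continuous_map_in_subtopology
      unfolding embedding_map_def by blast
    have "connectedin X P" unfolding g
      by (rule connectedin_continuous_map_image[OF c]) (auto simp: connectedin_subtopology)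
    moreover have "compactin X P" unfolding g
      by (rule image_compactin[OF _ c]) (simp add: compactin_subtopology)
    ultimately show ?thesis using g by auto
  qed
  then show "connectedin X P" "p \<in> P" "q \<in> P" by auto
  then show "P \<subseteq> points G" using connectedin_subset_topspace topspace_X by metis
  have "compactin euclidean ((\<lambda>p. p) ` P)"
    by (rule image_compactin[OF _ continuous_map_ambient]) (use * in blast)
  then show "compact P" by simp
qed

section \<open>Segments of edges\<close>

lemma sigma_continuous: "e \<in> edges G \<Longrightarrow> continuous_on (edge_pts e) (\<sigma> e)"
  using sigma homeomorphism_cont1 by blast

lemma sigma_inj: "e \<in> edges G \<Longrightarrow> inj_on (\<sigma> e) (edge_pts e)"
  by (drule sigma) (auto intro: inj_on_inverseI homeomorphism_apply1)

lemma sigma_image: "e \<in> edges G \<Longrightarrow> \<sigma> e ` edge_pts e = {0..l e}"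
  using sigma homeomorphism_image1 by blast

lemma sigma_mem: "e \<in> edges G \<Longrightarrow> p \<in> edge_pts e \<Longrightarrow> \<sigma> e p \<in> {0..l e}"
  using sigma_image by blast

definition segment :: "'v set \<Rightarrow> ('v \<Rightarrow> real) \<Rightarrow> ('v \<Rightarrow> real) \<Rightarrow> ('v \<Rightarrow> real) set" where
  "segment e p q = {r \<in> edge_pts e. \<sigma> e r \<in> closed_segment (\<sigma> e p) (\<sigma> e q)}"

lemma segment_subset: "segment e p q \<subseteq> edge_pts e"
  by (auto simp: segment_def)

lemma sigma_image_segment:
  assumes "e \<in> edges G" "p \<in> edge_pts e" "q \<in> edge_pts e"
  shows "\<sigma> e ` segment e p q = closed_segment (\<sigma> e p) (\<sigma> e q)"
proof -
  have "closed_segment (\<sigma> e p) (\<sigma> e q) \<subseteq> {0..l e}"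
    by (rule closed_segment_subset) (use assms sigma_mem in auto)
  then show ?thesis unfolding segment_def using sigma_image[OF assms(1)] by fast
qed

lemma arc_within_segment:
  assumes e: "e \<in> edges G" and p: "p \<in> edge_pts e" and q: "q \<in> edge_pts e"
  shows "arc_within X (segment e p q) p q"
proof (cases "p = q")
  case True
  then show ?thesis using assms edge_pts_subset_points
    by (auto simp: arc_within_def topspace_X segment_def)
next
  case False
  obtain \<tau> where \<tau>: "homeomorphism (edge_pts e) {0..l e} (\<sigma> e) \<tau>" using sigma[OF e] by blast
  have ne: "\<sigma> e p \<noteq> \<sigma> e q" using False inj_onD[OF sigma_inj[OF e]] p q by blast
  define s where "s t = (1 - t) * \<sigma> e p + t * \<sigma> e q" for t :: real
  have seg: "s t \<in> closed_segment (\<sigma> e p) (\<sigma> e q)" if "t \<in> {0..1}" for t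
    using that unfolding s_def closed_segment_def by auto
  have "closed_segment (\<sigma> e p) (\<sigma> e q) \<subseteq> {0..l e}"
    by (rule closed_segment_subset) (use e p q sigma_mem in auto)
  with seg have mem: "s t \<in> {0..l e}" if "t \<in> {0..1}" for t using that by blast
  have "continuous_map (top_of_set {0..1}) (top_of_set (edge_pts e)) (\<lambda>t. \<tau> (s t))"
  proof -
    have "continuous_on {0..1} (\<lambda>t. \<tau> (s t))"
      by (rule continuous_on_compose2[OF homeomorphism_cont2[OF \<tau>]])
         (use mem in \<open>auto simp: s_def intro!: continuous_intros\<close>)
    then show ?thesis using homeomorphism_image2[OF \<tau>] mem by auto
  qed
  from continuous_map_compose[OF this continuous_map_edge_inclusion[OF e]]
  have "continuous_map (top_of_set {0..1}) X (\<lambda>t. \<tau> (s t))" by (simp add: o_def)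
  moreover have "inj_on (\<lambda>t. \<tau> (s t)) {0..1}"
  proof (rule inj_onI)
    fix a b :: real assume ab: "a \<in> {0..1}" "b \<in> {0..1}" "\<tau> (s a) = \<tau> (s b)"
    then have "s a = s b" using homeomorphism_apply2[OF \<tau>] mem by metis
    then have "(a - b) * (\<sigma> e q - \<sigma> e p) = 0" by (simp add: s_def algebra_simps)
    then show "a = b" using ne by simp
  qed
  moreover have "\<tau> (s 0) = p" "\<tau> (s 1) = q"
    using homeomorphism_apply1[OF \<tau>] p q by (simp_all add: s_def)
  moreover have "(\<lambda>t. \<tau> (s t)) ` {0..1} \<subseteq> segment e p q"
  proof (rule image_subsetI)
    fix t :: real assume t: "t \<in> {0..1}"
    have "\<sigma> e (\<tau> (s t)) = s t" by (rule homeomorphism_apply2[OF \<tau> mem[OF t]])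
    moreover have "\<tau> (s t) \<in> edge_pts e" using homeomorphism_image2[OF \<tau>] mem[OF t] by blast
    ultimately show "\<tau> (s t) \<in> segment e p q" using seg[OF t] by (simp add: segment_def)
  qed
  ultimately show ?thesis unfolding arc_within_def by (intro disjI2 exI[of _ "\<lambda>t. \<tau> (s t)"]) blast
qed

section \<open>Lengths of arcs\<close>

text \<open>A compact connected part of an edge is a segment, as its image under \<open>\<sigma>\<close> is a closed
  interval. Expressing its length as a measure makes lengths additive and monotone.\<close>

lemma half_edge_length_eq_measure:
  assumes e: "e \<in> edges G" and f: "f \<subseteq> edge_pts e" "compact f" "connected f" "f \<noteq> {}"
  shows "half_edge_length \<sigma> e f = measure lborel (\<sigma> e ` f)"
proof -
  have cont: "continuous_on f (\<sigma> e)" using sigma_continuous[OF e] f(1) by (rule continuous_on_subset)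
  have "compact (\<sigma> e ` f)" "connected (\<sigma> e ` f)" "\<sigma> e ` f \<noteq> {}"
    using compact_continuous_image[OF cont] connected_continuous_image[OF cont] f by auto
  then obtain a b where ab: "\<sigma> e ` f = {a..b}"
    using connected_compact_interval_1[of "\<sigma> e ` f"] by blast
  then have "a \<le> b" using f(4) by (metis atLeastatMost_empty_iff2 image_is_empty)
  then obtain p q where pq: "p \<in> f" "q \<in> f" "\<sigma> e p = a" "\<sigma> e q = b"
    using ab by (metis (no_types, lifting) atLeastAtMost_iff imageE order_refl)
  have cs: "closed_segment (\<sigma> e p) (\<sigma> e q) = {a..b}"
    using pq \<open>a \<le> b\<close> by (simp add: closed_segment_eq_real_ivl)
  have "f = {r \<in> edge_pts e. \<sigma> e r \<in> {a..b}}"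
  proof
    show "f \<subseteq> {r \<in> edge_pts e. \<sigma> e r \<in> {a..b}}" using ab f(1) by blast
    show "{r \<in> edge_pts e. \<sigma> e r \<in> {a..b}} \<subseteq> f"
      unfolding ab[symmetric] using inj_onD[OF sigma_inj[OF e]] f(1) by fast
  qed
  then have feq: "f = segment e p q" unfolding segment_def cs .
  have cl: "closure f = f" using f(2) by (simp add: compact_imp_closed_functions)
  show ?thesis unfolding half_edge_length_def
  proof (rule the_equality)
    show "\<exists>a\<in>edge_pts e. \<exists>b\<in>edge_pts e. closure f = {p \<in> edge_pts e. \<sigma> e p \<in> closed_segment (\<sigma> e a) (\<sigma> e b)}
      \<and> measure lborel (\<sigma> e ` f) = \<bar>\<sigma> e a - \<sigma> e b\<bar>"
      using pq f(1) cl feq ab \<open>a \<le> b\<close> unfolding segment_def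
      by (intro bexI[of _ p] bexI[of _ q]) auto
  next
    fix r assume "\<exists>a\<in>edge_pts e. \<exists>b\<in>edge_pts e. closure f = {p \<in> edge_pts e. \<sigma> e p \<in> closed_segment (\<sigma> e a) (\<sigma> e b)}
      \<and> r = \<bar>\<sigma> e a - \<sigma> e b\<bar>"
    then obtain c d where cd: "c \<in> edge_pts e" "d \<in> edge_pts e" "f = segment e c d"
        "r = \<bar>\<sigma> e c - \<sigma> e d\<bar>"
      unfolding segment_def cl by blast
    have "\<sigma> e ` f = closed_segment (\<sigma> e c) (\<sigma> e d)"
      unfolding cd(3) by (rule sigma_image_segment[OF e cd(1,2)])
    then show "r = measure lborel (\<sigma> e ` f)"
      unfolding cd(4) by (auto simp: closed_segment_eq_real_ivl)
  qed
qed

lemma arc_component: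
  assumes "e \<in> edges G" "compact P" "f \<in> components (P \<inter> edge_pts e)"
  shows "f \<subseteq> edge_pts e" "compact f" "connected f" "f \<noteq> {}" "f \<subseteq> P"
proof -
  have "compact (P \<inter> edge_pts e)" using assms closed_edge_pts by (simp add: compact_Int_closed)
  moreover have "closed f"
    using closed_components compact_imp_closed_functions calculation assms(3) by blast
  ultimately have "compact ((P \<inter> edge_pts e) \<inter> f)" by (rule compact_Int_closed)
  then show "compact f" using in_components_subset[OF assms(3)] by (simp add: Int_absorb1)
  show "f \<subseteq> edge_pts e" "f \<subseteq> P" using in_components_subset[OF assms(3)] by auto
  show "connected f" "f \<noteq> {}"
    using assms(3) in_components_connected in_components_nonempty by blast+
qed

text \<open>Disjoint half-edges have disjoint images under \<open>\<sigma>\<close>, so that their total length is the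
  measure of a subset of the interval.\<close>

lemma sum_half_edge_length_le:
  assumes e: "e \<in> edges G" and P: "compact P"
    and F: "finite F" "F \<subseteq> components (P \<inter> edge_pts e)"
  shows "(\<Sum>f\<in>F. half_edge_length \<sigma> e f) \<le> measure lborel (\<sigma> e ` (P \<inter> edge_pts e))"
proof -
  note fc = arc_component[OF e P subsetD[OF F(2)]]
  have cpt: "compact (\<sigma> e ` f)" if "f \<in> F" for f
    by (rule compact_continuous_image[OF continuous_on_subset[OF sigma_continuous[OF e]]])
       (rule fc(1)[OF that], rule fc(2)[OF that])
  have cptP: "compact (\<sigma> e ` (P \<inter> edge_pts e))"
    using P closed_edge_pts[OF e]
    by (intro compact_continuous_image continuous_on_subset[OF sigma_continuous[OF e]])
       (auto simp: compact_Int_closed)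
  have fm: "\<sigma> e ` f \<in> fmeasurable lborel" if "f \<in> F" for f
    using cpt[OF that] by (simp add: fmeasurable_compact)
  have fmP: "\<sigma> e ` (P \<inter> edge_pts e) \<in> fmeasurable lborel"
    using cptP by (simp add: fmeasurable_compact)
  have dj: "disjoint_family_on (\<lambda>f. \<sigma> e ` f) F"
    unfolding disjoint_family_on_def
  proof (intro ballI impI)
    fix f g assume fg: "f \<in> F" "g \<in> F" "f \<noteq> g"
    then have "f \<inter> g = {}" using F(2) components_nonoverlap by (metis subsetD)
    then show "\<sigma> e ` f \<inter> \<sigma> e ` g = {}"
      using inj_on_image_Int[OF sigma_inj[OF e] fc(1)[OF fg(1)] fc(1)[OF fg(2)]] by simp
  qed
  have "(\<Sum>f\<in>F. half_edge_length \<sigma> e f) = (\<Sum>f\<in>F. measure lborel (\<sigma> e ` f))"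
    by (rule sum.cong[OF refl]) (rule half_edge_length_eq_measure[OF e], use fc in auto)
  also have "\<dots> = measure lborel (\<Union>f\<in>F. \<sigma> e ` f)"
    by (rule measure_finite_Union[symmetric, OF F(1) _ dj])
       (use fm in \<open>auto simp: fmeasurable_def less_top\<close>)
  also have "\<dots> \<le> measure lborel (\<sigma> e ` (P \<inter> edge_pts e))"
  proof (rule measure_mono_fmeasurable[OF _ _ fmP])
    show "(\<Union>f\<in>F. \<sigma> e ` f) \<subseteq> \<sigma> e ` (P \<inter> edge_pts e)"
      using fc(1,5) by blast
    show "(\<Union>f\<in>F. \<sigma> e ` f) \<in> sets lborel"
      using fm F(1) by (auto simp: fmeasurable_def)
  qed
  finally show ?thesis .
qed

lemma half_edge_length_nonneg:
  assumes "e \<in> edges G" "compact P" "f \<in> components (P \<inter> edge_pts e)"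
  shows "0 \<le> half_edge_length \<sigma> e f"
  using half_edge_length_eq_measure[OF assms(1) arc_component(1-4)[OF assms]] by simp

text \<open>Grouped by edges, finitely many half-edges of \<open>P\<close> contribute at most the measure of the trace
  of \<open>P\<close> on each edge.\<close>

lemma sum_half_edge_lengths_le:
  assumes P: "compact P"
    and w: "\<And>e. e \<in> edges G \<Longrightarrow> measure lborel (\<sigma> e ` (P \<inter> edge_pts e)) \<le> w e"
    and w_sum: "w summable_on edges G"
    and F: "finite F" "F \<subseteq> (SIGMA e:edges G. components (P \<inter> edge_pts e))"
  shows "(\<Sum>(e, f)\<in>F. half_edge_length \<sigma> e f) \<le> infsum w (edges G)"
proof -
  have w0: "0 \<le> w e" if "e \<in> edges G" for e
    using w[OF that] measure_nonneg order_trans by blast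
  define B where "B e = {f. (e, f) \<in> F}" for e
  have finB: "finite (B e)" for e
    unfolding B_def by (rule finite_subset[of _ "snd ` F"]) (use F(1) in force)+
  have "F = (SIGMA e:fst ` F. B e)" unfolding B_def by force
  then have "(\<Sum>(e, f)\<in>F. half_edge_length \<sigma> e f) = (\<Sum>(e, f)\<in>(SIGMA e:fst ` F. B e). half_edge_length \<sigma> e f)"
    by simp
  also have "\<dots> = (\<Sum>e\<in>fst ` F. \<Sum>f\<in>B e. half_edge_length \<sigma> e f)"
    by (rule sum.Sigma[symmetric]) (use F(1) finB in auto)
  also have "\<dots> \<le> (\<Sum>e\<in>fst ` F. w e)"
  proof (rule sum_mono)
    fix e assume "e \<in> fst ` F"
    then have e: "e \<in> edges G" using F(2) by auto
    have "B e \<subseteq> components (P \<inter> edge_pts e)" using F(2) unfolding B_def by auto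
    from sum_half_edge_length_le[OF e P finB this] w[OF e]
    show "(\<Sum>f\<in>B e. half_edge_length \<sigma> e f) \<le> w e" by linarith
  qed
  also have "\<dots> \<le> infsum w (edges G)"
    by (rule finite_sum_le_infsum[OF w_sum]) (use F w0 in auto)
  finally show ?thesis .
qed

text \<open>The measure of a set that is not measurable is zero, which gives the bound for arbitrary \<open>P\<close>.\<close>

lemma measure_trace_le:
  assumes "e \<in> edges G"
  shows "measure lborel (\<sigma> e ` (P \<inter> edge_pts e)) \<le> l e"
proof (cases "\<sigma> e ` (P \<inter> edge_pts e) \<in> sets lborel")
  case True
  have "measure lborel (\<sigma> e ` (P \<inter> edge_pts e)) \<le> measure lborel {0..l e}"
    by (rule measure_mono_fmeasurable[OF _ True]) (use sigma_mem[OF assms] in \<open>auto simp: fmeasurable_compact compact_Icc\<close>)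
  then show ?thesis using l_pos[OF assms] by simp
next
  case False
  then show ?thesis using l_pos[OF assms] by (simp add: measure_notin_sets)
qed

text \<open>Summability of the edge lengths bounds all finite partial sums; no edge can contribute more
  than its own length, however many half-edges it contains.\<close>

lemma half_edge_lengths_summable:
  assumes P: "compact P"
  shows "(\<lambda>(e, f). half_edge_length \<sigma> e f) summable_on (SIGMA e:edges G. components (P \<inter> edge_pts e))"
proof (rule nonneg_bdd_above_summable_on)
  show "bdd_above (sum (\<lambda>(e, f). half_edge_length \<sigma> e f) `
      {F. F \<subseteq> (SIGMA e:edges G. components (P \<inter> edge_pts e)) \<and> finite F})"
    by (rule bdd_aboveI[of _ "infsum l (edges G)"])
       (use sum_half_edge_lengths_le[OF P measure_trace_le l_summable] in auto)
qed (use half_edge_length_nonneg[OF _ P] in auto)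

lemma arc_length_le:
  assumes "compact P"
    and "\<And>e. e \<in> edges G \<Longrightarrow> measure lborel (\<sigma> e ` (P \<inter> edge_pts e)) \<le> w e"
    and "w summable_on edges G"
  shows "arc_length G \<sigma> P \<le> infsum w (edges G)"
  unfolding arc_length_def
  by (rule infsum_le_finite_sums[OF half_edge_lengths_summable[OF assms(1)]])
     (rule sum_half_edge_lengths_le[OF assms])

lemma arc_length_nonneg:
  assumes "compact P" shows "0 \<le> arc_length G \<sigma> P"
  unfolding arc_length_def
  by (rule infsum_nonneg) (use half_edge_length_nonneg[OF _ assms] in auto)

text \<open>The connected set \<open>K\<close> lies in one maximal half-edge of \<open>P\<close>, and all other half-edges have
  nonnegative length.\<close>

lemma arc_length_ge:
  assumes e: "e \<in> edges G" and P: "compact P"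
    and K: "connected K" "K \<subseteq> P \<inter> edge_pts e" "p \<in> K" "q \<in> K"
  shows "\<bar>\<sigma> e p - \<sigma> e q\<bar> \<le> arc_length G \<sigma> P"
proof -
  obtain f where f: "f \<in> components (P \<inter> edge_pts e)" "K \<subseteq> f"
    using exists_component_superset[OF K(2) _ K(1)] K(2,3) by blast
  note fc = arc_component[OF e P f(1)]
  have cont: "continuous_on f (\<sigma> e)" using sigma_continuous[OF e] fc(1) by (rule continuous_on_subset)
  have cc: "compact (\<sigma> e ` f)" "connected (\<sigma> e ` f)"
    using compact_continuous_image[OF cont] connected_continuous_image[OF cont] fc by auto
  have "closed_segment (\<sigma> e p) (\<sigma> e q) \<subseteq> \<sigma> e ` f"
    by (rule closed_segment_subset)
       (use cc(2) K f(2) in \<open>auto simp: is_interval_convex_1[symmetric] is_interval_connected_1\<close>)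
  then have "measure lborel (closed_segment (\<sigma> e p) (\<sigma> e q)) \<le> measure lborel (\<sigma> e ` f)"
    by (rule measure_mono_fmeasurable) (use cc in \<open>auto simp: fmeasurable_compact\<close>)
  then have "\<bar>\<sigma> e p - \<sigma> e q\<bar> \<le> half_edge_length \<sigma> e f"
    unfolding half_edge_length_eq_measure[OF e fc(1-4)]
    by (auto simp: closed_segment_eq_real_ivl split: if_splits)
  also have "\<dots> = (\<Sum>(e, f)\<in>{(e, f)}. half_edge_length \<sigma> e f)" by simp
  also have "\<dots> \<le> arc_length G \<sigma> P"
    unfolding arc_length_def
    by (rule finite_sum_le_infsum[OF half_edge_lengths_summable[OF P]])
       (use e f half_edge_length_nonneg[OF _ P] in auto)
  finally show ?thesis .
qed

section \<open>Upper bounds for the distance\<close>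

definition tail :: "'v set set \<Rightarrow> real" where
  "tail S = infsum l (edges G - S)"

lemma l_nonneg: "e \<in> edges G \<Longrightarrow> 0 \<le> l e"
  using l_pos by (simp add: less_imp_le)

lemma tail_nonneg: "0 \<le> tail S"
  unfolding tail_def by (rule infsum_nonneg) (use l_nonneg in auto)

lemma tail_antimono: "S \<subseteq> T \<Longrightarrow> tail T \<le> tail S"
  unfolding tail_def
  by (rule infsum_mono2) (use l_nonneg summable_on_subset_banach[OF l_summable] in auto)

lemma length_le_tail:
  assumes "e \<in> edges G" "e \<notin> S" shows "l e \<le> tail S"
proof -
  have "sum l {e} \<le> infsum l (edges G - S)"
    by (rule finite_sum_le_infsum)
       (use assms l_nonneg summable_on_subset_banach[OF l_summable] in auto)
  then show ?thesis by (simp add: tail_def)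
qed

text \<open>The finite partial sums of a convergent sum come close to its value.\<close>

lemma small_tail:
  assumes "0 < \<epsilon>"
  obtains S where "finite S" "S \<subseteq> edges G" "tail S < \<epsilon>"
proof -
  have "(sum l \<longlongrightarrow> infsum l (edges G)) (finite_subsets_at_top (edges G))"
    using l_summable has_sum_def has_sum_infsum by blast
  then have "\<forall>\<^sub>F S in finite_subsets_at_top (edges G). dist (sum l S) (infsum l (edges G)) < \<epsilon>"
    using assms by (rule tendstoD)
  then obtain S where S: "finite S" "S \<subseteq> edges G" "dist (sum l S) (infsum l (edges G)) < \<epsilon>"
    unfolding eventually_finite_subsets_at_top by blast
  have "infsum l (edges G - S) = infsum l (edges G) - infsum l S"
    by (rule infsum_Diff) (use l_summable S in auto)
  then have "tail S < \<epsilon>" using S by (simp add: tail_def dist_real_def)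
  with S that show thesis by blast
qed

text \<open>The edges of a walk are joined one by one into an arc.\<close>

lemma linked_imp_arc_within:
  assumes "linked (del_edges G S) x y" "x \<in> verts G"
  shows "y \<in> verts G \<and> arc_within X (points (del_edges G S)) (vertex_pt x) (vertex_pt y)"
  using assms(1) unfolding linked_def
proof (induction rule: rtrancl_induct)
  case base
  then show ?case using assms(2) vertex_pt_in_points
    by (auto simp: arc_within_def topspace_X points_def del_edges_def)
next
  case (step y z)
  then have e: "{y, z} \<in> edges G" "{y, z} \<notin> S" by (auto simp: del_edges_def)
  then have "z \<in> verts G" using edge_subset_verts by blast
  have "arc_within X (segment {y, z} (vertex_pt y) (vertex_pt z)) (vertex_pt y) (vertex_pt z)"
    by (rule arc_within_segment) (use e vertex_pt_mem_edge_pts in auto)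
  moreover have "segment {y, z} (vertex_pt y) (vertex_pt z) \<subseteq> points (del_edges G S)"
    using segment_subset e by (fastforce simp: points_def del_edges_def)
  ultimately have "arc_within X (points (del_edges G S)) (vertex_pt y) (vertex_pt z)"
    by (rule arc_within_subset)
  from arc_within_trans[OF Hausdorff_X conjunct2[OF step.IH] this] \<open>z \<in> verts G\<close>
  show ?case by simp
qed

lemma linked_in_verts: "linked (del_edges G S) x y \<Longrightarrow> x \<in> verts G \<Longrightarrow> y \<in> verts G"
  using linked_imp_arc_within by blast

lemma linked_G: "x \<in> verts G \<Longrightarrow> y \<in> verts G \<Longrightarrow> linked (del_edges G {}) x y"
  using connected by (simp add: connected_graph_def linked_def del_edges_def)

lemma len_dist_le:
  assumes "is_arc G p q P"
  shows "len_dist G \<sigma> p q \<le> arc_length G \<sigma> P"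
  unfolding len_dist_def
  by (rule cInf_lower) (use assms arc_length_nonneg is_arcD(2) in \<open>auto intro!: bdd_belowI[of _ 0]\<close>)

text \<open>Deleting a finite set \<open>S\<close> of edges leaves only the total length \<open>tail S\<close>. An arc that avoids
  the interiors of the edges in \<open>S\<close> except for given segments is therefore no longer than
  \<open>tail S\<close> and these segments together.\<close>

lemma len_dist_le_tail:
  assumes "arc_within X (points (del_edges G S) \<union> Q) p q"
    and S: "finite S" "S \<subseteq> edges G"
    and Q: "\<And>f r. f \<in> S \<Longrightarrow> r \<in> Q \<Longrightarrow> r \<in> edge_pts f \<Longrightarrow>
      r \<in> vertex_pt ` f \<or> \<sigma> f r \<in> closed_segment (a f) (b f)"
  shows "len_dist G \<sigma> p q \<le> tail S + (\<Sum>f\<in>S. \<bar>a f - b f\<bar>)"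
proof -
  obtain P where P: "P \<subseteq> points (del_edges G S) \<union> Q" "is_arc G p q P"
    using arc_within_imp_is_arc[OF assms(1)] by blast
  \<comment> \<open>An edge outside \<open>S\<close> contributes at most its length. An edge in \<open>S\<close> is met in its segment and
    in its endvertices, which have measure zero.\<close>
  define w where "w f = (if f \<in> S then \<bar>a f - b f\<bar> else l f)" for f
  have trace: "\<sigma> f ` (P \<inter> edge_pts f) \<subseteq> \<sigma> f ` vertex_pt ` f \<union> closed_segment (a f) (b f)"
    if f: "f \<in> edges G" "f \<in> S" for f
  proof (rule image_subsetI)
    fix r assume r: "r \<in> P \<inter> edge_pts f"
    have "r \<in> vertex_pt ` f \<or> \<sigma> f r \<in> closed_segment (a f) (b f)"
    proof (cases "r \<in> Q")
      case False
      with r P(1) have "r \<in> points (del_edges G S)" by blast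
      then consider v where "v \<in> verts G" "r = vertex_pt v"
        | g where "g \<in> edges G" "g \<notin> S" "r \<in> edge_pts g"
        by (auto simp: points_def del_edges_def)
      then show ?thesis
      proof cases
        case 1
        then show ?thesis using r vertex_pt_mem_edge_pts[OF f(1)] by blast
      next
        case 2
        then have "f \<noteq> g" using f by blast
        from edge_pts_Int[OF f(1) 2(1) this] r 2(3) show ?thesis by blast
      qed
    qed (use Q f r in blast)
    then show "\<sigma> f r \<in> \<sigma> f ` vertex_pt ` f \<union> closed_segment (a f) (b f)" by blast
  qed
  have summable: "w summable_on (edges G - S)"
    by (rule summable_on_cong[THEN iffD1, OF _ summable_on_subset_banach[OF l_summable]])
       (auto simp: w_def)
  have "arc_length G \<sigma> P \<le> infsum w (edges G)"
  proof (rule arc_length_le[OF is_arcD(2)[OF P(2)]])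
    fix f assume f: "f \<in> edges G"
    show "measure lborel (\<sigma> f ` (P \<inter> edge_pts f)) \<le> w f"
    proof (cases "f \<in> S")
      case False
      then show ?thesis using measure_trace_le[OF f] by (auto simp: w_def)
    next
      case True
      let ?A = "\<sigma> f ` vertex_pt ` f" and ?B = "closed_segment (a f) (b f)"
      have fin: "finite ?A" using edge_finite[OF f] by simp
      have A: "?A \<in> fmeasurable lborel" using fin by (simp add: finite_imp_compact fmeasurable_compact)
      have B: "?B \<in> fmeasurable lborel" by (auto simp: fmeasurable_compact)
      have "compact (\<sigma> f ` (P \<inter> edge_pts f))"
        using is_arcD(2)[OF P(2)] closed_edge_pts[OF f]
        by (intro compact_continuous_image continuous_on_subset[OF sigma_continuous[OF f]])
           (auto simp: compact_Int_closed)
      then have "measure lborel (\<sigma> f ` (P \<inter> edge_pts f)) \<le> measure lborel (?A \<union> ?B)"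
        by (intro measure_mono_fmeasurable[OF trace[OF f True]] fmeasurable.Un A B)
           (auto intro: borel_compact)
      also have "\<dots> \<le> measure lborel ?A + measure lborel ?B"
        by (rule measure_Un_le) (use A B in \<open>auto simp: fmeasurable_def\<close>)
      also have "measure lborel ?A = 0"
        using emeasure_lborel_countable[OF countable_finite[OF fin]] by (simp add: measure_def)
      also have "0 + measure lborel ?B = w f"
        using True by (auto simp: w_def closed_segment_eq_real_ivl)
      finally show ?thesis .
    qed
  next
    have "w summable_on ((edges G - S) \<union> S)"
      using summable by (rule summable_on_Un_disjoint) (use S in auto)
    then show "w summable_on edges G" using S by (simp add: Un_absorb2)
  qed
  also have "infsum w (edges G) = tail S + (\<Sum>f\<in>S. \<bar>a f - b f\<bar>)"
  proof -
    have "infsum w (edges G - S) = tail S"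
      unfolding tail_def by (rule infsum_cong) (auto simp: w_def)
    moreover have "infsum w S = (\<Sum>f\<in>S. \<bar>a f - b f\<bar>)" using S by (simp add: w_def)
    moreover have "infsum w ((edges G - S) \<union> S) = infsum w (edges G - S) + infsum w S"
      using summable by (rule infsum_Un_disjoint) (use S in auto)
    ultimately show ?thesis using S by (simp add: Un_absorb2)
  qed
  finally show ?thesis using len_dist_le[OF P(2)] by linarith
qed

text \<open>Without an arc the infimum defining the distance would be that of the empty set, and lower
  bounds for arcs would say nothing about the distance.\<close>

lemma arc_exists:
  assumes "p \<in> points G" "q \<in> points G"
  shows "\<exists>P. is_arc G p q P"
proof -
  have to_vertex: "\<exists>v\<in>verts G. arc_within X (points G) p (vertex_pt v) \<and>
      arc_within X (points G) (vertex_pt v) p" if p: "p \<in> points G" for p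
    using p
  proof (cases rule: points_cases)
    case (1 v)
    then show ?thesis using p by (auto simp: arc_within_def topspace_X)
  next
    case (2 e)
    obtain x y where xy: "x \<in> verts G" "x \<noteq> y" "e = {x, y}" by (rule edgeE[OF 2(1)])
    have pe: "p \<in> edge_pts e" "vertex_pt x \<in> edge_pts e"
      using 2 xy vertex_pt_mem_edge_pts[OF 2(1)] by (auto simp: edge_interior_def)
    show ?thesis
      using arc_within_subset[OF arc_within_segment[OF 2(1)]] pe xy(1)
        order_trans[OF segment_subset edge_pts_subset_points[OF 2(1)]] by blast
  qed
  obtain v w where v: "v \<in> verts G" "arc_within X (points G) p (vertex_pt v)"
    and w: "w \<in> verts G" "arc_within X (points G) (vertex_pt w) q"
    using to_vertex assms by blast
  have vw: "arc_within X (points (del_edges G {})) (vertex_pt v) (vertex_pt w)"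
    using linked_imp_arc_within linked_G v(1) w(1) by blast
  from arc_within_imp_is_arc[OF arc_within_trans[OF Hausdorff_X
      arc_within_trans[OF Hausdorff_X v(2) vw] w(2)]]
  show ?thesis by blast
qed

lemma len_dist_ge:
  assumes "p \<in> points G" "q \<in> points G" "\<And>P. is_arc G p q P \<Longrightarrow> \<delta> \<le> arc_length G \<sigma> P"
  shows "\<delta> \<le> len_dist G \<sigma> p q"
  unfolding len_dist_def
  by (rule cInf_greatest) (use assms arc_exists in auto)

section \<open>Separation by finite edge sets\<close>

text \<open>The part of a basic neighbourhood of \<open>ETOP\<close> that lies in the graph, with the inner points
  cutting the edges of \<open>S\<close> given by their coordinates.\<close>

definition nbhd :: "'v set \<Rightarrow> 'v set set \<Rightarrow> ('v set \<Rightarrow> 'v \<Rightarrow> real) \<Rightarrow> ('v \<Rightarrow> real) set" where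
  "nbhd U S t = {p \<in> points G. p \<in> vertex_pt ` U \<or>
     (\<exists>e\<in>edges G - S. e \<subseteq> U \<and> p \<in> edge_pts e) \<or>
     (\<exists>e\<in>S. \<exists>y\<in>e \<inter> U. p \<in> edge_pts e \<and> t e y < p y)}"

text \<open>The edges leaving \<open>U\<close> belong to \<open>S\<close>; so \<open>U\<close> is a union of components of \<open>G - S\<close>.\<close>

definition cut :: "'v set \<Rightarrow> 'v set set \<Rightarrow> bool" where
  "cut U S \<longleftrightarrow> S \<subseteq> edges G \<and> U \<subseteq> verts G \<and> (\<forall>e\<in>edges G - S. e \<subseteq> U \<or> e \<inter> U = {})"

definition inner_coords :: "'v set \<Rightarrow> 'v set set \<Rightarrow> ('v set \<Rightarrow> 'v \<Rightarrow> real) \<Rightarrow> bool" where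
  "inner_coords U S t \<longleftrightarrow> (\<forall>e\<in>S. \<forall>y\<in>e \<inter> U. 0 < t e y \<and> t e y < 1)"

text \<open>A vertex may lie in many edges, and each of them could put it into the neighbourhood. The
  following rules show that all of them agree, so that membership can be read off from any one edge
  containing the point.\<close>

lemma nbhd_vertex:
  assumes "cut U S" "inner_coords U S t" "v \<in> verts G"
  shows "vertex_pt v \<in> nbhd U S t \<longleftrightarrow> v \<in> U"
proof
  assume "vertex_pt v \<in> nbhd U S t"
  then consider "v \<in> U" | e where "e \<in> edges G - S" "e \<subseteq> U" "vertex_pt v \<in> edge_pts e"
    | e y where "e \<in> S" "y \<in> e \<inter> U" "t e y < vertex_pt v y"
    unfolding nbhd_def by auto
  then show "v \<in> U"
  proof cases
    case 2
    then show ?thesis using vertex_pt_mem_edge_pts by blast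
  next
    case 3
    then have "0 < t e y" using assms(2) by (auto simp: inner_coords_def)
    then show ?thesis using 3 by (auto simp: vertex_pt_apply split: if_splits)
  qed
qed (use assms vertex_pt_in_points in \<open>auto simp: nbhd_def\<close>)

lemma nbhd_interior:
  assumes "S \<subseteq> edges G" and e: "e \<in> edges G" and p: "p \<in> edge_interior e"
  shows "p \<in> nbhd U S t \<longleftrightarrow> (if e \<in> S then \<exists>y\<in>e \<inter> U. t e y < p y else e \<subseteq> U)"
proof -
  have pe: "p \<in> edge_pts e" using p by (simp add: edge_interior_def)
  have 1: "p \<notin> vertex_pt ` U" using edge_interior_not_vertex[OF e p] by blast
  have 2: "p \<in> edge_pts f \<longleftrightarrow> f = e" if "f \<in> edges G" for f
    using edge_interior_disjoint[OF e that _ p] pe by blast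
  have 3: "(\<exists>f\<in>edges G - S. f \<subseteq> U \<and> p \<in> edge_pts f) \<longleftrightarrow> e \<notin> S \<and> e \<subseteq> U"
    using 2 e by (auto simp: Bex_def)
  have 4: "(\<exists>f\<in>S. \<exists>y\<in>f \<inter> U. p \<in> edge_pts f \<and> t f y < p y) \<longleftrightarrow> e \<in> S \<and> (\<exists>y\<in>e \<inter> U. t e y < p y)"
  proof
    assume "\<exists>f\<in>S. \<exists>y\<in>f \<inter> U. p \<in> edge_pts f \<and> t f y < p y"
    then obtain f y where f: "f \<in> S" "y \<in> f \<inter> U" "p \<in> edge_pts f" "t f y < p y" by blast
    then have "f = e" using 2[of f] assms(1) by blast
    then show "e \<in> S \<and> (\<exists>y\<in>e \<inter> U. t e y < p y)" using f by blast
  qed (use pe in blast)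
  show ?thesis unfolding nbhd_def mem_Collect_eq 3 4
    using 1 pe edge_pts_subset_points[OF e] by auto
qed

lemma nbhd_edge_outside:
  assumes cut: "cut U S" and t: "inner_coords U S t" and e: "e \<in> edges G" "e \<notin> S"
    and p: "p \<in> edge_pts e"
  shows "p \<in> nbhd U S t \<longleftrightarrow> e \<subseteq> U"
proof (cases "p \<in> vertex_pt ` e")
  case True
  then obtain v where v: "v \<in> e" "p = vertex_pt v" by blast
  then have "v \<in> verts G" using edge_subset_verts e by blast
  then show ?thesis using nbhd_vertex[OF cut t] v cut e unfolding cut_def by blast
next
  case False
  then have pi: "p \<in> edge_interior e" using p by (simp add: edge_interior_def)
  show ?thesis using nbhd_interior[OF _ e(1) pi] cut e(2) by (simp add: cut_def)
qed

lemma nbhd_edge_inside: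
  assumes cut: "cut U S" and t: "inner_coords U S t" and e: "e \<in> S" and p: "p \<in> edge_pts e"
  shows "p \<in> nbhd U S t \<longleftrightarrow> (\<exists>y\<in>e \<inter> U. t e y < p y)"
proof (cases "p \<in> vertex_pt ` e")
  case True
  have eE: "e \<in> edges G" using cut e by (auto simp: cut_def)
  from True obtain v where v: "v \<in> e" "p = vertex_pt v" by blast
  then have "v \<in> verts G" using edge_subset_verts eE by blast
  moreover have "v \<in> U \<longleftrightarrow> (\<exists>y\<in>e \<inter> U. t e y < p y)"
  proof
    assume "v \<in> U"
    then show "\<exists>y\<in>e \<inter> U. t e y < p y"
      using t e v by (intro bexI[of _ v]) (auto simp: inner_coords_def vertex_pt_apply)
  next
    assume "\<exists>y\<in>e \<inter> U. t e y < p y"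
    then obtain y where y: "y \<in> e \<inter> U" "t e y < p y" by blast
    then have "0 < t e y" using t e by (auto simp: inner_coords_def)
    then show "v \<in> U" using y v by (auto simp: vertex_pt_apply split: if_splits)
  qed
  ultimately show ?thesis using nbhd_vertex[OF cut t] v by blast
next
  case False
  have eE: "e \<in> edges G" using cut e by (auto simp: cut_def)
  from False have pi: "p \<in> edge_interior e" using p by (simp add: edge_interior_def)
  show ?thesis using nbhd_interior[OF _ eE pi] cut e by (simp add: cut_def)
qed

lemma nbhd_antimono:
  assumes "\<And>e y. e \<in> S \<Longrightarrow> y \<in> e \<inter> U \<Longrightarrow> s e y \<le> t e y"
  shows "nbhd U S t \<subseteq> nbhd U S s"
  unfolding nbhd_def
proof (intro Collect_mono impI, elim conjE, intro conjI, assumption, elim disjE)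
  fix p assume "\<exists>e\<in>S. \<exists>y\<in>e \<inter> U. p \<in> edge_pts e \<and> t e y < p y"
  then have "\<exists>e\<in>S. \<exists>y\<in>e \<inter> U. p \<in> edge_pts e \<and> s e y < p y"
    using assms by (meson le_less_trans)
  then show "p \<in> vertex_pt ` U \<or> (\<exists>e\<in>edges G - S. e \<subseteq> U \<and> p \<in> edge_pts e) \<or>
      (\<exists>e\<in>S. \<exists>y\<in>e \<inter> U. p \<in> edge_pts e \<and> s e y < p y)" by blast
qed blast+

lemma openin_nbhd:
  assumes cut: "cut U S" and t: "inner_coords U S t"
  shows "openin X (nbhd U S t)"
  unfolding openin_complex_topology
proof (intro conjI ballI)
  show "nbhd U S t \<subseteq> points G" by (auto simp: nbhd_def)
  fix e assume e: "e \<in> edges G"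
  show "openin (top_of_set (edge_pts e)) (nbhd U S t \<inter> edge_pts e)"
  proof (cases "e \<in> S")
    case False
    then have "nbhd U S t \<inter> edge_pts e = (if e \<subseteq> U then edge_pts e else {})"
      using nbhd_edge_outside[OF cut t e] by auto
    then show ?thesis by simp
  next
    case True
    then have "nbhd U S t \<inter> edge_pts e = (\<Union>y\<in>e \<inter> U. {p \<in> edge_pts e. t e y < p y})"
      using nbhd_edge_inside[OF cut t] by auto
    then show ?thesis
      by (simp only:) (rule openin_Union, erule imageE, simp only: openin_edge_coordinate(1))
  qed
qed

text \<open>The complement of a neighbourhood becomes open after removing the points at which the edges
  are cut off.\<close>

lemma openin_nbhd_complement:
  assumes cut: "cut U S" and t: "inner_coords U S t"
  shows "openin X {p \<in> points G. p \<notin> nbhd U S t \<and> (\<forall>e\<in>S. \<forall>y\<in>e \<inter> U. p \<in> edge_pts e \<longrightarrow> p y \<noteq> t e y)}"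
    (is "openin X ?B")
  unfolding openin_complex_topology
proof (intro conjI ballI)
  show "?B \<subseteq> points G" by auto
  fix e assume e: "e \<in> edges G"
  have vertex: "p y \<noteq> t f y" if "p \<in> edge_pts e" "p \<in> edge_pts f" "f \<in> S" "y \<in> f \<inter> U" "f \<noteq> e" for p f y
  proof -
    have "f \<in> edges G" using cut that(3) by (auto simp: cut_def)
    from edge_pts_Int[OF e this _ that(1,2)] that(5) obtain v where "p = vertex_pt v" by blast
    moreover have "0 < t f y" "t f y < 1" using t that by (auto simp: inner_coords_def)
    ultimately show ?thesis by (auto simp: vertex_pt_apply)
  qed
  show "openin (top_of_set (edge_pts e)) (?B \<inter> edge_pts e)"
  proof (cases "e \<in> S")
    case False
    have "?B \<inter> edge_pts e = (if e \<subseteq> U then {} else edge_pts e)"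
    proof (rule set_eqI)
      fix p
      show "p \<in> ?B \<inter> edge_pts e \<longleftrightarrow> p \<in> (if e \<subseteq> U then {} else edge_pts e)"
        using nbhd_edge_outside[OF cut t e False, of p] vertex[of p] False edge_pts_subset_points[OF e]
        by auto
    qed
    then show ?thesis by simp
  next
    case True
    have "?B \<inter> edge_pts e = edge_pts e \<inter> (\<Inter>y\<in>e \<inter> U. {p \<in> edge_pts e. p y < t e y})"
    proof (rule set_eqI)
      fix p
      show "p \<in> ?B \<inter> edge_pts e \<longleftrightarrow> p \<in> edge_pts e \<inter> (\<Inter>y\<in>e \<inter> U. {p \<in> edge_pts e. p y < t e y})"
      proof (cases "p \<in> edge_pts e")
        case p: True
        have "(\<forall>f\<in>S. \<forall>y\<in>f \<inter> U. p \<in> edge_pts f \<longrightarrow> p y \<noteq> t f y) \<longleftrightarrow> (\<forall>y\<in>e \<inter> U. p y \<noteq> t e y)"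
          using vertex[OF p] p True by blast
        moreover have "p \<in> points G" using edge_pts_subset_points[OF e] p by blast
        ultimately have "p \<in> ?B \<longleftrightarrow> \<not> (\<exists>y\<in>e \<inter> U. t e y < p y) \<and> (\<forall>y\<in>e \<inter> U. p y \<noteq> t e y)"
          unfolding mem_Collect_eq nbhd_edge_inside[OF cut t True p] by (simp only: simp_thms)
        also have "\<dots> \<longleftrightarrow> (\<forall>y\<in>e \<inter> U. p y < t e y)" by (force simp: linorder_neq_iff)
        finally have "p \<in> ?B \<longleftrightarrow> (\<forall>y\<in>e \<inter> U. p y < t e y)" .
        then show ?thesis using p by auto
      qed auto
    qed
    moreover have "finite (e \<inter> U)" using edge_finite[OF e] by simp
    ultimately show ?thesis
      using openin_edge_coordinate(2)[of e] by (cases "e \<inter> U = {}") (auto intro!: openin_Int openin_INT2)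
  qed
qed

text \<open>A connected set leaving a neighbourhood must run along one of the cut edges. Otherwise it
  misses an inner point of every such edge, and the neighbourhood cut off at these points is both
  open and closed in it.\<close>

lemma connected_crosses_cut:
  assumes cut: "cut U S" and P: "connectedin X P"
    and t: "inner_coords U S t" and t': "inner_coords U S t'"
    and p: "p \<in> P" "p \<in> nbhd U S t'" and q: "q \<in> P" "q \<notin> nbhd U S t"
  shows "\<exists>e\<in>S. \<exists>y\<in>e \<inter> U. {r \<in> edge_pts e. t e y \<le> r y \<and> r y \<le> t' e y} \<subseteq> P"
proof (rule ccontr)
  assume "\<not> ?thesis"
  then have "\<forall>e\<in>S. \<forall>y\<in>e \<inter> U. \<exists>r. r \<in> edge_pts e \<and> t e y \<le> r y \<and> r y \<le> t' e y \<and> r \<notin> P" by blast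
  then obtain w where w: "\<And>e y. e \<in> S \<Longrightarrow> y \<in> e \<inter> U \<Longrightarrow>
      w e y \<in> edge_pts e \<and> t e y \<le> w e y y \<and> w e y y \<le> t' e y \<and> w e y \<notin> P"
    by metis
  \<comment> \<open>Moving the thresholds to the missing points makes the boundary of the neighbourhood disjoint
    from \<open>P\<close>.\<close>
  define s where "s e y = w e y y" for e y
  have s: "inner_coords U S s"
    unfolding inner_coords_def s_def
  proof (intro ballI conjI)
    fix e y assume ey: "e \<in> S" "y \<in> e \<inter> U"
    show "0 < w e y y" "w e y y < 1"
      using w[OF ey] t t' ey unfolding inner_coords_def by (meson less_le_trans le_less_trans)+
  qed
  let ?A = "nbhd U S s"
  let ?B = "{p \<in> points G. p \<notin> nbhd U S s \<and> (\<forall>e\<in>S. \<forall>y\<in>e \<inter> U. p \<in> edge_pts e \<longrightarrow> p y \<noteq> s e y)}"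
  have PG: "P \<subseteq> points G" using connectedin_subset_topspace[OF P] by (simp add: topspace_X)
  have P_not: "r y \<noteq> s e y" if r: "r \<in> P" "e \<in> S" "y \<in> e \<inter> U" "r \<in> edge_pts e" for r e y
  proof
    assume eq: "r y = s e y"
    have "e \<in> edges G" using cut r by (auto simp: cut_def)
    then obtain x where x: "x \<noteq> y" "e = {x, y}" using edgeE'[of e y] r(3) by blast
    have "r = w e y"
      using edge_pts_coordinates(2)[OF x(1)] r(4) w[OF r(2,3)] eq x unfolding s_def by metis
    then show False using w[OF r(2,3)] r(1) by simp
  qed
  have "P \<subseteq> ?A \<union> ?B" using PG P_not by blast
  moreover have "?A \<inter> ?B \<inter> P = {}" by blast
  moreover have "?A \<inter> P \<noteq> {}"
    using p nbhd_antimono[of S U s t'] w unfolding s_def by blast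
  moreover have "q \<in> ?B"
    using q PG P_not nbhd_antimono[of S U t s] w unfolding s_def by blast
  moreover note openin_nbhd[OF cut s] openin_nbhd_complement[OF cut s]
  ultimately show False using P q(1) unfolding connectedin by blast
qed

text \<open>An arc that crosses from one threshold to the other contains one of finitely many nontrivial
  segments, hence is at least as long as the shortest of them.\<close>

lemma arc_crossing_length:
  assumes cut: "cut U S" and S: "finite S"
    and t: "inner_coords U S t" and t': "inner_coords U S t'"
    and less: "\<And>e y. e \<in> S \<Longrightarrow> y \<in> e \<inter> U \<Longrightarrow> t e y < t' e y"
  shows "\<exists>\<delta>>0. \<forall>P a b. connectedin X P \<and> compact P \<and> a \<in> P \<and> b \<in> P \<and>
    a \<in> nbhd U S t' \<and> b \<notin> nbhd U S t \<longrightarrow> \<delta> \<le> arc_length G \<sigma> P"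
proof -
  let ?J = "\<lambda>(e, y). {r \<in> edge_pts e. t e y \<le> r y \<and> r y \<le> t' e y}"
  have "\<exists>\<delta>>0. \<forall>a\<in>(SIGMA e:S. e \<inter> U). \<forall>P. (compact P \<and> ?J a \<subseteq> P) \<longrightarrow> \<delta> \<le> arc_length G \<sigma> P"
  proof (rule finite_uniform_bound)
    show "finite (SIGMA e:S. e \<inter> U)"
      using S cut edge_finite by (auto simp: cut_def)
    fix a assume "a \<in> (SIGMA e:S. e \<inter> U)"
    then obtain e y where a: "a = (e, y)" and ey: "e \<in> S" "y \<in> e \<inter> U" by blast
    have e: "e \<in> edges G" using cut ey by (auto simp: cut_def)
    obtain x where x: "x \<noteq> y" "e = {x, y}" using edgeE'[OF e, of y] ey by blast
    have ty: "0 < t e y" "t e y < 1" "t e y < t' e y" "t' e y < 1"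
      using t t' less[OF ey] ey unfolding inner_coords_def by auto
    let ?u = "edge_pt x y (t e y)" and ?v = "edge_pt x y (t' e y)"
    have y_coord: "edge_pt x y c y = c" for c by (simp add: edge_pt_def)
    have J: "?J a = edge_pt x y ` {t e y..t' e y}"
    proof (rule set_eqI, rule iffI)
      fix r assume "r \<in> ?J a"
      then have r: "r \<in> edge_pts {x, y}" "r y \<in> {t e y..t' e y}" using a x by auto
      then show "r \<in> edge_pt x y ` {t e y..t' e y}"
        using edge_pts_coordinates(2)[OF x(1) r(1)] by (metis image_eqI)
    next
      fix r assume "r \<in> edge_pt x y ` {t e y..t' e y}"
      then obtain c where c: "c \<in> {t e y..t' e y}" "r = edge_pt x y c" by blast
      then have "r \<in> edge_pts e" using edge_pt_in_edge_pts[OF x(1), of c] ty x by auto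
      then show "r \<in> ?J a" using c a by (simp add: y_coord)
    qed
    have conn: "connected (?J a)"
      unfolding J by (rule connected_continuous_image[OF continuous_on_edge_pt]) simp
    have uv: "?u \<in> ?J a" "?v \<in> ?J a" unfolding J using ty by auto
    have sub: "?J a \<subseteq> edge_pts e" using a by auto
    have "?u \<noteq> ?v" using ty y_coord by (metis less_irrefl)
    then have "\<sigma> e ?u \<noteq> \<sigma> e ?v"
      using inj_on_eq_iff[OF sigma_inj[OF e]] uv sub by blast
    then have "0 < \<bar>\<sigma> e ?u - \<sigma> e ?v\<bar>" by simp
    moreover have "\<bar>\<sigma> e ?u - \<sigma> e ?v\<bar> \<le> arc_length G \<sigma> P" if "compact P \<and> ?J a \<subseteq> P" for P
      by (rule arc_length_ge[OF e _ conn _ uv]) (use that sub in blast)+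
    ultimately show "\<exists>\<delta>>0. \<forall>P. (compact P \<and> ?J a \<subseteq> P) \<longrightarrow> \<delta> \<le> arc_length G \<sigma> P" by blast
  qed
  then obtain \<delta> where \<delta>: "\<delta> > 0" "\<forall>a\<in>(SIGMA e:S. e \<inter> U). \<forall>P. (compact P \<and> ?J a \<subseteq> P) \<longrightarrow> \<delta> \<le> arc_length G \<sigma> P"
    by (elim exE conjE)
  show ?thesis
  proof (intro exI[of _ \<delta>] conjI allI impI, fact, elim conjE)
    fix P a b assume P: "connectedin X P" "compact P"
      and ab: "a \<in> P" "b \<in> P" "a \<in> nbhd U S t'" "b \<notin> nbhd U S t"
    obtain e y where ey: "e \<in> S" "y \<in> e \<inter> U" "{r \<in> edge_pts e. t e y \<le> r y \<and> r y \<le> t' e y} \<subseteq> P"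
      using connected_crosses_cut[OF cut P(1) t t' ab(1,3,2,4)] by blast
    then show "\<delta> \<le> arc_length G \<sigma> P" using \<delta>(2)[rule_format, of "(e, y)" P] P(2) by simp
  qed
qed

text \<open>The second threshold may be any one closer to the component; the midpoint between the first
  threshold and the endvertex will do.\<close>

lemma nbhd_distance:
  assumes cut: "cut U S" and S: "finite S" and t: "inner_coords U S t"
  shows "\<exists>\<delta>>0. \<forall>x\<in>U. \<forall>q\<in>points G - nbhd U S t. \<delta> \<le> len_dist G \<sigma> (vertex_pt x) q"
proof -
  define t' where "t' e y = (1 + t e y) / 2" for e and y :: 'v
  have t': "inner_coords U S t'" "\<And>e y. e \<in> S \<Longrightarrow> y \<in> e \<inter> U \<Longrightarrow> t e y < t' e y"
    using t unfolding inner_coords_def t'_def by (auto intro: add_pos_pos)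
  obtain \<delta> where \<delta>: "\<delta> > 0" "\<And>P a b. connectedin X P \<Longrightarrow> compact P \<Longrightarrow> a \<in> P \<Longrightarrow> b \<in> P \<Longrightarrow>
      a \<in> nbhd U S t' \<Longrightarrow> b \<notin> nbhd U S t \<Longrightarrow> \<delta> \<le> arc_length G \<sigma> P"
    using arc_crossing_length[OF cut S t t'] by meson
  have "\<delta> \<le> len_dist G \<sigma> (vertex_pt x) q" if x: "x \<in> U" and q: "q \<in> points G - nbhd U S t" for x q
  proof (rule len_dist_ge)
    have xv: "x \<in> verts G" using x cut by (auto simp: cut_def)
    then show "vertex_pt x \<in> points G" by (rule vertex_pt_in_points)
    have "vertex_pt x \<in> nbhd U S t'" using nbhd_vertex[OF cut t'(1) xv] x by simp
    then show "\<delta> \<le> arc_length G \<sigma> P" if "is_arc G (vertex_pt x) q P" for P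
      using \<delta>(2)[OF is_arcD(1-4)[OF that]] q by blast
  qed (use q in blast)
  then show ?thesis using \<delta>(1) by blast
qed

text \<open>The complement of a segment of one edge is a neighbourhood of the whole vertex set. So a
  short arc from an inner point of an edge does not leave a prescribed segment.\<close>

lemma edge_interior_distance:
  assumes e: "e \<in> edges G" and W: "openin (top_of_set (edge_interior e)) W" and p: "p \<in> W"
  shows "\<exists>\<delta>>0. \<forall>q\<in>points G - W. \<delta> \<le> len_dist G \<sigma> p q"
proof -
  have WI: "W \<subseteq> edge_interior e" using openin_imp_subset[OF W] .
  have pe: "p \<in> edge_pts e" using WI p by (auto simp: edge_interior_def)
  obtain O' where O': "open O'" "W = edge_interior e \<inter> O'" using W by (auto simp: openin_open)
  obtain x y where xy: "x \<noteq> y" "e = {x, y}" by (rule edgeE[OF e])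
  have coords: "r x = 1 - r y" if "r \<in> edge_pts e" for r
    using that xy by (simp add: edge_pts_def)
  have py: "0 < p y" "p y < 1"
    using edge_interior_doubleton[OF xy(1), of p] WI p xy(2) by blast+
  have "open (edge_pt x y -` O')"
    using O'(1) continuous_on_edge_pt[of UNIV x y] by (simp add: continuous_on_open_vimage)
  moreover have "p y \<in> edge_pt x y -` O'"
    using edge_pts_coordinates(2)[OF xy(1), of p] pe xy(2) p O' by simp
  ultimately obtain \<epsilon> where \<epsilon>: "0 < \<epsilon>" "ball (p y) \<epsilon> \<subseteq> edge_pt x y -` O'"
    using open_contains_ball by blast
  \<comment> \<open>The segment must also keep away from both endvertices.\<close>
  define c where "c = Min {\<epsilon> / 2, p y / 2, (1 - p y) / 2}"
  have c: "0 < c" "c < \<epsilon>" "c < p y" "c < 1 - p y"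
    using \<epsilon> py by (auto simp: c_def min_def)
  have near: "r \<in> W" if r: "r \<in> edge_pts e" "\<bar>r y - p y\<bar> \<le> c" for r
  proof -
    have "r y \<in> ball (p y) \<epsilon>" using r c by (auto simp: dist_real_def)
    then have "edge_pt x y (r y) \<in> O'" using \<epsilon>(2) by blast
    then have "r \<in> O'" using edge_pts_coordinates(2)[OF xy(1), of r] r(1) xy(2) by simp
    moreover have "r \<in> edge_interior e"
      using edge_interior_doubleton[OF xy(1), of r] r xy(2) c by auto
    ultimately show ?thesis using O'(2) by blast
  qed
  \<comment> \<open>With both thresholds of \<open>e\<close> at \<open>p\<close>, the neighbourhood of the vertex set is everything except
    \<open>p\<close>; raising them by \<open>c\<close> leaves out a segment around \<open>p\<close> that lies in \<open>W\<close>.\<close>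
  define t where "t f v = p v" for f :: "'v set" and v
  define t' where "t' f v = p v + c" for f :: "'v set" and v
  have cut: "cut (verts G) {e}"
    using e edge_subset_verts by (auto simp: cut_def)
  have px: "p x = 1 - p y" by (rule coords[OF pe])
  have t: "inner_coords (verts G) {e} t" "inner_coords (verts G) {e} t'"
    "\<And>f v. f \<in> {e} \<Longrightarrow> v \<in> f \<inter> verts G \<Longrightarrow> t f v < t' f v"
    using c py px xy(2) by (auto simp: inner_coords_def t_def t'_def)
  have "p \<notin> nbhd (verts G) {e} t"
    using nbhd_edge_inside[OF cut t(1) _ pe] by (auto simp: t_def)
  moreover have "q \<in> nbhd (verts G) {e} t'" if q: "q \<in> points G" "q \<notin> W" for q
  proof (cases "q \<in> edge_pts e")
    case True
    then have "\<not> \<bar>q y - p y\<bar> \<le> c" using near q by blast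
    then have "t' e y < q y \<or> t' e x < q x" using coords[OF True] px by (auto simp: t'_def)
    then show ?thesis
      using nbhd_edge_inside[OF cut t(2) _ True] xy(2) edge_subset_verts[OF e] by auto
  next
    case False
    from q(1) consider v where "v \<in> verts G" "q = vertex_pt v"
      | f where "f \<in> edges G" "q \<in> edge_pts f"
      by (auto simp: points_def)
    then show ?thesis
    proof cases
      case 1
      then show ?thesis using nbhd_vertex[OF cut t(2)] by simp
    next
      case 2
      then have "f \<notin> {e}" using False by blast
      then show ?thesis using nbhd_edge_outside[OF cut t(2) 2(1) _ 2(2)] edge_subset_verts[OF 2(1)] by simp
    qed
  qed
  moreover obtain \<delta> where \<delta>: "\<delta> > 0" "\<And>P a b. connectedin X P \<Longrightarrow> compact P \<Longrightarrow> a \<in> P \<Longrightarrow> b \<in> P \<Longrightarrow>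
      a \<in> nbhd (verts G) {e} t' \<Longrightarrow> b \<notin> nbhd (verts G) {e} t \<Longrightarrow> \<delta> \<le> arc_length G \<sigma> P"
    using arc_crossing_length[OF cut _ t] by (meson finite.emptyI finite_insert)
  ultimately have "\<delta> \<le> arc_length G \<sigma> P" if "q \<in> points G - W" "is_arc G p q P" for q P
    using is_arcD[OF that(2)] that(1) by blast
  then have "\<delta> \<le> len_dist G \<sigma> p q" if "q \<in> points G - W" for q
    by (intro len_dist_ge) (use that pe edge_pts_subset_points[OF e] in auto)
  then show ?thesis using \<delta>(1) by blast
qed

section \<open>Components\<close>

definition vcomp :: "'v set set \<Rightarrow> 'v \<Rightarrow> 'v set" where
  "vcomp S x = {y. linked (del_edges G S) x y}"

lemma vcomp_self [simp]: "x \<in> vcomp S x"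
  by (simp add: vcomp_def)

lemma vcomp_subset: "x \<in> verts G \<Longrightarrow> vcomp S x \<subseteq> verts G"
  using linked_in_verts by (auto simp: vcomp_def)

lemma vcomp_eq: "y \<in> vcomp S x \<Longrightarrow> vcomp S y = vcomp S x"
  unfolding vcomp_def mem_Collect_eq by (intro Collect_cong iffI) (erule (1) linked_trans linked_trans[OF linked_sym])+

lemma vcomp_antimono: "S \<subseteq> T \<Longrightarrow> vcomp T x \<subseteq> vcomp S x"
  unfolding vcomp_def by (intro Collect_mono impI) (rule linked_del_edges_mono)

lemma edge_in_vcomp:
  assumes "{u, v} \<in> edges G" "{u, v} \<notin> S" "u \<in> vcomp S x" shows "v \<in> vcomp S x"
proof -
  have "linked (del_edges G S) u v" by (rule linked_edge) (use assms in \<open>simp add: del_edges_def\<close>)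
  then show ?thesis using assms(3) linked_trans[of "del_edges G S"] unfolding vcomp_def by blast
qed

lemma cut_vcomp:
  assumes "S \<subseteq> edges G" "x \<in> verts G" shows "cut (vcomp S x) S"
  unfolding cut_def
proof (intro conjI ballI)
  fix e assume e: "e \<in> edges G - S"
  then obtain u v where "e = {u, v}" using edgeE by blast
  then show "e \<subseteq> vcomp S x \<or> e \<inter> vcomp S x = {}"
    using e edge_in_vcomp[of u v S x] edge_in_vcomp[of v u S x] by (auto simp: insert_commute)
qed (use assms vcomp_subset in auto)

lemma graph_components_eq:
  "graph_components (del_edges G S) =
    (\<lambda>x. (vcomp S x, {e \<in> edges G - S. e \<subseteq> vcomp S x})) ` verts G"
  unfolding graph_components_def vcomp_def by (auto simp: del_edges_def)

text \<open>The identification of vertices at distance zero is thus harmless: they lie in the same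
  component after every finite deletion of edges, as \<open>nbhd_distance\<close> separates different components
  by a positive distance.\<close>

lemma linked_if_len_dist_0:
  assumes "x \<in> verts G" "y \<in> verts G" "len_dist G \<sigma> (vertex_pt x) (vertex_pt y) = 0"
    and S: "finite S" "S \<subseteq> edges G"
  shows "linked (del_edges G S) x y"
proof (rule ccontr)
  assume "\<not> ?thesis"
  then have y: "y \<notin> vcomp S x" by (simp add: vcomp_def)
  note cut = cut_vcomp[OF S(2) assms(1)]
  have t: "inner_coords (vcomp S x) S (\<lambda>e y. 1/2)" by (simp add: inner_coords_def)
  obtain \<delta> where \<delta>: "\<delta> > 0" "\<forall>x'\<in>vcomp S x. \<forall>q\<in>points G - nbhd (vcomp S x) S (\<lambda>e y. 1/2).
      \<delta> \<le> len_dist G \<sigma> (vertex_pt x') q"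
    using nbhd_distance[OF cut S(1) t] by blast
  have "vertex_pt y \<in> points G - nbhd (vcomp S x) S (\<lambda>e y. 1/2)"
    using nbhd_vertex[OF cut t assms(2)] y vertex_pt_in_points[OF assms(2)] by blast
  from \<delta>(2)[rule_format, OF vcomp_self this] show False using \<delta>(1) assms(3) by simp
qed

section \<open>Edge-ends\<close>

text \<open>A ray uses each edge at most once.\<close>

lemma ray_eventually_avoids:
  assumes "r \<in> rays G" "finite S"
  shows "\<forall>\<^sub>F n in sequentially. {r n, r (Suc n)} \<notin> S"
proof -
  have "finite ((\<lambda>n. {r n, r (Suc n)}) -` S)"
    by (rule finite_vimageI[OF assms(2) ray_edge_inj]) (use assms(1) in \<open>simp add: rays_iff\<close>)
  then show ?thesis
    by (simp add: eventually_cofinite vimage_def flip: cofinite_eq_sequentially)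
qed

lemma ray_eventually_in_vcomp:
  assumes r: "r \<in> rays G" and "finite S"
  shows "\<exists>x\<in>verts G. \<forall>\<^sub>F n in sequentially. r n \<in> vcomp S x"
proof -
  obtain N where N: "\<And>n. n \<ge> N \<Longrightarrow> {r n, r (Suc n)} \<notin> S"
    using ray_eventually_avoids[OF assms] by (auto simp: eventually_sequentially)
  have "r n \<in> vcomp S (r N)" if "n \<ge> N" for n
    using that
  proof (induction n rule: dec_induct)
    case (step n)
    then show ?case using edge_in_vcomp[of "r n" "r (Suc n)"] r N by (simp add: rays_iff)
  qed simp
  moreover have "r N \<in> verts G" using r by (auto simp: rays_iff)
  ultimately show ?thesis by (auto simp: eventually_sequentially)
qed

abbreviation component :: "'v set set \<Rightarrow> 'v \<Rightarrow> 'v graph" where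
  "component S x \<equiv> (vcomp S x, {e \<in> edges G - S. e \<subseteq> vcomp S x})"

lemma tail_in_component_iff:
  assumes r: "r \<in> rays G" and "finite S"
  shows "tail_in (component S x) r \<longleftrightarrow> (\<forall>\<^sub>F n in sequentially. r n \<in> vcomp S x)"
proof
  assume "tail_in (component S x) r"
  then obtain N where N: "\<And>n. r (N + n) \<in> vcomp S x"
    unfolding tail_in_def rays_iff by auto
  have "r n \<in> vcomp S x" if "n \<ge> N" for n using N[of "n - N"] that by simp
  then show "\<forall>\<^sub>F n in sequentially. r n \<in> vcomp S x" by (auto simp: eventually_sequentially)
next
  assume "\<forall>\<^sub>F n in sequentially. r n \<in> vcomp S x"
  with ray_eventually_avoids[OF assms]
  have "\<forall>\<^sub>F n in sequentially. {r n, r (Suc n)} \<notin> S \<and> r n \<in> vcomp S x" by (rule eventually_conj)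
  then obtain N where N: "\<And>n. n \<ge> N \<Longrightarrow> {r n, r (Suc n)} \<notin> S \<and> r n \<in> vcomp S x"
    by (auto simp: eventually_sequentially)
  have "inj (\<lambda>n. r (N + n))" by (rule ray_shift_inj[OF r])
  then have "(\<lambda>n. r (N + n)) \<in> rays (component S x)"
    using r N[of "N + n" for n] N[of "Suc (N + n)" for n] by (auto simp: rays_iff)
  then show "tail_in (component S x) r" unfolding tail_in_def by blast
qed

lemma vcomp_eq_if_eventually:
  assumes "\<forall>\<^sub>F n in sequentially. r n \<in> vcomp S x" "\<forall>\<^sub>F n in sequentially. r n \<in> vcomp S y"
  shows "vcomp S x = vcomp S y"
proof -
  obtain n where "r n \<in> vcomp S x" "r n \<in> vcomp S y"
    using eventually_happens[OF eventually_conj[OF assms]] by auto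
  then show ?thesis using vcomp_eq by metis
qed

lemma eventually_in_vcomp_iff:
  assumes "\<forall>\<^sub>F n in sequentially. r n \<in> vcomp S x"
  shows "(\<forall>\<^sub>F n in sequentially. r n \<in> vcomp S z) \<longleftrightarrow> vcomp S z = vcomp S x"
proof
  assume "vcomp S z = vcomp S x"
  then show "\<forall>\<^sub>F n in sequentially. r n \<in> vcomp S z" using assms by (simp only:)
qed (rule vcomp_eq_if_eventually[OF _ assms])

text \<open>After deleting finitely many edges, each ray eventually stays in exactly one component. So a
  separation of two rays amounts to these components being different.\<close>

lemma edge_equiv_iff:
  "(r, r') \<in> edge_equiv G \<longleftrightarrow> r \<in> rays G \<and> r' \<in> rays G \<and>
    (\<forall>S x. finite S \<and> S \<subseteq> edges G \<and> x \<in> verts G \<longrightarrow>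
      (\<forall>\<^sub>F n in sequentially. r n \<in> vcomp S x) = (\<forall>\<^sub>F n in sequentially. r' n \<in> vcomp S x))"
proof (cases "r \<in> rays G \<and> r' \<in> rays G")
  case True
  then have r: "r \<in> rays G" "r' \<in> rays G" by auto
  have sep: "separates_rays G S r r' \<longleftrightarrow> \<not> (\<forall>x\<in>verts G.
      (\<forall>\<^sub>F n in sequentially. r n \<in> vcomp S x) = (\<forall>\<^sub>F n in sequentially. r' n \<in> vcomp S x))"
    if S: "finite S" for S
  proof -
    obtain x where x: "x \<in> verts G" "\<forall>\<^sub>F n in sequentially. r n \<in> vcomp S x"
      using ray_eventually_in_vcomp[OF r(1) S] by blast
    obtain x' where x': "x' \<in> verts G" "\<forall>\<^sub>F n in sequentially. r' n \<in> vcomp S x'"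
      using ray_eventually_in_vcomp[OF r(2) S] by blast
    have uniq: "(\<forall>\<^sub>F n in sequentially. r n \<in> vcomp S z) \<longleftrightarrow> vcomp S z = vcomp S x"
      "(\<forall>\<^sub>F n in sequentially. r' n \<in> vcomp S z) \<longleftrightarrow> vcomp S z = vcomp S x'" for z
      by (rule eventually_in_vcomp_iff, fact)+
    have "separates_rays G S r r' \<longleftrightarrow> (\<exists>y\<in>verts G. \<exists>y'\<in>verts G. component S y \<noteq> component S y' \<and>
        vcomp S y = vcomp S x \<and> vcomp S y' = vcomp S x')"
      unfolding separates_rays_def graph_components_eq bex_simps
        tail_in_component_iff[OF r(1) S] tail_in_component_iff[OF r(2) S] uniq ..
    also have "\<dots> \<longleftrightarrow> vcomp S x \<noteq> vcomp S x'" using x(1) x'(1) by auto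
    also have "\<dots> \<longleftrightarrow> \<not> (\<forall>z\<in>verts G. (vcomp S z = vcomp S x) = (vcomp S z = vcomp S x'))"
      using x(1) by auto
    finally show ?thesis unfolding uniq .
  qed
  have "(r, r') \<in> edge_equiv G \<longleftrightarrow> (\<forall>S. finite S \<and> S \<subseteq> edges G \<longrightarrow> \<not> separates_rays G S r r')"
    unfolding edge_equiv_def using r by auto
  also have "\<dots> \<longleftrightarrow> (\<forall>S x. finite S \<and> S \<subseteq> edges G \<and> x \<in> verts G \<longrightarrow>
      (\<forall>\<^sub>F n in sequentially. r n \<in> vcomp S x) = (\<forall>\<^sub>F n in sequentially. r' n \<in> vcomp S x))"
    using sep by auto
  finally show ?thesis using r by simp
qed (auto simp: edge_equiv_def)

lemma equiv_edge_equiv: "equiv (rays G) (edge_equiv G)"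
proof (rule equivI)
  show "edge_equiv G \<subseteq> rays G \<times> rays G" by (auto simp: edge_equiv_def)
  show "refl_on (rays G) (edge_equiv G)" by (auto simp: refl_on_def edge_equiv_iff)
  show "sym (edge_equiv G)" by (rule symI) (simp add: edge_equiv_iff)
  show "trans (edge_equiv G)" by (rule transI) (simp add: edge_equiv_iff)
qed

lemma end_ray:
  assumes "\<omega> \<in> edge_ends G" "r \<in> \<omega>" shows "r \<in> rays G"
  using assms in_quotient_imp_subset[OF equiv_edge_equiv] unfolding edge_ends_def by blast

definition some_ray :: "(nat \<Rightarrow> 'v) set \<Rightarrow> nat \<Rightarrow> 'v" where
  "some_ray \<omega> = (SOME r. r \<in> \<omega>)"

lemma some_ray: "\<omega> \<in> edge_ends G \<Longrightarrow> some_ray \<omega> \<in> \<omega>"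
  using in_quotient_imp_non_empty[OF equiv_edge_equiv] unfolding edge_ends_def some_ray_def
  by (metis some_in_eq)

text \<open>The definition asks for a ray of the end that lies entirely in the component. Every tail of a
  ray is an equivalent ray, so it suffices that some ray of the end, and then each, ends up there.\<close>

lemma ends_in_component_iff:
  assumes w: "\<omega> \<in> edge_ends G" and r: "r \<in> \<omega>" and S: "finite S" "S \<subseteq> edges G" and x: "x \<in> verts G"
  shows "\<omega> \<in> ends_in G (component S x) \<longleftrightarrow> (\<forall>\<^sub>F n in sequentially. r n \<in> vcomp S x)"
proof
  assume "\<omega> \<in> ends_in G (component S x)"
  then obtain r1 where r1: "r1 \<in> \<omega>" "r1 \<in> rays (component S x)" by (auto simp: ends_in_def)
  have "(r1, r) \<in> edge_equiv G"
    using in_quotient_imp_in_rel[OF equiv_edge_equiv] w r r1(1) unfolding edge_ends_def by blast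
  moreover have "\<forall>\<^sub>F n in sequentially. r1 n \<in> vcomp S x" using r1(2) by (auto simp: rays_iff)
  ultimately show "\<forall>\<^sub>F n in sequentially. r n \<in> vcomp S x"
    using S x by (auto simp: edge_equiv_iff)
next
  assume ev: "\<forall>\<^sub>F n in sequentially. r n \<in> vcomp S x"
  have rG: "r \<in> rays G" by (rule end_ray[OF w r])
  have "tail_in (component S x) r" using ev tail_in_component_iff[OF rG S(1)] by simp
  then obtain N where N: "(\<lambda>n. r (N + n)) \<in> rays (component S x)" unfolding tail_in_def by blast
  have "inj (\<lambda>n. r (N + n))" by (rule ray_shift_inj[OF rG])
  then have "(\<lambda>n. r (N + n)) \<in> rays G" using rG by (auto simp: rays_iff)
  moreover have "(\<forall>\<^sub>F n in sequentially. r (N + n) \<in> A) \<longleftrightarrow> (\<forall>\<^sub>F n in sequentially. r n \<in> A)" for A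
    using eventually_sequentially_seg[of "\<lambda>n. r n \<in> A" N] by (simp add: add.commute)
  ultimately have "(r, \<lambda>n. r (N + n)) \<in> edge_equiv G" using rG by (simp add: edge_equiv_iff)
  then have "(\<lambda>n. r (N + n)) \<in> \<omega>"
    using in_quotient_imp_closed[OF equiv_edge_equiv] w r unfolding edge_ends_def by blast
  then show "\<omega> \<in> ends_in G (component S x)" using N w by (auto simp: ends_in_def)
qed

section \<open>Rays in locally finite walks\<close>

text \<open>Going on from the last visit to each vertex turns an infinite walk that visits every vertex
  finitely often into a ray. The walk may pause at a vertex.\<close>

lemma locally_finite_walk_contains_ray:
  assumes W: "range W \<subseteq> verts G" "\<And>t. W (Suc t) = W t \<or> {W t, W (Suc t)} \<in> edges G"
    and fin: "\<And>v. finite {t. W t = v}"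
  obtains \<tau> where "strict_mono \<tau>" "(\<lambda>n. W (\<tau> n)) \<in> rays G"
proof -
  define last where "last v = Max {t. W t = v}" for v
  have last: "W (last (W t)) = W t" "t \<le> last (W t)" for t
  proof -
    have "last (W t) \<in> {s. W s = W t}" unfolding last_def by (rule Max_in[OF fin]) auto
    then show "W (last (W t)) = W t" by simp
    show "t \<le> last (W t)" unfolding last_def by (rule Max_ge[OF fin]) simp
  qed
  define \<tau> where "\<tau> = rec_nat (last (W 0)) (\<lambda>_ t. last (W (Suc t)))"
  have \<tau>: "\<tau> 0 = last (W 0)" "\<And>n. \<tau> (Suc n) = last (W (Suc (\<tau> n)))"
    by (simp_all add: \<tau>_def)
  have step: "W (\<tau> (Suc n)) = W (Suc (\<tau> n))" "\<tau> n < \<tau> (Suc n)" for n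
    using last[of "Suc (\<tau> n)"] by (auto simp: \<tau>(2))
  have mono: "strict_mono \<tau>" by (rule strict_monoI_Suc) (rule step)
  have is_last: "last (W (\<tau> n)) = \<tau> n" for n
    by (cases n) (simp_all add: \<tau> last(1))
  have "inj (\<lambda>n. W (\<tau> n))"
  proof (rule injI)
    fix a b assume "W (\<tau> a) = W (\<tau> b)"
    then have "\<tau> a = \<tau> b" using is_last by metis
    then show "a = b" using strict_mono_eq[OF mono] by simp
  qed
  moreover have "{W (\<tau> n), W (\<tau> (Suc n))} \<in> edges G" for n
  proof -
    have "W (Suc (\<tau> n)) \<noteq> W (\<tau> n)" using last(2)[of "Suc (\<tau> n)"] is_last[of n] by auto
    then show ?thesis using W(2)[of "\<tau> n"] by (simp add: step(1))
  qed
  ultimately have "(\<lambda>n. W (\<tau> n)) \<in> rays G" using W(1) by (auto simp: rays_iff)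
  with mono show thesis by (rule that)
qed

end

section \<open>The distance in the completion\<close>

locale completed_graph = summable_graph G l \<sigma>
  for G :: "'v graph" and l \<sigma> +
  fixes m :: "'c metric" and i :: "('v \<Rightarrow> real) set \<Rightarrow> 'c"
  assumes completion: "is_completion (ident_points G \<sigma>) (ident_dist G \<sigma>) m i"
begin

definition emb :: "('v \<Rightarrow> real) \<Rightarrow> 'c" where
  "emb p = i (ident_class G \<sigma> p)"

text \<open>Distances of classes are computed from arbitrary representatives. The relation between two
  representatives is expressed by linkage rather than by distance zero, so that the bounds below hold
  for any choice.\<close>

definition inseparable :: "('v \<Rightarrow> real) \<Rightarrow> ('v \<Rightarrow> real) \<Rightarrow> bool" where
  "inseparable p q \<longleftrightarrow> p = q \<or> (\<exists>v\<in>verts G. \<exists>w\<in>verts G. p = vertex_pt v \<and> q = vertex_pt w \<and>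
     (\<forall>S. finite S \<and> S \<subseteq> edges G \<longrightarrow> linked (del_edges G S) v w))"

lemma ident_class_in: "p \<in> points G \<Longrightarrow> ident_class G \<sigma> p \<in> ident_points G \<sigma>"
  by (auto simp: ident_class_def ident_points_def intro: quotientI)

lemma emb_in [simp]: "p \<in> points G \<Longrightarrow> emb p \<in> mspace m"
  using completion ident_class_in unfolding is_completion_def emb_def by blast

lemma ident_class_representative:
  assumes "p \<in> points G"
  shows "inseparable p (SOME a. a \<in> ident_class G \<sigma> p)" "(SOME a. a \<in> ident_class G \<sigma> p) \<in> points G"
proof -
  let ?a = "SOME a. a \<in> ident_class G \<sigma> p"
  have "p \<in> ident_class G \<sigma> p" using assms by (simp add: ident_class_def vertex_ident_def)
  then have "?a \<in> ident_class G \<sigma> p" by (rule someI[of "\<lambda>a. a \<in> ident_class G \<sigma> p"])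
  then have "(p, ?a) \<in> vertex_ident G \<sigma>" by (simp add: ident_class_def)
  then show "inseparable p ?a" "?a \<in> points G"
    unfolding vertex_ident_def inseparable_def using linked_if_len_dist_0 by auto
qed

lemma mdist_emb:
  assumes "p \<in> points G" "q \<in> points G"
  obtains p' q' where "inseparable p p'" "inseparable q q'" "p' \<in> points G" "q' \<in> points G"
    "mdist m (emb p) (emb q) = len_dist G \<sigma> p' q'"
proof -
  have "mdist m (emb p) (emb q) = ident_dist G \<sigma> (ident_class G \<sigma> p) (ident_class G \<sigma> q)"
    using completion ident_class_in assms unfolding is_completion_def emb_def by blast
  then show thesis
    using that ident_class_representative[OF assms(1)] ident_class_representative[OF assms(2)]
    unfolding ident_dist_def by blast
qed

text \<open>Between inseparable vertices there are arcs avoiding \<open>S\<close>, which cost at most \<open>tail S\<close>. So a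
  change of representatives does not affect bounds that allow for \<open>tail S\<close>.\<close>

lemma arc_within_inseparable:
  assumes "arc_within X (points (del_edges G S) \<union> Q) p q" "inseparable p p'" "inseparable q q'"
    and S: "finite S" "S \<subseteq> edges G"
  shows "arc_within X (points (del_edges G S) \<union> Q) p' q'"
proof -
  let ?K = "points (del_edges G S) \<union> Q"
  have link: "arc_within X ?K (vertex_pt v) (vertex_pt w)"
    if "linked (del_edges G S) v w" "v \<in> verts G" for v w
    using linked_imp_arc_within[OF that] arc_within_subset by (metis Un_upper1)
  have "arc_within X ?K p' q"
    using assms(2) unfolding inseparable_def
  proof
    assume "\<exists>v\<in>verts G. \<exists>w\<in>verts G. p = vertex_pt v \<and> p' = vertex_pt w \<and>
     (\<forall>S. finite S \<and> S \<subseteq> edges G \<longrightarrow> linked (del_edges G S) v w)"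
    then obtain v w where "v \<in> verts G" "w \<in> verts G" "p = vertex_pt v" "p' = vertex_pt w"
      "linked (del_edges G S) v w" using S by blast
    then have "arc_within X ?K p' p" using link linked_sym by metis
    from arc_within_trans[OF Hausdorff_X this assms(1)] show ?thesis by simp
  qed (use assms(1) in simp)
  then show ?thesis
    using assms(3) unfolding inseparable_def
  proof (elim disjE)
    assume *: "arc_within X ?K p' q" and "\<exists>v\<in>verts G. \<exists>w\<in>verts G. q = vertex_pt v \<and> q' = vertex_pt w \<and>
     (\<forall>S. finite S \<and> S \<subseteq> edges G \<longrightarrow> linked (del_edges G S) v w)"
    then obtain v w where "v \<in> verts G" "w \<in> verts G" "q = vertex_pt v" "q' = vertex_pt w"
      "linked (del_edges G S) v w" using S by blast
    then have "arc_within X ?K q q'" using link by metis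
    from arc_within_trans[OF Hausdorff_X * this] show ?thesis by simp
  qed simp
qed

lemma mdist_linked_le:
  assumes "linked (del_edges G S) x y" "x \<in> verts G" and S: "finite S" "S \<subseteq> edges G"
  shows "mdist m (emb (vertex_pt x)) (emb (vertex_pt y)) \<le> tail S"
proof -
  have y: "y \<in> verts G" using linked_in_verts assms(1,2) by blast
  obtain p' q' where pq: "inseparable (vertex_pt x) p'" "inseparable (vertex_pt y) q'"
    "mdist m (emb (vertex_pt x)) (emb (vertex_pt y)) = len_dist G \<sigma> p' q'"
    using mdist_emb[OF vertex_pt_in_points[OF assms(2)] vertex_pt_in_points[OF y]] by metis
  have "arc_within X (points (del_edges G S) \<union> {}) (vertex_pt x) (vertex_pt y)"
    using linked_imp_arc_within[OF assms(1,2)] by simp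
  from arc_within_inseparable[OF this pq(1,2) S]
  have "len_dist G \<sigma> p' q' \<le> tail S + (\<Sum>f\<in>S. \<bar>0 - 0\<bar>)"
    by (rule len_dist_le_tail[OF _ S]) auto
  then show ?thesis using pq by simp
qed

text \<open>An arc that first changes the representatives avoiding \<open>S\<close> and then runs along the segment
  exceeds the length of the segment by at most \<open>tail S\<close>, which is arbitrarily small.\<close>

lemma mdist_edge_le:
  assumes e: "e \<in> edges G" and p: "p \<in> edge_pts e" and q: "q \<in> edge_pts e"
  shows "mdist m (emb p) (emb q) \<le> \<bar>\<sigma> e p - \<sigma> e q\<bar>"
proof (rule field_le_epsilon)
  fix \<epsilon> :: real assume "\<epsilon> > 0"
  then obtain S0 where S0: "finite S0" "S0 \<subseteq> edges G" "tail S0 < \<epsilon>" by (rule small_tail)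
  define S where "S = insert e S0"
  have S: "finite S" "S \<subseteq> edges G" "e \<in> S" using S0 e by (auto simp: S_def)
  have "tail S \<le> tail S0" by (rule tail_antimono) (auto simp: S_def)
  have pG: "p \<in> points G" "q \<in> points G" using p q edge_pts_subset_points[OF e] by auto
  obtain p' q' where pq: "inseparable p p'" "inseparable q q'"
    "mdist m (emb p) (emb q) = len_dist G \<sigma> p' q'"
    using mdist_emb[OF pG] by metis
  have "arc_within X (points (del_edges G S) \<union> segment e p q) p q"
    by (rule arc_within_subset[OF arc_within_segment[OF e p q]]) simp
  from arc_within_inseparable[OF this pq(1,2) S(1,2)]
  have "len_dist G \<sigma> p' q' \<le> tail S + (\<Sum>f\<in>S. \<bar>(if f = e then \<sigma> e p else 0) - (if f = e then \<sigma> e q else 0)\<bar>)"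
  proof (rule len_dist_le_tail[OF _ S(1,2)])
    fix f r assume f: "f \<in> S" and r: "r \<in> segment e p q" "r \<in> edge_pts f"
    have re: "r \<in> edge_pts e" "\<sigma> e r \<in> closed_segment (\<sigma> e p) (\<sigma> e q)"
      using r(1) by (auto simp: segment_def)
    show "r \<in> vertex_pt ` f \<or>
      \<sigma> f r \<in> closed_segment (if f = e then \<sigma> e p else 0) (if f = e then \<sigma> e q else 0)"
    proof (cases "f = e")
      case False
      have "f \<in> edges G" using f S by blast
      from edge_pts_Int[OF this e False r(2) re(1)] show ?thesis by blast
    qed (use re in simp)
  qed
  also have "(\<Sum>f\<in>S. \<bar>(if f = e then \<sigma> e p else 0) - (if f = e then \<sigma> e q else 0)\<bar>)
      = (\<Sum>f\<in>S. if f = e then \<bar>\<sigma> e p - \<sigma> e q\<bar> else 0)"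
    by (rule sum.cong) auto
  also have "\<dots> = \<bar>\<sigma> e p - \<sigma> e q\<bar>" using S by (simp add: sum.delta)
  finally show "mdist m (emb p) (emb q) \<le> \<bar>\<sigma> e p - \<sigma> e q\<bar> + \<epsilon>"
    using pq(3) \<open>tail S \<le> tail S0\<close> S0(3) by linarith
qed

lemma mdist_edge_le_length:
  assumes e: "e \<in> edges G" and p: "p \<in> edge_pts e" and q: "q \<in> edge_pts e"
  shows "mdist m (emb p) (emb q) \<le> l e"
  using mdist_edge_le[OF assms] sigma_mem[OF e p] sigma_mem[OF e q] by auto

lemma mdist_edge_interior_ge:
  assumes e: "e \<in> edges G" and W: "openin (top_of_set (edge_interior e)) W" and p: "p \<in> W"
  shows "\<exists>\<delta>>0. \<forall>q\<in>points G - W. \<delta> \<le> mdist m (emb p) (emb q)"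
proof -
  obtain \<delta> where \<delta>: "\<delta> > 0" "\<forall>q\<in>points G - W. \<delta> \<le> len_dist G \<sigma> p q"
    using edge_interior_distance[OF assms] by blast
  have WI: "W \<subseteq> edge_interior e" using openin_imp_subset[OF W] .
  have "\<delta> \<le> mdist m (emb p) (emb q)" if q: "q \<in> points G - W" for q
  proof -
    have "p \<in> points G" using WI p edge_pts_subset_points[OF e] by (auto simp: edge_interior_def)
    then obtain p' q' where pq: "inseparable p p'" "inseparable q q'" "q' \<in> points G"
      "mdist m (emb p) (emb q) = len_dist G \<sigma> p' q'"
      using mdist_emb q by (metis DiffD1)
    have "p' = p" using pq(1) edge_interior_not_vertex[OF e] WI p unfolding inseparable_def by blast
    moreover have "q' \<notin> W" using pq(2) edge_interior_not_vertex[OF e] WI q unfolding inseparable_def by blast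
    ultimately show ?thesis using \<delta>(2) pq(3,4) by simp
  qed
  then show ?thesis using \<delta>(1) by blast
qed

lemma mdist_nbhd_ge:
  assumes S: "finite S" "S \<subseteq> edges G" and x: "x \<in> verts G" and t: "inner_coords (vcomp S x) S t"
  shows "\<exists>\<delta>>0. \<forall>y\<in>vcomp S x. \<forall>q\<in>points G - nbhd (vcomp S x) S t. \<delta> \<le> mdist m (emb (vertex_pt y)) (emb q)"
proof -
  let ?U = "vcomp S x"
  note cut = cut_vcomp[OF S(2) x]
  obtain \<delta> where \<delta>: "\<delta> > 0" "\<forall>y\<in>?U. \<forall>q\<in>points G - nbhd ?U S t. \<delta> \<le> len_dist G \<sigma> (vertex_pt y) q"
    using nbhd_distance[OF cut S(1) t] by blast
  have link: "w \<in> ?U \<longleftrightarrow> v \<in> ?U" if "\<forall>S. finite S \<and> S \<subseteq> edges G \<longrightarrow> linked (del_edges G S) v w" for v w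
  proof -
    have "linked (del_edges G S) v w" using that S by blast
    then show ?thesis
      unfolding vcomp_def mem_Collect_eq by (metis linked_trans linked_sym)
  qed
  have "\<delta> \<le> mdist m (emb (vertex_pt y)) (emb q)" if y: "y \<in> ?U" and q: "q \<in> points G - nbhd ?U S t" for y q
  proof -
    have yv: "y \<in> verts G" using y vcomp_subset[OF x] by blast
    have qG: "q \<in> points G" using q by blast
    obtain p' q' where pq: "inseparable (vertex_pt y) p'" "inseparable q q'" "q' \<in> points G"
      "mdist m (emb (vertex_pt y)) (emb q) = len_dist G \<sigma> p' q'"
      using mdist_emb[OF vertex_pt_in_points[OF yv] qG] by metis
    have "\<exists>y'\<in>?U. p' = vertex_pt y'"
      using pq(1) unfolding inseparable_def
    proof
      assume "\<exists>v\<in>verts G. \<exists>w\<in>verts G. vertex_pt y = vertex_pt v \<and> p' = vertex_pt w \<and>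
        (\<forall>S. finite S \<and> S \<subseteq> edges G \<longrightarrow> linked (del_edges G S) v w)"
      then obtain w where "p' = vertex_pt w" "\<forall>S. finite S \<and> S \<subseteq> edges G \<longrightarrow> linked (del_edges G S) y w"
        by auto
      then show ?thesis using link[of y w] y by blast
    qed (use y in blast)
    moreover have "q' \<notin> nbhd ?U S t"
      using pq(2) unfolding inseparable_def
    proof
      assume "\<exists>v\<in>verts G. \<exists>w\<in>verts G. q = vertex_pt v \<and> q' = vertex_pt w \<and>
        (\<forall>S. finite S \<and> S \<subseteq> edges G \<longrightarrow> linked (del_edges G S) v w)"
      then obtain v w where vw: "v \<in> verts G" "w \<in> verts G" "q = vertex_pt v" "q' = vertex_pt w"
        "\<forall>S. finite S \<and> S \<subseteq> edges G \<longrightarrow> linked (del_edges G S) v w" by blast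
      then show ?thesis using link[OF vw(5)] nbhd_vertex[OF cut t] q by blast
    qed (use q in simp)
    ultimately show ?thesis using \<delta>(2) pq(3,4) by auto
  qed
  then show ?thesis using \<delta>(1) by blast
qed

section \<open>The map from \<open>ETOP\<close> to the completion\<close>

text \<open>Every point of \<open>ETOP\<close> is approximated by a sequence of points of the graph: a constant
  sequence, or the vertices of a ray.\<close>

definition approx :: "('v \<Rightarrow> real) + (nat \<Rightarrow> 'v) set \<Rightarrow> nat \<Rightarrow> 'v \<Rightarrow> real" where
  "approx a n = (case a of Inl p \<Rightarrow> p | Inr \<omega> \<Rightarrow> vertex_pt (some_ray \<omega> n))"

text \<open>The vertices of a ray converge by \<open>ray_converges\<close>, so that the choice at an end is the choice
  of their limit.\<close>

definition to_compl :: "('v \<Rightarrow> real) + (nat \<Rightarrow> 'v) set \<Rightarrow> 'c" where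
  "to_compl a = (case a of Inl p \<Rightarrow> emb p
     | Inr \<omega> \<Rightarrow> SOME c. limitin (mtopology_of m) (\<lambda>n. emb (approx a n)) c sequentially)"

definition ETOP_pts where "ETOP_pts = Inl ` points G \<union> Inr ` edge_ends G"

lemma approx_in_points: "a \<in> ETOP_pts \<Longrightarrow> approx a n \<in> points G"
proof -
  assume "a \<in> ETOP_pts"
  then consider p where "p \<in> points G" "a = Inl p" | \<omega> where "\<omega> \<in> edge_ends G" "a = Inr \<omega>"
    by (auto simp: ETOP_pts_def)
  then show ?thesis
  proof cases
    case 2
    have "some_ray \<omega> \<in> rays G" using end_ray some_ray 2 by blast
    then show ?thesis using 2 vertex_pt_in_points by (auto simp: approx_def rays_iff)
  qed (simp add: approx_def)
qed

lemma limitin_m_iff: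
  "limitin (mtopology_of m) f c F \<longleftrightarrow>
    c \<in> mspace m \<and> (\<forall>\<epsilon>>0. \<forall>\<^sub>F n in F. f n \<in> mspace m \<and> mdist m (f n) c < \<epsilon>)"
  unfolding mtopology_of_def by (rule Metric_space.limitin_metric[OF Metric_space_mspace_mdist])

text \<open>Once the ray has settled in a component of \<open>G - S\<close>, its vertices are within \<open>tail S\<close> of each
  other.\<close>

lemma ray_converges:
  assumes r: "r \<in> rays G"
  shows "\<exists>c. limitin (mtopology_of m) (\<lambda>n. emb (vertex_pt (r n))) c sequentially"
proof -
  interpret M: Metric_space "mspace m" "mdist m" by (rule Metric_space_mspace_mdist)
  have rv: "r n \<in> verts G" for n using r by (auto simp: rays_iff)
  have "M.MCauchy (\<lambda>n. emb (vertex_pt (r n)))"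
    unfolding M.MCauchy_def
  proof (intro conjI allI impI)
    show "range (\<lambda>n. emb (vertex_pt (r n))) \<subseteq> mspace m" using rv vertex_pt_in_points by auto
    fix \<epsilon> :: real assume "\<epsilon> > 0"
    then obtain S where S: "finite S" "S \<subseteq> edges G" "tail S < \<epsilon>" by (rule small_tail)
    obtain x N where N: "\<And>n. n \<ge> N \<Longrightarrow> r n \<in> vcomp S x"
      using ray_eventually_in_vcomp[OF r S(1)] by (auto simp: eventually_sequentially)
    have "mdist m (emb (vertex_pt (r n))) (emb (vertex_pt (r n'))) < \<epsilon>" if "N \<le> n" "N \<le> n'" for n n'
    proof -
      have "linked (del_edges G S) (r n) (r n')"
        using N[OF that(1)] N[OF that(2)] linked_sym linked_trans unfolding vcomp_def by (metis mem_Collect_eq)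
      from mdist_linked_le[OF this rv S(1,2)] S(3) show ?thesis by linarith
    qed
    then show "\<exists>N. \<forall>n n'. N \<le> n \<longrightarrow> N \<le> n' \<longrightarrow> mdist m (emb (vertex_pt (r n))) (emb (vertex_pt (r n'))) < \<epsilon>"
      by blast
  qed
  moreover have "M.mcomplete" using completion by (simp add: is_completion_def mcomplete_of_def)
  ultimately show ?thesis unfolding M.mcomplete_def mtopology_of_def by blast
qed

lemma approx_limit:
  assumes "a \<in> ETOP_pts"
  shows "limitin (mtopology_of m) (\<lambda>n. emb (approx a n)) (to_compl a) sequentially"
proof -
  consider p where "p \<in> points G" "a = Inl p" | \<omega> where "\<omega> \<in> edge_ends G" "a = Inr \<omega>"
    using assms by (auto simp: ETOP_pts_def)
  then show ?thesis
  proof cases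
    case 1
    then show ?thesis by (simp add: to_compl_def approx_def limitin_m_iff)
  next
    case 2
    have "\<exists>c. limitin (mtopology_of m) (\<lambda>n. emb (approx a n)) c sequentially"
      using ray_converges[OF end_ray[OF 2(1) some_ray[OF 2(1)]]] by (simp add: 2 approx_def)
    moreover have "to_compl a = (SOME c. limitin (mtopology_of m) (\<lambda>n. emb (approx a n)) c sequentially)"
      by (simp add: to_compl_def 2)
    ultimately show ?thesis by (simp only:) (rule someI_ex)
  qed
qed

lemma to_compl_in: "a \<in> ETOP_pts \<Longrightarrow> to_compl a \<in> mspace m"
  using approx_limit by (simp add: limitin_m_iff)

text \<open>By this lemma, bounds for distances in the graph carry over to ends.\<close>

lemma mdist_to_compl_tendsto:
  assumes "a \<in> ETOP_pts" "b \<in> ETOP_pts"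
  shows "(\<lambda>n. mdist m (emb (approx a n)) (emb (approx b n))) \<longlonglongrightarrow> mdist m (to_compl a) (to_compl b)"
proof (rule tendstoI)
  fix \<epsilon> :: real assume "\<epsilon> > 0"
  then have "\<epsilon> / 2 > 0" by simp
  have near: "\<forall>\<^sub>F n in sequentially. mdist m (emb (approx c n)) (to_compl c) < \<epsilon> / 2" if "c \<in> ETOP_pts" for c
  proof -
    have "\<forall>\<^sub>F n in sequentially. emb (approx c n) \<in> mspace m \<and> mdist m (emb (approx c n)) (to_compl c) < \<epsilon> / 2"
      using approx_limit[OF that] \<open>\<epsilon> / 2 > 0\<close> unfolding limitin_m_iff by blast
    then show ?thesis by (rule eventually_mono) blast
  qed
  from near[OF assms(1)] near[OF assms(2)]
  show "\<forall>\<^sub>F n in sequentially.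
      dist (mdist m (emb (approx a n)) (emb (approx b n))) (mdist m (to_compl a) (to_compl b)) < \<epsilon>"
  proof eventually_elim
    case (elim n)
    let ?a = "emb (approx a n)" and ?b = "emb (approx b n)"
    have in_m: "?a \<in> mspace m" "?b \<in> mspace m" "to_compl a \<in> mspace m" "to_compl b \<in> mspace m"
      using approx_in_points to_compl_in assms by auto
    have "mdist m ?a ?b \<le> mdist m ?a (to_compl a) + (mdist m (to_compl a) (to_compl b) + mdist m (to_compl b) ?b)"
      using mdist_triangle[of ?a m "to_compl a" ?b] mdist_triangle[of "to_compl a" m "to_compl b" ?b] in_m by linarith
    moreover have "mdist m (to_compl a) (to_compl b) \<le> mdist m (to_compl a) ?a + (mdist m ?a ?b + mdist m ?b (to_compl b))"
      using mdist_triangle[of "to_compl a" m ?a "to_compl b"] mdist_triangle[of ?a m ?b "to_compl b"] in_m by linarith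
    moreover have "mdist m (to_compl b) ?b = mdist m ?b (to_compl b)" "mdist m (to_compl a) ?a = mdist m ?a (to_compl a)"
      by (simp_all add: mdist_commute)
    ultimately show ?case using elim by (simp add: dist_real_def abs_less_iff)
  qed
qed

lemma mdist_to_compl_le:
  assumes "a \<in> ETOP_pts" "b \<in> ETOP_pts"
    and "\<forall>\<^sub>F n in sequentially. mdist m (emb (approx a n)) (emb (approx b n)) \<le> c"
  shows "mdist m (to_compl a) (to_compl b) \<le> c"
  by (rule tendsto_upperbound[OF mdist_to_compl_tendsto[OF assms(1,2)] assms(3)]) simp

lemma mdist_to_compl_ge:
  assumes "a \<in> ETOP_pts" "b \<in> ETOP_pts"
    and "\<forall>\<^sub>F n in sequentially. c \<le> mdist m (emb (approx a n)) (emb (approx b n))"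
  shows "c \<le> mdist m (to_compl a) (to_compl b)"
  by (rule tendsto_lowerbound[OF mdist_to_compl_tendsto[OF assms(1,2)] assms(3)]) simp

section \<open>Comparing the topologies\<close>

lemma ETOP_pts_cases:
  assumes "a \<in> ETOP_pts"
  obtains v where "v \<in> verts G" "a = Inl (vertex_pt v)"
  | e p where "e \<in> edges G" "p \<in> edge_interior e" "a = Inl p"
  | \<omega> where "\<omega> \<in> edge_ends G" "a = Inr \<omega>"
proof -
  consider p where "p \<in> points G" "a = Inl p" | \<omega> where "\<omega> \<in> edge_ends G" "a = Inr \<omega>"
    using assms by (auto simp: ETOP_pts_def)
  then show thesis
  proof cases
    case 1
    from 1(1) show thesis
      by (cases rule: points_cases) (use that 1(2) in blast)+
  qed (use that in blast)
qed

lemma approx_Inl [simp]: "approx (Inl p) n = p"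
  by (simp add: approx_def)

lemma approx_Inr: "approx (Inr \<omega>) n = vertex_pt (some_ray \<omega> n)"
  by (simp add: approx_def)

lemma to_compl_Inl: "to_compl (Inl p) = emb p"
  by (simp add: to_compl_def)

lemma some_ray_in_rays: "\<omega> \<in> edge_ends G \<Longrightarrow> some_ray \<omega> \<in> rays G"
  using end_ray some_ray by blast

lemma edge_interior_coordinate:
  assumes "e \<in> edges G" "y \<in> e" "z \<in> edge_interior e"
  shows "0 < z y" "z y < 1"
proof -
  obtain x where x: "x \<noteq> y" "e = {x, y}" using edgeE'[OF assms(1,2)] by blast
  then show "0 < z y" "z y < 1" using edge_interior_doubleton[OF x(1), of z] assms(3) by auto
qed

text \<open>Only the coordinate of the cut point \<open>z e y\<close> at \<open>y\<close> matters, so the graph part of a basic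
  neighbourhood is given by thresholds.\<close>

lemma basic_nbhd_eq:
  assumes S: "S \<subseteq> edges G" and x: "x \<in> verts G"
  shows "basic_nbhd G S (component S x) z =
    Inl ` nbhd (vcomp S x) S (\<lambda>e y. z e y y) \<union> Inr ` ends_in G (component S x)"
proof -
  have C: "r \<in> points G" if "r \<in> points (component S x)" for r
    using that vcomp_subset[OF x, of S] by (auto simp: points_def)
  have C_iff: "r \<in> points (component S x) \<longleftrightarrow>
      r \<in> vertex_pt ` vcomp S x \<or> (\<exists>e\<in>edges G - S. e \<subseteq> vcomp S x \<and> r \<in> edge_pts e)" for r
    by (auto simp: points_def)
  have H: "r \<in> points G" if "e \<in> S" "r \<in> edge_pts e" for e r
    using edge_pts_subset_points[of e] S that by blast
  have eq: "points (component S x) \<union> (\<Union>e\<in>S. \<Union>y\<in>e \<inter> vcomp S x. half_open_edge e (z e y) y)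
      = nbhd (vcomp S x) S (\<lambda>e y. z e y y)"
  proof (rule set_eqI)
    fix r
    let ?A = "r \<in> points (component S x)"
    let ?B = "\<exists>e\<in>S. \<exists>y\<in>e \<inter> vcomp S x. r \<in> edge_pts e \<and> z e y y < r y"
    have 1: "r \<in> points (component S x) \<union> (\<Union>e\<in>S. \<Union>y\<in>e \<inter> vcomp S x. half_open_edge e (z e y) y)
        \<longleftrightarrow> ?A \<or> ?B"
      by (auto simp: half_open_edge_def)
    have 2: "r \<in> nbhd (vcomp S x) S (\<lambda>e y. z e y y) \<longleftrightarrow> r \<in> points G \<and> (?A \<or> ?B)"
      unfolding C_iff nbhd_def by (simp only: mem_Collect_eq disj_assoc)
    have 3: "?A \<or> ?B \<Longrightarrow> r \<in> points G"
      using C H by (elim disjE bexE) auto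
    show "r \<in> points (component S x) \<union> (\<Union>e\<in>S. \<Union>y\<in>e \<inter> vcomp S x. half_open_edge e (z e y) y)
      \<longleftrightarrow> r \<in> nbhd (vcomp S x) S (\<lambda>e y. z e y y)"
      unfolding 1 2 using 3 by argo
  qed
  show ?thesis unfolding basic_nbhd_def eq[symmetric] fst_conv image_Un by (simp only: Un_ac)
qed

lemma inner_coords_points:
  assumes S: "S \<subseteq> edges G" and z: "\<forall>e\<in>S. \<forall>y\<in>e \<inter> U. z e y \<in> edge_interior e"
  shows "inner_coords U S (\<lambda>e y. z e y y)"
  unfolding inner_coords_def using edge_interior_coordinate S z by blast

definition edge_sets where
  "edge_sets = {Inl ` U :: (('v \<Rightarrow> real) + (nat \<Rightarrow> 'v) set) set | U e.
     e \<in> edges G \<and> openin (top_of_set (edge_interior e)) U}"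

definition component_sets where
  "component_sets = {basic_nbhd G S C z | S C z. finite S \<and> S \<subseteq> edges G \<and>
     C \<in> graph_components (del_edges G S) \<and> (\<forall>e\<in>S. \<forall>y\<in>e \<inter> verts C. z e y \<in> edge_interior e)}"

lemma ETOP_pre_eq: "ETOP_pre G = topology_generated_by (edge_sets \<union> component_sets)"
  unfolding ETOP_pre_def edge_sets_def component_sets_def ..

lemma component_setE:
  assumes "U \<in> component_sets"
  obtains S x z where "finite S" "S \<subseteq> edges G" "x \<in> verts G"
    "\<forall>e\<in>S. \<forall>y\<in>e \<inter> vcomp S x. z e y \<in> edge_interior e"
    "U = Inl ` nbhd (vcomp S x) S (\<lambda>e y. z e y y) \<union> Inr ` ends_in G (component S x)"
proof -
  obtain S C z where U: "U = basic_nbhd G S C z" "finite S" "S \<subseteq> edges G"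
    "C \<in> graph_components (del_edges G S)" "\<forall>e\<in>S. \<forall>y\<in>e \<inter> verts C. z e y \<in> edge_interior e"
    using assms unfolding component_sets_def by blast
  obtain x where x: "x \<in> verts G" "C = component S x" using U(4) unfolding graph_components_eq by blast
  show thesis
    by (rule that[OF U(2,3) x(1), of z]) (use U x basic_nbhd_eq in auto)
qed

lemma component_setI:
  assumes "finite S" "S \<subseteq> edges G" "x \<in> verts G"
    "\<forall>e\<in>S. \<forall>y\<in>e \<inter> vcomp S x. z e y \<in> edge_interior e"
  shows "Inl ` nbhd (vcomp S x) S (\<lambda>e y. z e y y) \<union> Inr ` ends_in G (component S x) \<in> component_sets"
proof -
  have "component S x \<in> graph_components (del_edges G S)"
    unfolding graph_components_eq using assms(3) by blast
  then show ?thesis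
    unfolding component_sets_def basic_nbhd_eq[OF assms(2,3), symmetric] using assms
    by (intro CollectI exI[of _ S] exI[of _ "component S x"] exI[of _ z]) auto
qed

lemma topspace_ETOP_pre: "topspace (ETOP_pre G) = ETOP_pts"
proof -
  have "\<Union>(edge_sets \<union> component_sets) \<subseteq> ETOP_pts"
  proof -
    have "U \<subseteq> ETOP_pts" if "U \<in> edge_sets" for U
    proof -
      obtain W e where W: "U = Inl ` W" "e \<in> edges G" "openin (top_of_set (edge_interior e)) W"
        using \<open>U \<in> edge_sets\<close> by (auto simp: edge_sets_def)
      then have "W \<subseteq> points G"
        using openin_imp_subset[OF W(3)] edge_pts_subset_points[OF W(2)] by (auto simp: edge_interior_def)
      then show ?thesis using W(1) by (auto simp: ETOP_pts_def)
    qed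
    moreover have "U \<subseteq> ETOP_pts" if U: "U \<in> component_sets" for U
      using U by (rule component_setE) (auto simp: ETOP_pts_def nbhd_def ends_in_def)
    ultimately show ?thesis by blast
  qed
  moreover have "ETOP_pts \<subseteq> \<Union>component_sets"
  proof -
    obtain x where x: "x \<in> verts G" using connected by (auto simp: connected_graph_def)
    have V: "vcomp {} x = verts G"
      using vcomp_subset[OF x] linked_G[OF x] by (auto simp: vcomp_def)
    have "Inl ` nbhd (vcomp {} x) {} (\<lambda>e y. undefined y) \<union> Inr ` ends_in G (component {} x) \<in> component_sets"
      by (rule component_setI) (use x in auto)
    moreover have "nbhd (vcomp {} x) {} (\<lambda>e y. undefined y) = points G"
      unfolding nbhd_def V using edge_subset_verts by (auto simp: points_def)
    moreover have "ends_in G (component {} x) = edge_ends G"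
    proof -
      have "\<omega> \<in> ends_in G (component {} x)" if w: "\<omega> \<in> edge_ends G" for \<omega>
      proof -
        have "some_ray \<omega> n \<in> verts G" for n using some_ray_in_rays[OF w] by (auto simp: rays_iff)
        then show ?thesis
          using ends_in_component_iff[OF w some_ray[OF w] _ _ x, of "{}"] by (simp add: V)
      qed
      then show ?thesis by (auto simp: ends_in_def)
    qed
    ultimately show ?thesis unfolding ETOP_pts_def by auto
  qed
  ultimately show ?thesis unfolding ETOP_pre_eq by (auto simp: topology_generated_by_topspace)
qed

subsection \<open>Open sets of \<open>ETOP\<close> are metrically open\<close>

text \<open>Openness for the pseudometric that \<open>to_compl\<close> pulls back from the completion.\<close>

definition metrically_open :: "(('v \<Rightarrow> real) + (nat \<Rightarrow> 'v) set) set \<Rightarrow> bool" where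
  "metrically_open U \<longleftrightarrow> U \<subseteq> ETOP_pts \<and> (\<forall>a\<in>U. \<exists>\<delta>>0. \<forall>b\<in>ETOP_pts. mdist m (to_compl a) (to_compl b) < \<delta> \<longrightarrow> b \<in> U)"

lemma metrically_open_edge_set:
  assumes e: "e \<in> edges G" and W: "openin (top_of_set (edge_interior e)) W"
  shows "metrically_open (Inl ` W)"
  unfolding metrically_open_def
proof (intro conjI ballI)
  have WI: "W \<subseteq> edge_interior e" using openin_imp_subset[OF W] .
  show sub: "Inl ` W \<subseteq> ETOP_pts"
    using WI edge_pts_subset_points[OF e] by (auto simp: ETOP_pts_def edge_interior_def)
  fix a :: "('v \<Rightarrow> real) + (nat \<Rightarrow> 'v) set" assume a: "a \<in> Inl ` W"
  then obtain p where p: "p \<in> W" "a = Inl p" by blast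
  obtain \<delta> where \<delta>: "\<delta> > 0" "\<forall>q\<in>points G - W. \<delta> \<le> mdist m (emb p) (emb q)"
    using mdist_edge_interior_ge[OF e W p(1)] by blast
  have "\<delta> \<le> mdist m (to_compl a) (to_compl b)" if b: "b \<in> ETOP_pts" "b \<notin> Inl ` W" for b
  proof -
    have "approx b n \<in> points G - W" for n
      using b approx_in_points[OF b(1), of n] edge_interior_not_vertex[OF e] WI
      by (cases b) (auto simp: approx_Inr)
    then show ?thesis using mdist_to_compl_ge[of a b \<delta>] a sub b(1) \<delta>(2) p(2) by auto
  qed
  then show "\<exists>\<delta>>0. \<forall>b\<in>ETOP_pts. mdist m (to_compl a) (to_compl b) < \<delta> \<longrightarrow> b \<in> Inl ` W"
    using \<delta>(1) by (meson not_le)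
qed

text \<open>At the vertices and ends of the component, distances to the outside are bounded below by
  \<open>mdist_nbhd_ge\<close>. This applies to ends since their rays eventually stay inside or outside the
  component.\<close>

lemma metrically_open_component_set:
  assumes "U \<in> component_sets"
  shows "metrically_open U"
proof -
  obtain S x z where S: "finite S" "S \<subseteq> edges G" and x: "x \<in> verts G"
    and z: "\<forall>e\<in>S. \<forall>y\<in>e \<inter> vcomp S x. z e y \<in> edge_interior e"
    and U: "U = Inl ` nbhd (vcomp S x) S (\<lambda>e y. z e y y) \<union> Inr ` ends_in G (component S x)"
    using assms by (rule component_setE)
  let ?N = "nbhd (vcomp S x) S (\<lambda>e y. z e y y)"
  note cut = cut_vcomp[OF S(2) x]
  note t = inner_coords_points[OF S(2) z]
  have sub: "U \<subseteq> ETOP_pts" unfolding U by (auto simp: ETOP_pts_def nbhd_def ends_in_def)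
  show ?thesis
    unfolding metrically_open_def
  proof (intro conjI ballI)
    fix a assume a: "a \<in> U"
    then have aT: "a \<in> ETOP_pts" using sub by blast
    have outside: "\<forall>\<^sub>F n in sequentially. approx b n \<in> points G - ?N" if b: "b \<in> ETOP_pts" "b \<notin> U" for b
    proof (cases b)
      case (Inl p)
      then show ?thesis using b approx_in_points[OF b(1)] U by auto
    next
      case (Inr \<omega>)
      then have w: "\<omega> \<in> edge_ends G" using b(1) by (auto simp: ETOP_pts_def)
      have rG: "some_ray \<omega> \<in> rays G" by (rule some_ray_in_rays[OF w])
      obtain x' where x': "\<forall>\<^sub>F n in sequentially. some_ray \<omega> n \<in> vcomp S x'"
        using ray_eventually_in_vcomp[OF rG S(1)] by blast
      have "\<omega> \<notin> ends_in G (component S x)" using b(2) Inr U by blast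
      then have "vcomp S x \<noteq> vcomp S x'"
        using ends_in_component_iff[OF w some_ray[OF w] S x] eventually_in_vcomp_iff[OF x', of x] by blast
      then have disj: "vcomp S x \<inter> vcomp S x' = {}" using vcomp_eq by blast
      from x' show ?thesis
      proof eventually_elim
        case (elim n)
        then have "some_ray \<omega> n \<notin> vcomp S x" using disj by blast
        moreover have "some_ray \<omega> n \<in> verts G" using rG by (auto simp: rays_iff)
        ultimately show ?case
          using nbhd_vertex[OF cut t] vertex_pt_in_points Inr by (simp add: approx_Inr)
      qed
    qed
    show "\<exists>\<delta>>0. \<forall>b\<in>ETOP_pts. mdist m (to_compl a) (to_compl b) < \<delta> \<longrightarrow> b \<in> U"
    proof (cases "\<forall>\<^sub>F n in sequentially. approx a n \<in> vertex_pt ` vcomp S x")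
      case True
      obtain \<delta> where \<delta>: "\<delta> > 0"
        "\<forall>y\<in>vcomp S x. \<forall>q\<in>points G - ?N. \<delta> \<le> mdist m (emb (vertex_pt y)) (emb q)"
        using mdist_nbhd_ge[OF S x t] by blast
      have "\<delta> \<le> mdist m (to_compl a) (to_compl b)" if b: "b \<in> ETOP_pts" "b \<notin> U" for b
        by (rule mdist_to_compl_ge[OF aT b(1) eventually_elim2[OF True outside[OF b]]]) (use \<delta>(2) in auto)
      then show ?thesis using \<delta>(1) by (meson not_le)
    next
      case False
      \<comment> \<open>The remaining points are inner points of edges, where the neighbourhood contains an open
        part of the edge.\<close>
      obtain e p where p: "e \<in> edges G" "p \<in> edge_interior e" "a = Inl p"
      proof (cases rule: ETOP_pts_cases[OF aT])
        case (1 v)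
        then have "v \<in> vcomp S x" using a U nbhd_vertex[OF cut t] by auto
        then show ?thesis using False 1 by simp
      next
        case (3 \<omega>)
        then have "\<omega> \<in> ends_in G (component S x)" using a U by blast
        then have "\<forall>\<^sub>F n in sequentially. some_ray \<omega> n \<in> vcomp S x"
          using ends_in_component_iff[OF 3(1) some_ray[OF 3(1)] S x] by blast
        then have "\<forall>\<^sub>F n in sequentially. approx a n \<in> vertex_pt ` vcomp S x"
          by (rule eventually_mono) (simp add: 3 approx_Inr)
        then show ?thesis using False by blast
      qed (rule that)
      have "openin (top_of_set (edge_pts e)) (?N \<inter> edge_pts e)"
        using openin_nbhd[OF cut t] p(1) by (auto simp: openin_complex_topology)
      then obtain O' where O': "open O'" "?N \<inter> edge_pts e = edge_pts e \<inter> O'"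
        by (auto simp: openin_open)
      have "edge_interior e \<inter> O' = ?N \<inter> edge_interior e"
        using O'(2) by (auto simp: edge_interior_def)
      then have "openin (top_of_set (edge_interior e)) (?N \<inter> edge_interior e)"
        using O'(1) by (metis openin_open_Int)
      from metrically_open_edge_set[OF p(1) this]
      have "\<exists>\<delta>>0. \<forall>b\<in>ETOP_pts. mdist m (to_compl a) (to_compl b) < \<delta> \<longrightarrow> b \<in> Inl ` (?N \<inter> edge_interior e)"
        unfolding metrically_open_def using p(2,3) a U by blast
      then show ?thesis unfolding U by blast
    qed
  qed (rule sub)
qed

lemma metrically_open_ETOP_pre:
  assumes "openin (ETOP_pre G) U" shows "metrically_open U"
proof -
  have "generate_topology_on (edge_sets \<union> component_sets) U"
    using assms unfolding ETOP_pre_eq by (simp add: openin_topology_generated_by_iff)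
  then show ?thesis
  proof induction
    case Empty
    then show ?case by (simp add: metrically_open_def)
  next
    case (Int A B)
    show ?case
      unfolding metrically_open_def
    proof (intro conjI ballI)
      fix a assume "a \<in> A \<inter> B"
      then obtain \<delta>1 \<delta>2 where "\<delta>1 > 0" "\<forall>b\<in>ETOP_pts. mdist m (to_compl a) (to_compl b) < \<delta>1 \<longrightarrow> b \<in> A"
        "\<delta>2 > 0" "\<forall>b\<in>ETOP_pts. mdist m (to_compl a) (to_compl b) < \<delta>2 \<longrightarrow> b \<in> B"
        using Int.IH unfolding metrically_open_def by (metis IntD1 IntD2)
      then show "\<exists>\<delta>>0. \<forall>b\<in>ETOP_pts. mdist m (to_compl a) (to_compl b) < \<delta> \<longrightarrow> b \<in> A \<inter> B"
        by (intro exI[of _ "min \<delta>1 \<delta>2"]) auto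
    qed (use Int.IH in \<open>auto simp: metrically_open_def\<close>)
  next
    case (UN K)
    then show ?case unfolding metrically_open_def by blast
  next
    case (Basis A)
    then show ?case
      using metrically_open_component_set metrically_open_edge_set by (auto simp: edge_sets_def)
  qed
qed

subsection \<open>Metrically open sets are open in \<open>ETOP\<close>\<close>

lemma inner_point_near_vertex:
  assumes e: "e \<in> edges G" and y: "y \<in> e" and "0 < \<epsilon>"
  shows "\<exists>z\<in>edge_interior e. \<forall>p\<in>edge_pts e. z y < p y \<longrightarrow> \<bar>\<sigma> e p - \<sigma> e (vertex_pt y)\<bar> < \<epsilon>"
proof -
  obtain x where x: "x \<noteq> y" "e = {x, y}" using edgeE'[OF e y] by blast
  have "continuous_on {0..1} (\<lambda>s. \<sigma> e (edge_pt x y s))"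
    by (rule continuous_on_compose2[OF sigma_continuous[OF e] continuous_on_edge_pt])
       (use edge_pt_in_edge_pts[OF x(1)] x(2) in auto)
  then obtain \<delta> where \<delta>: "\<delta> > 0" "\<And>s. s \<in> {0..1} \<Longrightarrow> dist s 1 < \<delta> \<Longrightarrow>
      dist (\<sigma> e (edge_pt x y s)) (\<sigma> e (edge_pt x y 1)) < \<epsilon>"
    using \<open>0 < \<epsilon>\<close> unfolding continuous_on_iff by (metis atLeastAtMost_iff order_refl zero_le_one)
  define s where "s = max (1 - \<delta> / 2) (1 / 2)"
  have s: "0 < s" "s < 1" "1 - s < \<delta>" using \<delta>(1) by (auto simp: s_def)
  have v: "edge_pt x y 1 = vertex_pt y" using x(1) by (auto simp: edge_pt_def vertex_pt_apply fun_eq_iff)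
  have sy: "edge_pt x y s y = s" by (simp add: edge_pt_def)
  show ?thesis
  proof (intro bexI[of _ "edge_pt x y s"] ballI impI)
    show "edge_pt x y s \<in> edge_interior e"
      using edge_interior_doubleton[OF x(1), of "edge_pt x y s"] edge_pt_in_edge_pts[OF x(1), of s] s x(2)
      by (simp add: sy)
    fix p assume p: "p \<in> edge_pts e" "edge_pt x y s y < p y"
    have py: "p y \<in> {0..1}" "edge_pt x y (p y) = p"
      using edge_pts_coordinates[OF x(1), of p] p(1) x(2) by auto
    have "dist (p y) 1 < \<delta>" using p(2) py(1) s by (simp add: sy dist_real_def)
    from \<delta>(2)[OF py(1) this] show "\<bar>\<sigma> e p - \<sigma> e (vertex_pt y)\<bar> < \<epsilon>"
      by (simp add: py(2) v dist_real_def)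
  qed
qed

lemma mdist_emb_triangle:
  "p \<in> points G \<Longrightarrow> q \<in> points G \<Longrightarrow> r \<in> points G \<Longrightarrow>
    mdist m (emb p) (emb r) \<le> mdist m (emb p) (emb q) + mdist m (emb q) (emb r)"
  by (rule mdist_triangle) auto

text \<open>For small \<open>tail S\<close> and short half-edges a component of \<open>G - S\<close> has a small neighbourhood:
  each of its vertices is within \<open>tail S\<close> of \<open>x\<close>, and every other point is close to a vertex.\<close>

lemma mdist_nbhd_le:
  assumes S: "finite S" "S \<subseteq> edges G" and x: "x \<in> verts G" and c: "tail S \<le> c"
    and t: "\<And>e y p. e \<in> S \<Longrightarrow> y \<in> e \<Longrightarrow> p \<in> edge_pts e \<Longrightarrow> t e y < p y \<Longrightarrow>
      \<bar>\<sigma> e p - \<sigma> e (vertex_pt y)\<bar> < c"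
    and p: "p \<in> nbhd (vcomp S x) S t"
  shows "mdist m (emb p) (emb (vertex_pt x)) \<le> 2 * c"
proof -
  have vert: "mdist m (emb (vertex_pt y)) (emb (vertex_pt x)) \<le> c" if "y \<in> vcomp S x" for y
  proof -
    have "linked (del_edges G S) x y" using that by (simp add: vcomp_def)
    from mdist_linked_le[OF this x S] c show ?thesis by (simp add: mdist_commute)
  qed
  have via: ?thesis if e: "e \<in> edges G" "p \<in> edge_pts e" "y \<in> e" "y \<in> vcomp S x"
    and le: "mdist m (emb p) (emb (vertex_pt y)) \<le> c" for e y
  proof -
    have "p \<in> points G" "vertex_pt y \<in> points G"
      using e edge_pts_subset_points vertex_pt_in_points edge_subset_verts by blast+
    from mdist_emb_triangle[OF this vertex_pt_in_points[OF x]] le vert[OF e(4)]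
    show ?thesis by linarith
  qed
  have "0 \<le> c" using c tail_nonneg[of S] by linarith
  from p consider y where "y \<in> vcomp S x" "p = vertex_pt y"
    | e where "e \<in> edges G - S" "e \<subseteq> vcomp S x" "p \<in> edge_pts e"
    | e y where "e \<in> S" "y \<in> e \<inter> vcomp S x" "p \<in> edge_pts e" "t e y < p y"
    unfolding nbhd_def by blast
  then show ?thesis
  proof cases
    case 1
    then show ?thesis using vert[of y] \<open>0 \<le> c\<close> by simp
  next
    case 2
    then have e: "e \<in> edges G" "e \<notin> S" by auto
    then obtain y where y: "y \<in> e" using edgeE[OF e(1)] by blast
    have "mdist m (emb p) (emb (vertex_pt y)) \<le> l e"
      by (rule mdist_edge_le_length[OF e(1) 2(3)]) (use vertex_pt_mem_edge_pts[OF e(1)] y in simp)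
    then show ?thesis using via[OF e(1) 2(3) y] 2(2) y length_le_tail[OF e] c by auto
  next
    case 3
    then have e: "e \<in> edges G" and y: "y \<in> e" using S(2) by auto
    have "mdist m (emb p) (emb (vertex_pt y)) \<le> \<bar>\<sigma> e p - \<sigma> e (vertex_pt y)\<bar>"
      by (rule mdist_edge_le[OF e 3(3)]) (use vertex_pt_mem_edge_pts[OF e] y in simp)
    then show ?thesis using via[OF e 3(3) y] 3 t[OF 3(1) y 3(3,4)] by auto
  qed
qed

text \<open>At a vertex or an end, delete edges until their tail is less than \<open>\<epsilon> / 6\<close> and take half-edges
  shorter than \<open>\<epsilon> / 6\<close>. Then every point of the basic neighbourhood is within \<open>\<epsilon> / 3\<close> of a vertex of
  the component. At an inner point the metric of the edge suffices.\<close>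

lemma small_open_nbhd:
  assumes a: "a \<in> ETOP_pts" and "0 < \<epsilon>"
  shows "\<exists>U. openin (ETOP_pre G) U \<and> a \<in> U \<and> (\<forall>b\<in>U. mdist m (to_compl a) (to_compl b) < \<epsilon>)"
proof -
  have comp_case: ?thesis
    if S: "finite S" "S \<subseteq> edges G" "tail S < \<epsilon> / 6" and x: "x \<in> verts G"
      and a': "a = Inl (vertex_pt x) \<or> (\<exists>\<omega>. a = Inr \<omega> \<and> \<omega> \<in> ends_in G (component S x))" for S x
  proof -
    have "\<exists>z\<in>edge_interior e. \<forall>p\<in>edge_pts e. z y < p y \<longrightarrow> \<bar>\<sigma> e p - \<sigma> e (vertex_pt y)\<bar> < \<epsilon> / 6"
      if "e \<in> S" "y \<in> e" for e y
      by (rule inner_point_near_vertex) (use that S(2) \<open>0 < \<epsilon>\<close> in auto)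
    then obtain z where z: "\<And>e y. e \<in> S \<Longrightarrow> y \<in> e \<Longrightarrow> z e y \<in> edge_interior e"
      "\<And>e y p. e \<in> S \<Longrightarrow> y \<in> e \<Longrightarrow> p \<in> edge_pts e \<Longrightarrow> z e y y < p y \<Longrightarrow>
        \<bar>\<sigma> e p - \<sigma> e (vertex_pt y)\<bar> < \<epsilon> / 6"
      by metis
    let ?N = "nbhd (vcomp S x) S (\<lambda>e y. z e y y)"
    let ?U = "Inl ` ?N \<union> Inr ` ends_in G (component S x)"
    have zi: "\<forall>e\<in>S. \<forall>y\<in>e \<inter> vcomp S x. z e y \<in> edge_interior e" using z(1) by blast
    note cut = cut_vcomp[OF S(2) x]
    note t = inner_coords_points[OF S(2) zi]
    have UT: "?U \<subseteq> ETOP_pts" by (auto simp: ETOP_pts_def nbhd_def ends_in_def)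
    have xT: "Inl (vertex_pt x) \<in> ETOP_pts" using vertex_pt_in_points[OF x] by (simp add: ETOP_pts_def)
    have "openin (ETOP_pre G) ?U"
      unfolding ETOP_pre_eq by (rule topology_generated_by_Basis) (use component_setI[OF S(1,2) x zi] in blast)
    moreover have "a \<in> ?U" using a' nbhd_vertex[OF cut t x] by auto
    moreover have near: "mdist m (to_compl b) (emb (vertex_pt x)) \<le> 2 * (\<epsilon> / 6)" if b: "b \<in> ?U" for b
    proof -
      have ev: "\<forall>\<^sub>F n in sequentially. approx b n \<in> ?N"
      proof (cases b)
        case (Inl p)
        then show ?thesis using b by auto
      next
        case (Inr \<omega>)
        then have "\<omega> \<in> ends_in G (component S x)" using b by blast
        then have w: "\<omega> \<in> edge_ends G" "\<forall>\<^sub>F n in sequentially. some_ray \<omega> n \<in> vcomp S x"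
          using ends_in_component_iff[OF _ some_ray S(1,2) x] by (auto simp: ends_in_def)
        from w(2) show ?thesis
        proof eventually_elim
          case (elim n)
          then show ?case
            using nbhd_vertex[OF cut t] vcomp_subset[OF x] Inr by (auto simp: approx_Inr)
        qed
      qed
      have "\<forall>\<^sub>F n in sequentially. mdist m (emb (approx b n)) (emb (approx (Inl (vertex_pt x)) n)) \<le> 2 * (\<epsilon> / 6)"
        using ev
      proof eventually_elim
        case (elim n)
        then show ?case
          using mdist_nbhd_le[OF S(1,2) x _ z(2) elim] S(3) by simp
      qed
      from mdist_to_compl_le[OF _ xT this] b UT show ?thesis by (auto simp: to_compl_Inl)
    qed
    moreover have "mdist m (to_compl a) (to_compl b) < \<epsilon>" if b: "b \<in> ?U" for b
    proof -
      have "mdist m (to_compl a) (to_compl b) \<le> mdist m (to_compl a) (emb (vertex_pt x)) + mdist m (emb (vertex_pt x)) (to_compl b)"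
        by (rule mdist_triangle) (use to_compl_in a b UT vertex_pt_in_points[OF x] in auto)
      then show ?thesis
        using near[OF b] near[OF \<open>a \<in> ?U\<close>] \<open>0 < \<epsilon>\<close> by (simp add: mdist_commute)
    qed
    ultimately show ?thesis by blast
  qed
  from \<open>0 < \<epsilon>\<close> have "0 < \<epsilon> / 6" by simp
  then obtain S where S: "finite S" "S \<subseteq> edges G" "tail S < \<epsilon> / 6" by (rule small_tail)
  show ?thesis
  proof (cases rule: ETOP_pts_cases[OF a])
    case (1 v)
    then show ?thesis by (intro comp_case[OF S 1(1)]) simp
  next
    case (3 \<omega>)
    obtain x where x: "x \<in> verts G" "\<forall>\<^sub>F n in sequentially. some_ray \<omega> n \<in> vcomp S x"
      using ray_eventually_in_vcomp[OF some_ray_in_rays[OF 3(1)] S(1)] by blast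
    then have "\<omega> \<in> ends_in G (component S x)"
      using ends_in_component_iff[OF 3(1) some_ray[OF 3(1)] S(1,2) x(1)] by blast
    then show ?thesis using 3 by (intro comp_case[OF S x(1)]) simp
  next
    case (2 e p)
    let ?W = "{q \<in> edge_interior e. dist (\<sigma> e q) (\<sigma> e p) < \<epsilon>}"
    have "continuous_on (edge_interior e) (\<sigma> e)"
      using sigma_continuous[OF 2(1)] by (rule continuous_on_subset) (auto simp: edge_interior_def)
    from continuous_openin_preimage_gen[OF this open_ball[of "\<sigma> e p" \<epsilon>]]
    have "openin (top_of_set (edge_interior e)) ?W"
      by (simp add: vimage_def Int_def dist_commute)
    then have "openin (ETOP_pre G) (Inl ` ?W)"
      unfolding ETOP_pre_eq by (intro topology_generated_by_Basis) (use 2(1) in \<open>auto simp: edge_sets_def\<close>)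
    moreover have "a \<in> Inl ` ?W" using 2 \<open>0 < \<epsilon>\<close> by simp
    moreover have "mdist m (to_compl a) (to_compl b) < \<epsilon>" if b: "b \<in> Inl ` ?W" for b
    proof -
      obtain q where q: "q \<in> edge_interior e" "dist (\<sigma> e q) (\<sigma> e p) < \<epsilon>" "b = Inl q"
        using b by blast
      have "mdist m (emb p) (emb q) \<le> \<bar>\<sigma> e p - \<sigma> e q\<bar>"
        by (rule mdist_edge_le[OF 2(1)]) (use 2 q in \<open>auto simp: edge_interior_def\<close>)
      then show ?thesis using q 2 by (simp add: to_compl_Inl dist_real_def abs_minus_commute)
    qed
    ultimately show ?thesis by blast
  qed
qed

lemma openin_ETOP_pre_iff: "openin (ETOP_pre G) U \<longleftrightarrow> metrically_open U"
proof
  assume U: "metrically_open U"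
  show "openin (ETOP_pre G) U"
  proof (subst openin_subopen, intro ballI)
    fix a assume a: "a \<in> U"
    obtain \<delta> where \<delta>: "\<delta> > 0" "\<forall>b\<in>ETOP_pts. mdist m (to_compl a) (to_compl b) < \<delta> \<longrightarrow> b \<in> U"
      using U a unfolding metrically_open_def by blast
    have "a \<in> ETOP_pts" using U a unfolding metrically_open_def by blast
    then obtain V where V: "openin (ETOP_pre G) V" "a \<in> V" "\<forall>b\<in>V. mdist m (to_compl a) (to_compl b) < \<delta>"
      using small_open_nbhd[OF _ \<delta>(1)] by blast
    moreover have "V \<subseteq> ETOP_pts" using openin_subset[OF V(1)] topspace_ETOP_pre by simp
    ultimately show "\<exists>V. openin (ETOP_pre G) V \<and> a \<in> V \<and> V \<subseteq> U" using \<delta>(2) by blast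
  qed
qed (rule metrically_open_ETOP_pre)

section \<open>Every point of the completion comes from a point or an end\<close>

text \<open>A component without an endvertex of an edge in \<open>S\<close> is closed under all edges of the connected
  graph. So deleting finitely many edges leaves finitely many components.\<close>

lemma vcomp_meets_cut:
  assumes x: "x \<in> verts G"
  shows "vcomp S x = verts G \<or> (\<exists>e\<in>S. \<exists>y\<in>e. y \<in> vcomp S x)"
proof (rule ccontr)
  assume *: "\<not> ?thesis"
  have "y \<in> vcomp S x" if "linked (del_edges G {}) x y" for y
    using that unfolding linked_def
  proof (induction rule: rtrancl_induct)
    case (step y z)
    then have "{y, z} \<in> edges G" by (simp add: del_edges_def)
    moreover have "{y, z} \<notin> S" using * step.IH by blast
    ultimately show ?case using edge_in_vcomp step.IH by blast
  qed simp
  then have "verts G \<subseteq> vcomp S x" using linked_G[OF x] by blast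
  then show False using * vcomp_subset[OF x] by blast
qed

text \<open>The lower bound of \<open>mdist_nbhd_ge\<close> depends on the component. By \<open>vcomp_meets_cut\<close> there are
  finitely many components, so that one constant separates them all.\<close>

lemma close_vertices_linked:
  assumes S: "finite S" "S \<subseteq> edges G"
  shows "\<exists>\<delta>>0. \<forall>v\<in>verts G. \<forall>w\<in>verts G. mdist m (emb (vertex_pt v)) (emb (vertex_pt w)) < \<delta> \<longrightarrow> vcomp S v = vcomp S w"
proof -
  have "\<exists>\<delta>>0. \<forall>y\<in>\<Union>S. \<forall>b. fst b \<in> vcomp S y \<and> snd b \<in> verts G - vcomp S y \<longrightarrow>
      \<delta> \<le> mdist m (emb (vertex_pt (fst b))) (emb (vertex_pt (snd b)))"
  proof (rule finite_uniform_bound)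
    show "finite (\<Union>S)" using S edge_finite by blast
    fix y assume "y \<in> \<Union>S"
    then have y: "y \<in> verts G" using S edge_subset_verts by blast
    have t: "inner_coords (vcomp S y) S (\<lambda>e y. 1/2)" by (simp add: inner_coords_def)
    note cut = cut_vcomp[OF S(2) y]
    obtain \<delta> where \<delta>: "\<delta> > 0" "\<forall>v\<in>vcomp S y. \<forall>q\<in>points G - nbhd (vcomp S y) S (\<lambda>e y. 1/2).
        \<delta> \<le> mdist m (emb (vertex_pt v)) (emb q)"
      using mdist_nbhd_ge[OF S y t] by blast
    show "\<exists>\<delta>>0. \<forall>b. fst b \<in> vcomp S y \<and> snd b \<in> verts G - vcomp S y \<longrightarrow>
      \<delta> \<le> mdist m (emb (vertex_pt (fst b))) (emb (vertex_pt (snd b)))"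
      using \<delta> nbhd_vertex[OF cut t] vertex_pt_in_points by (intro exI[of _ \<delta>]) auto
  qed
  then obtain \<delta> where \<delta>: "\<delta> > 0" "\<And>y v w. y \<in> \<Union>S \<Longrightarrow> v \<in> vcomp S y \<Longrightarrow> w \<in> verts G - vcomp S y \<Longrightarrow>
      \<delta> \<le> mdist m (emb (vertex_pt v)) (emb (vertex_pt w))"
    by (metis fst_conv snd_conv)
  have "vcomp S v = vcomp S w" if v: "v \<in> verts G" and w: "w \<in> verts G"
    and less: "mdist m (emb (vertex_pt v)) (emb (vertex_pt w)) < \<delta>" for v w
  proof -
    have "w \<in> vcomp S v"
    proof (rule ccontr)
      assume nw: "w \<notin> vcomp S v"
      then obtain y where y: "y \<in> \<Union>S" "y \<in> vcomp S v" using vcomp_meets_cut[OF v, of S] w by blast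
      have "vcomp S y = vcomp S v" by (rule vcomp_eq[OF y(2)])
      then have "\<delta> \<le> mdist m (emb (vertex_pt v)) (emb (vertex_pt w))"
        using \<delta>(2)[OF y(1)] nw w by auto
      then show False using less by linarith
    qed
    from vcomp_eq[OF this] show ?thesis by simp
  qed
  then show ?thesis using \<delta>(1) by blast
qed

lemma points_dense:
  assumes "c \<in> mspace m" "0 < \<epsilon>"
  shows "\<exists>p\<in>points G. mdist m c (emb p) < \<epsilon>"
proof -
  interpret M: Metric_space "mspace m" "mdist m" by (rule Metric_space_mspace_mdist)
  have "c \<in> M.mtopology closure_of (i ` ident_points G \<sigma>)"
    using completion assms(1) by (simp add: is_completion_def mtopology_of_def)
  then obtain x where x: "x \<in> ident_points G \<sigma>" "mdist m c (i x) < \<epsilon>"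
    using assms(2) unfolding M.metric_closure_of by auto
  then obtain p where "p \<in> points G" "x = ident_class G \<sigma> p"
    unfolding ident_points_def ident_class_def by (auto elim: quotientE)
  then show ?thesis using x(2) by (auto simp: emb_def)
qed

text \<open>A point away from all vertices is a limit of points of the finitely many long edges, and
  these are compact.\<close>

lemma far_from_vertices:
  assumes c: "c \<in> mspace m" and "0 < \<epsilon>" and far: "\<And>v. v \<in> verts G \<Longrightarrow> \<epsilon> \<le> mdist m c (emb (vertex_pt v))"
  shows "\<exists>p\<in>points G. emb p = c"
proof -
  from \<open>0 < \<epsilon>\<close> have "0 < \<epsilon> / 2" by simp
  then obtain S where S: "finite S" "S \<subseteq> edges G" "tail S < \<epsilon> / 2" by (rule small_tail)
  have on_S: "\<exists>e\<in>S. p \<in> edge_pts e" if p: "p \<in> points G" "mdist m c (emb p) < \<epsilon> / 2" for p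
    using p(1)
  proof (cases rule: points_cases)
    case (1 v)
    then show ?thesis using far[of v] p(2) \<open>0 < \<epsilon>\<close> by simp
  next
    case (2 e)
    have pe: "p \<in> edge_pts e" using 2 by (simp add: edge_interior_def)
    show ?thesis
    proof (cases "e \<in> S")
      case False
      obtain y where y: "y \<in> verts G" "y \<in> e" using edgeE[OF 2(1)] by blast
      have "mdist m (emb p) (emb (vertex_pt y)) \<le> l e"
        by (rule mdist_edge_le_length[OF 2(1) pe]) (use vertex_pt_mem_edge_pts[OF 2(1)] y in simp)
      also have "l e \<le> tail S" by (rule length_le_tail[OF 2(1) False])
      finally have "mdist m c (emb (vertex_pt y)) < \<epsilon>"
        using mdist_triangle[of c m "emb p" "emb (vertex_pt y)"] c p vertex_pt_in_points[OF y(1)] S(3) by simp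
      then show ?thesis using far[OF y(1)] by simp
    qed (use pe in blast)
  qed
  have "\<exists>e\<in>S. \<forall>\<delta>>0. \<exists>p\<in>edge_pts e. mdist m c (emb p) < \<delta>"
  proof (rule ccontr)
    assume "\<not> ?thesis"
    then have "\<exists>\<delta>>0. \<forall>p. p \<in> edge_pts e \<longrightarrow> \<delta> \<le> mdist m c (emb p)" if "e \<in> S" for e
      using that by (meson not_le)
    from finite_uniform_bound[OF S(1), of "\<lambda>e p. p \<in> edge_pts e", OF this]
    obtain \<delta> where \<delta>: "\<delta> > 0" "\<forall>e\<in>S. \<forall>p. p \<in> edge_pts e \<longrightarrow> \<delta> \<le> mdist m c (emb p)" by blast
    obtain p where "p \<in> points G" "mdist m c (emb p) < min \<delta> (\<epsilon> / 2)"
      using points_dense[OF c, of "min \<delta> (\<epsilon> / 2)"] \<delta>(1) \<open>0 < \<epsilon>\<close> by auto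
    then show False using on_S[of p] \<delta>(2) by fastforce
  qed
  then obtain e where e: "e \<in> S" "\<And>\<delta>. \<delta> > 0 \<Longrightarrow> \<exists>p\<in>edge_pts e. mdist m c (emb p) < \<delta>" by blast
  have eE: "e \<in> edges G" using e(1) S(2) by blast
  have in_m: "p \<in> edge_pts e \<Longrightarrow> emb p \<in> mspace m" for p using edge_pts_subset_points[OF eE] by auto
  obtain \<tau> where \<tau>: "homeomorphism (edge_pts e) {0..l e} (\<sigma> e) \<tau>" using sigma[OF eE] by blast
  have \<tau>_in: "\<tau> s \<in> edge_pts e" if "s \<in> {0..l e}" for s using homeomorphism_image2[OF \<tau>] that by blast
  have lip: "\<bar>mdist m c (emb p) - mdist m c (emb q)\<bar> \<le> \<bar>\<sigma> e p - \<sigma> e q\<bar>"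
    if p: "p \<in> edge_pts e" and q: "q \<in> edge_pts e" for p q
    using mdist_triangle[OF c in_m[OF p] in_m[OF q]] mdist_triangle[OF c in_m[OF q] in_m[OF p]]
      mdist_edge_le[OF eE p q] mdist_commute[of m "emb p" "emb q"] by linarith
  have "continuous_on {0..l e} (\<lambda>s. mdist m c (emb (\<tau> s)))"
    unfolding continuous_on_iff
  proof (intro ballI allI impI)
    fix s \<epsilon> :: real assume s: "s \<in> {0..l e}" and "0 < \<epsilon>"
    have "dist (mdist m c (emb (\<tau> s'))) (mdist m c (emb (\<tau> s))) < \<epsilon>" if "s' \<in> {0..l e}" "dist s' s < \<epsilon>" for s'
      using lip[OF \<tau>_in[OF that(1)] \<tau>_in[OF s]] homeomorphism_apply2[OF \<tau>] s that by (simp add: dist_real_def)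
    then show "\<exists>d>0. \<forall>s'\<in>{0..l e}. dist s' s < d \<longrightarrow> dist (mdist m c (emb (\<tau> s'))) (mdist m c (emb (\<tau> s))) < \<epsilon>"
      using \<open>0 < \<epsilon>\<close> by blast
  qed
  then obtain s where s: "s \<in> {0..l e}" "\<forall>s'\<in>{0..l e}. mdist m c (emb (\<tau> s)) \<le> mdist m c (emb (\<tau> s'))"
    using continuous_attains_inf[of "{0..l e}" "\<lambda>s. mdist m c (emb (\<tau> s))"] l_nonneg[OF eE] by auto
  have "mdist m c (emb (\<tau> s)) \<le> \<delta>" if "\<delta> > 0" for \<delta>
  proof -
    obtain p where p: "p \<in> edge_pts e" "mdist m c (emb p) < \<delta>" using e(2)[OF \<open>\<delta> > 0\<close>] by blast
    then show ?thesis
      using s(2)[rule_format, OF sigma_mem[OF eE p(1)]] homeomorphism_apply1[OF \<tau> p(1)] by simp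
  qed
  then have "mdist m c (emb (\<tau> s)) \<le> 0" by (rule field_le_epsilon) simp
  then have "mdist m c (emb (\<tau> s)) = 0" using mdist_nonneg[of m c "emb (\<tau> s)"] by linarith
  then show ?thesis using mdist_zero[OF c in_m[OF \<tau>_in[OF s(1)]]] \<tau>_in[OF s(1)] edge_pts_subset_points[OF eE] by auto
qed

text \<open>For a limit \<open>c\<close> of vertices, this is the component of \<open>G - S\<close> that contains all vertices
  close to \<open>c\<close>.\<close>

definition comp_near :: "'c \<Rightarrow> 'v set set \<Rightarrow> 'v set" where
  "comp_near c S = {w \<in> verts G. \<exists>\<delta>>0. \<forall>v\<in>verts G. mdist m c (emb (vertex_pt v)) < \<delta> \<longrightarrow> w \<in> vcomp S v}"

text \<open>Vertices close to \<open>c\<close> are close to each other and hence in the same component, by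
  \<open>close_vertices_linked\<close>.\<close>

lemma comp_near_eq:
  assumes c: "c \<in> mspace m" and dense: "\<And>\<epsilon>. \<epsilon> > 0 \<Longrightarrow> \<exists>v\<in>verts G. mdist m c (emb (vertex_pt v)) < \<epsilon>"
    and S: "finite S" "S \<subseteq> edges G"
  obtains v where "v \<in> verts G" "comp_near c S = vcomp S v"
proof -
  obtain \<delta> where \<delta>: "\<delta> > 0" "\<forall>v\<in>verts G. \<forall>w\<in>verts G.
      mdist m (emb (vertex_pt v)) (emb (vertex_pt w)) < \<delta> \<longrightarrow> vcomp S v = vcomp S w"
    using close_vertices_linked[OF S] by blast
  have near: "vcomp S v = vcomp S w" if v: "v \<in> verts G" "mdist m c (emb (vertex_pt v)) < \<delta> / 2"
    and w: "w \<in> verts G" "mdist m c (emb (vertex_pt w)) < \<delta> / 2" for v w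
  proof -
    have "mdist m (emb (vertex_pt v)) (emb (vertex_pt w)) \<le> mdist m (emb (vertex_pt v)) c + mdist m c (emb (vertex_pt w))"
      by (rule mdist_triangle) (use c v w vertex_pt_in_points in auto)
    then have "mdist m (emb (vertex_pt v)) (emb (vertex_pt w)) < \<delta>"
      using v(2) w(2) mdist_commute[of m "emb (vertex_pt v)" c] by linarith
    then show ?thesis using \<delta>(2) v(1) w(1) by blast
  qed
  obtain v where v: "v \<in> verts G" "mdist m c (emb (vertex_pt v)) < \<delta> / 2" using dense[of "\<delta> / 2"] \<delta>(1) by auto
  have "comp_near c S = vcomp S v"
  proof (intro subset_antisym subsetI)
    fix w assume "w \<in> comp_near c S"
    then obtain \<delta>' where \<delta>': "\<delta>' > 0" "\<forall>u\<in>verts G. mdist m c (emb (vertex_pt u)) < \<delta>' \<longrightarrow> w \<in> vcomp S u"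
      by (auto simp: comp_near_def)
    obtain u where u: "u \<in> verts G" "mdist m c (emb (vertex_pt u)) < min \<delta>' (\<delta> / 2)"
      using dense[of "min \<delta>' (\<delta> / 2)"] \<delta>(1) \<delta>'(1) by auto
    then have "w \<in> vcomp S u" using \<delta>'(2) by simp
    moreover have "vcomp S u = vcomp S v" by (rule near) (use u v in auto)
    ultimately show "w \<in> vcomp S v" by simp
  next
    fix w assume w: "w \<in> vcomp S v"
    have "w \<in> vcomp S u" if "u \<in> verts G" "mdist m c (emb (vertex_pt u)) < \<delta> / 2" for u
      using near[OF that v] w by simp
    then show "w \<in> comp_near c S"
      unfolding comp_near_def using w vcomp_subset[OF v(1)] \<delta>(1)
      by (intro CollectI conjI exI[of _ "\<delta> / 2"]) auto
  qed
  with v(1) show thesis by (rule that)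
qed

lemma comp_near_antimono: "S \<subseteq> S' \<Longrightarrow> comp_near c S' \<subseteq> comp_near c S"
  using vcomp_antimono unfolding comp_near_def by blast

lemma comp_near_dist:
  assumes c: "c \<in> mspace m" and dense: "\<And>\<epsilon>. \<epsilon> > 0 \<Longrightarrow> \<exists>v\<in>verts G. mdist m c (emb (vertex_pt v)) < \<epsilon>"
    and S: "finite S" "S \<subseteq> edges G" and w: "w \<in> comp_near c S"
  shows "mdist m c (emb (vertex_pt w)) \<le> tail S"
proof (rule field_le_epsilon)
  fix \<epsilon> :: real assume "\<epsilon> > 0"
  obtain \<delta> where \<delta>: "\<delta> > 0" "\<forall>v\<in>verts G. mdist m c (emb (vertex_pt v)) < \<delta> \<longrightarrow> w \<in> vcomp S v"
    using w by (auto simp: comp_near_def)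
  obtain v where v: "v \<in> verts G" "mdist m c (emb (vertex_pt v)) < min \<delta> \<epsilon>"
    using dense[of "min \<delta> \<epsilon>"] \<delta>(1) \<open>\<epsilon> > 0\<close> by auto
  then have "linked (del_edges G S) v w" using \<delta>(2) by (simp add: vcomp_def)
  from mdist_linked_le[OF this v(1) S]
  have "mdist m (emb (vertex_pt v)) (emb (vertex_pt w)) \<le> tail S" .
  moreover have "w \<in> verts G" using w by (simp add: comp_near_def)
  ultimately show "mdist m c (emb (vertex_pt w)) \<le> tail S + \<epsilon>"
    using mdist_triangle[of c m "emb (vertex_pt v)" "emb (vertex_pt w)"] c v vertex_pt_in_points by simp
qed

text \<open>The components of \<open>G - S\<close> around \<open>c\<close> shrink as \<open>S\<close> grows. Either some vertex lies in all of
  them, or a walk passing through them one after the other is locally finite.\<close>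

lemma limit_of_vertices:
  assumes c: "c \<in> mspace m" and dense: "\<And>\<epsilon>. \<epsilon> > 0 \<Longrightarrow> \<exists>v\<in>verts G. mdist m c (emb (vertex_pt v)) < \<epsilon>"
  shows "\<exists>a\<in>ETOP_pts. to_compl a = c"
proof -
  have "\<exists>F. finite F \<and> F \<subseteq> edges G \<and> tail F < inverse (Suc n)" for n
    by (rule small_tail[of "inverse (Suc n)"]) auto
  then obtain F where F: "\<And>n. finite (F n)" "\<And>n. F n \<subseteq> edges G" "\<And>n. tail (F n) < inverse (Suc n)"
    by metis
  \<comment> \<open>Unions make the sets increasing, so that the components around \<open>c\<close> decrease.\<close>
  define S where "S n = (\<Union>i\<le>n. F i)" for n
  have S: "finite (S n)" "S n \<subseteq> edges G" for n using F by (auto simp: S_def)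
  have tail_S: "tail (S n) < inverse (Suc n)" for n
  proof -
    have "tail (S n) \<le> tail (F n)" by (rule tail_antimono) (auto simp: S_def)
    then show ?thesis using F(3)[of n] by linarith
  qed
  have S_mono: "S n \<subseteq> S n'" if "n \<le> n'" for n n' using that by (force simp: S_def)
  define C where "C n = comp_near c (S n)" for n
  have C_anti: "C n' \<subseteq> C n" if "n \<le> n'" for n n'
    unfolding C_def by (rule comp_near_antimono[OF S_mono[OF that]])
  have C_verts: "C n \<subseteq> verts G" for n by (auto simp: C_def comp_near_def)
  have "\<exists>v\<in>verts G. C n = vcomp (S n) v" for n
    unfolding C_def using comp_near_eq[OF c dense S] by blast
  then obtain v where v: "\<And>n. v n \<in> verts G" "\<And>n. C n = vcomp (S n) (v n)" by metis
  have C_dist: "mdist m c (emb (vertex_pt w)) < inverse (Suc n)" if "w \<in> C n" for w n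
    using comp_near_dist[OF c dense S, of w n] that tail_S[of n] unfolding C_def by linarith
  show ?thesis
  proof (cases "\<exists>w. \<forall>n. w \<in> C n")
    case True
    then obtain w where w: "\<And>n. w \<in> C n" by blast
    then have wv: "w \<in> verts G" using C_verts by blast
    have "mdist m c (emb (vertex_pt w)) \<le> 0"
    proof (rule field_le_epsilon)
      fix \<epsilon> :: real assume "\<epsilon> > 0"
      then obtain n where "inverse (Suc n) < \<epsilon>" using reals_Archimedean by blast
      then show "mdist m c (emb (vertex_pt w)) \<le> 0 + \<epsilon>" using C_dist[OF w, of n] by linarith
    qed
    then have "mdist m c (emb (vertex_pt w)) = 0"
      using mdist_nonneg[of m c "emb (vertex_pt w)"] by linarith
    then have "c = emb (vertex_pt w)" using mdist_zero[of c m] c vertex_pt_in_points[OF wv] by simp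
    then show ?thesis
      using vertex_pt_in_points[OF wv] by (intro bexI[of _ "Inl (vertex_pt w)"]) (auto simp: ETOP_pts_def to_compl_Inl)
  next
    case False
    have "\<exists>L p. p 0 = v n \<and> p L = v (Suc n) \<and> (\<forall>i<L. {p i, p (Suc i)} \<in> edges G - S n)" for n
    proof -
      have "v (Suc n) \<in> C (Suc n)" by (simp add: v(2))
      then have "v (Suc n) \<in> C n" using C_anti[of n "Suc n"] by auto
      then have "linked (del_edges G (S n)) (v n) (v (Suc n))" by (simp add: v(2) vcomp_def)
      then obtain L where "(v n, v (Suc n)) \<in> {(x, y). {x, y} \<in> edges (del_edges G (S n))} ^^ L"
        unfolding linked_def using rtrancl_imp_relpow by blast
      then show ?thesis unfolding relpow_fun_conv by (auto simp: del_edges_def)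
    qed
    then obtain L p where p: "\<And>n. p n 0 = v n" "\<And>n. p n (L n) = v (Suc n)"
      "\<And>n i. i < L n \<Longrightarrow> {p n i, p n (Suc i)} \<in> edges G - S n" by metis
    have p_C: "p n i \<in> C n" if "i \<le> L n" for n i
      using that
    proof (induction i)
      case (Suc i)
      then show ?case
        using edge_in_vcomp[of "p n i" "p n (Suc i)" "S n" "v n"] p(3)[of i n] by (simp add: v(2))
    qed (simp add: p(1) v(2))
    obtain W where W: "\<And>t. W (Suc t) = W t \<or> (\<exists>n i. i < L n \<and> W t = p n i \<and> W (Suc t) = p n (Suc i))"
      "\<And>N. \<exists>t0. \<forall>t\<ge>t0. \<exists>n\<ge>N. \<exists>i\<le>L n. W t = p n i"
      "\<And>t. \<exists>n. \<exists>i\<le>L n. W t = p n i"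
      by (rule concatenate_walks[of p L]) (auto simp: p(1,2))
    have W_C: "\<exists>t0. \<forall>t\<ge>t0. W t \<in> C N" for N
    proof -
      obtain t0 where t0: "\<forall>t\<ge>t0. \<exists>n\<ge>N. \<exists>i\<le>L n. W t = p n i" using W(2) by blast
      have "W t \<in> C N" if t: "t \<ge> t0" for t
      proof -
        obtain n i where n: "n \<ge> N" "i \<le> L n" "W t = p n i" using t0 t by blast
        then have "W t \<in> C n" using p_C by simp
        then show ?thesis using C_anti[OF n(1)] by blast
      qed
      then show ?thesis by blast
    qed
    obtain \<tau> where \<tau>: "strict_mono \<tau>" "(\<lambda>n. W (\<tau> n)) \<in> rays G"
    proof (rule locally_finite_walk_contains_ray)
      show "range W \<subseteq> verts G"
      proof (rule image_subsetI)
        fix t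
        obtain n i where "i \<le> L n" "W t = p n i" using W(3) by blast
        then show "W t \<in> verts G" using p_C[of i n] C_verts[of n] by auto
      qed
      show "W (Suc t) = W t \<or> {W t, W (Suc t)} \<in> edges G" for t
        using W(1)[of t] p(3) by fastforce
      fix u
      obtain N where "u \<notin> C N" using False by blast
      moreover obtain t0 where "\<forall>t\<ge>t0. W t \<in> C N" using W_C by blast
      ultimately have "{t. W t = u} \<subseteq> {..<t0}" by (auto simp: not_le[symmetric])
      then show "finite {t. W t = u}" by (rule finite_subset) simp
    qed
    let ?r = "\<lambda>n. W (\<tau> n)"
    have r_C: "\<forall>\<^sub>F n in sequentially. ?r n \<in> C N" for N
    proof -
      obtain t0 where t0: "\<forall>t\<ge>t0. W t \<in> C N" using W_C by blast
      have "?r n \<in> C N" if "n \<ge> t0" for n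
        using t0 seq_suble[OF \<tau>(1), of n] that by (meson order_trans)
      then show ?thesis by (auto simp: eventually_sequentially)
    qed
    define \<omega> where "\<omega> = edge_equiv G `` {?r}"
    have w: "\<omega> \<in> edge_ends G" unfolding \<omega>_def edge_ends_def by (rule quotientI[OF \<tau>(2)])
    have eqv: "(?r, some_ray \<omega>) \<in> edge_equiv G" using some_ray[OF w] unfolding \<omega>_def by simp
    have some_C: "\<forall>\<^sub>F n in sequentially. some_ray \<omega> n \<in> C N" for N
      using eqv r_C[of N] S[of N] v(1)[of N] unfolding edge_equiv_iff v(2) by blast
    have aT: "Inr \<omega> \<in> ETOP_pts" using w by (simp add: ETOP_pts_def)
    have "limitin (mtopology_of m) (\<lambda>n. emb (approx (Inr \<omega>) n)) c sequentially"
      unfolding limitin_m_iff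
    proof (intro conjI allI impI c)
      fix \<epsilon> :: real assume "\<epsilon> > 0"
      then obtain N where N: "inverse (Suc N) < \<epsilon>" using reals_Archimedean by blast
      from some_C[of N]
      show "\<forall>\<^sub>F n in sequentially. emb (approx (Inr \<omega>) n) \<in> mspace m \<and> mdist m (emb (approx (Inr \<omega>) n)) c < \<epsilon>"
      proof eventually_elim
        case (elim n)
        then show ?case
          using C_dist[OF elim] N approx_in_points[OF aT, of n] mdist_commute[of m c]
          by (simp add: approx_Inr)
      qed
    qed
    moreover have "Hausdorff_space (mtopology_of m)"
      unfolding mtopology_of_def by (rule Metric_space.Hausdorff_space_mtopology[OF Metric_space_mspace_mdist])
    ultimately have "to_compl (Inr \<omega>) = c"
      using limitin_Hausdorff_unique[OF approx_limit[OF aT]] by simp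
    then show ?thesis using aT by blast
  qed
qed

lemma to_compl_surj: "to_compl ` ETOP_pts = mspace m"
proof
  show "mspace m \<subseteq> to_compl ` ETOP_pts"
  proof
    fix c assume c: "c \<in> mspace m"
    show "c \<in> to_compl ` ETOP_pts"
    proof (cases "\<forall>\<epsilon>>0. \<exists>v\<in>verts G. mdist m c (emb (vertex_pt v)) < \<epsilon>")
      case True
      then show ?thesis using limit_of_vertices[OF c] by blast
    next
      case False
      then obtain \<epsilon> where "\<epsilon> > 0" "\<And>v. v \<in> verts G \<Longrightarrow> \<epsilon> \<le> mdist m c (emb (vertex_pt v))"
        by (meson not_le)
      then obtain p where "p \<in> points G" "emb p = c" using far_from_vertices[OF c] by blast
      then show ?thesis by (intro image_eqI[of _ _ "Inl p"]) (auto simp: ETOP_pts_def to_compl_Inl)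
    qed
  qed
qed (use to_compl_in in blast)

section \<open>The homeomorphism\<close>

lemma continuous_map_to_compl: "continuous_map (ETOP_pre G) (mtopology_of m) to_compl"
  unfolding continuous_map_def topspace_ETOP_pre topspace_mtopology_of
proof (intro conjI allI impI)
  show "to_compl \<in> ETOP_pts \<rightarrow> mspace m" using to_compl_in by blast
  fix V assume "openin (mtopology_of m) V"
  then have V: "\<And>c. c \<in> V \<Longrightarrow> \<exists>\<delta>>0. mball_of m c \<delta> \<subseteq> V"
    unfolding mtopology_of_def mball_of_def
    by (simp add: Metric_space.openin_mtopology[OF Metric_space_mspace_mdist])
  show "openin (ETOP_pre G) {a \<in> ETOP_pts. to_compl a \<in> V}"
    unfolding openin_ETOP_pre_iff metrically_open_def
  proof (intro conjI ballI)
    fix a assume "a \<in> {a \<in> ETOP_pts. to_compl a \<in> V}"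
    then have a: "a \<in> ETOP_pts" "to_compl a \<in> V" by auto
    obtain \<delta> where "\<delta> > 0" "mball_of m (to_compl a) \<delta> \<subseteq> V" using V[OF a(2)] by blast
    then show "\<exists>\<delta>>0. \<forall>b\<in>ETOP_pts. mdist m (to_compl a) (to_compl b) < \<delta> \<longrightarrow> b \<in> {a \<in> ETOP_pts. to_compl a \<in> V}"
      using a(1) to_compl_in by (intro exI[of _ \<delta>]) auto
  qed auto
qed

text \<open>The representatives picked by the Kolmogorov quotient meet each fibre of \<open>to_compl\<close> once, since
  points with the same image have the same neighbourhoods. The map is open because an open set of
  \<open>ETOP'\<close> contains, with each point, all points mapped near its image, and \<open>to_compl\<close> is
  surjective.\<close>

lemma ETOP_homeomorphic_completion:
  "\<exists>h. homeomorphic_map (mtopology_of m) (ETOP G) h \<and> (\<forall>x\<in>points G. h (emb x) = ETOP_map G x)"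
proof -
  define K where "K = Kolmogorov_quotient (ETOP_pre G)"
  have ETOP: "ETOP G = subtopology (ETOP_pre G) (K ` ETOP_pts)"
    by (simp add: ETOP_def K_def topspace_ETOP_pre)
  have KT: "K a \<in> ETOP_pts" if "a \<in> ETOP_pts" for a
    using that Kolmogorov_quotient_in_topspace[of "ETOP_pre G" a] by (simp add: K_def topspace_ETOP_pre)
  have "topspace (ETOP G) = K ` ETOP_pts"
    using KT unfolding ETOP by (auto simp: topspace_ETOP_pre)
  have haus: "Hausdorff_space (mtopology_of m)"
    unfolding mtopology_of_def by (rule Metric_space.Hausdorff_space_mtopology[OF Metric_space_mspace_mdist])
  have kK: "to_compl (K a) = to_compl a" if "a \<in> ETOP_pts" for a
    unfolding K_def
    by (rule Kolmogorov_quotient_continuous_map[OF continuous_map_to_compl])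
       (use that haus in \<open>auto simp: topspace_ETOP_pre intro: Hausdorff_imp_t1_space t1_imp_t0_space\<close>)
  have "homeomorphic_map (ETOP G) (mtopology_of m) to_compl"
  proof (rule bijective_open_imp_homeomorphic_map)
    show "continuous_map (ETOP G) (mtopology_of m) to_compl"
      unfolding ETOP by (rule continuous_map_from_subtopology[OF continuous_map_to_compl])
    show "to_compl ` topspace (ETOP G) = topspace (mtopology_of m)"
      using to_compl_surj kK \<open>topspace (ETOP G) = K ` ETOP_pts\<close> by (force simp: image_iff)
    show "inj_on to_compl (topspace (ETOP G))"
      unfolding \<open>topspace (ETOP G) = K ` ETOP_pts\<close>
    proof (rule inj_onI)
      fix a b assume a: "a \<in> K ` ETOP_pts" and b: "b \<in> K ` ETOP_pts" and eq: "to_compl a = to_compl b"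
      have ab: "a \<in> ETOP_pts" "b \<in> ETOP_pts" using a b KT by auto
      have "b' \<in> U" if U: "openin (ETOP_pre G) U" "a' \<in> U" and b': "b' \<in> ETOP_pts" "to_compl a' = to_compl b'" for a' b' U
      proof -
        obtain \<delta> where \<delta>: "\<delta> > 0" "\<forall>b\<in>ETOP_pts. mdist m (to_compl a') (to_compl b) < \<delta> \<longrightarrow> b \<in> U"
          using U unfolding openin_ETOP_pre_iff metrically_open_def by blast
        have "mdist m (to_compl a') (to_compl b') = 0" using b' to_compl_in by simp
        then show ?thesis using \<delta> b'(1) by auto
      qed
      then have "K a = K b" unfolding K_def Kolmogorov_quotient_eq using ab eq by metis
      moreover have "K (K a') = K a'" for a' unfolding K_def by (rule Kolmogorov_quotient_idemp)
      ultimately show "a = b" using a b by auto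
    qed
    show "open_map (ETOP G) (mtopology_of m) to_compl"
      unfolding open_map_def
    proof (intro allI impI)
      fix V assume "openin (ETOP G) V"
      then obtain U where U: "openin (ETOP_pre G) U" "V = U \<inter> K ` ETOP_pts"
        unfolding ETOP openin_subtopology by blast
      have "\<exists>\<delta>>0. mball_of m c \<delta> \<subseteq> to_compl ` V" if c: "c \<in> to_compl ` V" for c
      proof -
        obtain a where a: "a \<in> U" "a \<in> K ` ETOP_pts" "c = to_compl a" using c U(2) by blast
        obtain \<delta> where \<delta>: "\<delta> > 0" "\<forall>b\<in>ETOP_pts. mdist m (to_compl a) (to_compl b) < \<delta> \<longrightarrow> b \<in> U"
          using U(1) a(1) unfolding openin_ETOP_pre_iff metrically_open_def by blast
        have "c' \<in> to_compl ` V" if c': "c' \<in> mball_of m c \<delta>" for c'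
        proof -
          have "c' \<in> mspace m" "mdist m c c' < \<delta>" using c' by auto
          then obtain b where b: "b \<in> ETOP_pts" "c' = to_compl b" using to_compl_surj by blast
          then have "b \<in> U" using \<delta>(2) \<open>mdist m c c' < \<delta>\<close> a(3) by blast
          then have "K b \<in> U" unfolding K_def using Kolmogorov_quotient_in_open[OF U(1)] by blast
          then show ?thesis using b kK U(2) by (intro image_eqI[of _ _ "K b"]) auto
        qed
        then show ?thesis using \<delta>(1) by blast
      qed
      moreover have "to_compl ` V \<subseteq> mspace m" using U(2) KT to_compl_in by blast
      ultimately show "openin (mtopology_of m) (to_compl ` V)"
        unfolding mtopology_of_def mball_of_def
        by (simp add: Metric_space.openin_mtopology[OF Metric_space_mspace_mdist])
    qed
  qed
  then obtain h where h: "homeomorphic_maps (ETOP G) (mtopology_of m) to_compl h"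
    unfolding homeomorphic_map_maps by blast
  then have "homeomorphic_map (mtopology_of m) (ETOP G) h"
    unfolding homeomorphic_map_maps using homeomorphic_maps_sym by blast
  moreover have "h (emb x) = ETOP_map G x" if x: "x \<in> points G" for x
  proof -
    have xT: "Inl x \<in> ETOP_pts" using x by (simp add: ETOP_pts_def)
    have "h (to_compl (K (Inl x))) = K (Inl x)"
      using h xT \<open>topspace (ETOP G) = K ` ETOP_pts\<close> unfolding homeomorphic_maps_def by blast
    then have "h (emb x) = K (Inl x)" by (simp add: kK[OF xT] to_compl_Inl)
    then show ?thesis by (simp add: ETOP_map_def K_def)
  qed
  ultimately show ?thesis by blast
qed

end

theorem theorem3p1:
  fixes G :: "'v graph"
    and l :: "'v set \<Rightarrow> real"
    and \<sigma> :: "'v set \<Rightarrow> ('v \<Rightarrow> real) \<Rightarrow> real"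
    and m :: "'c metric"
    and i :: "('v \<Rightarrow> real) set \<Rightarrow> 'c"
  assumes "simple_graph G"
    and "countable (verts G)"
    and "connected_graph G"
    and "\<And>e. e \<in> edges G \<Longrightarrow> 0 < l e"
    and "\<And>e. e \<in> edges G \<Longrightarrow> \<exists>\<tau>. homeomorphism (edge_pts e) {0..l e} (\<sigma> e) \<tau>"
    and "l summable_on edges G"
    and "is_completion (ident_points G \<sigma>) (ident_dist G \<sigma>) m i"
  shows "\<exists>h. homeomorphic_map (mtopology_of m) (ETOP G) h \<and>
             (\<forall>x\<in>points G. h (i (ident_class G \<sigma> x)) = ETOP_map G x)"
proof -
  interpret completed_graph G l \<sigma> m i
    by unfold_locales (fact assms)+
  show ?thesis using ETOP_homeomorphic_completion unfolding emb_def .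
qed

end
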